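(* Let $\mathcal{S}$ be a free semigroup algebra on $n$ generators acting on a Hilbert space $\mathcal{H}$. If $\mathcal{S}$ is of type L, then $\mathcal{S}$ has a wandering vector.
   Context: Let $n\in\{1,2,3,\dots\}\cup\{\infty\}$. A free semigroup algebra $\mathcal{S}$ on $n$ generators is the weak-operator-closed (in general non-self-adjoint) subalgebra of $\mathcal{B}(\mathcal{H})$ generated by the identity and isometries $S_1,\dots,S_n$ on a complex Hilbert space $\mathcal{H}$ satisfying $S_i^*S_i=I$ and $S_i^*S_j=0$ for $i\neq j$. $\mathbb{F}_n^+$ denotes the free semigroup (with the empty word $\varnothing$) on the letters $\{1,\dots,n\}$. For $w=i_1\cdots i_k\in\mathbb{F}_n^+$ put $S_w=S_{i_1}\cdots S_{i_k}$ and $S_\varnothing=I$. Let $\mathcal{F}_n=\ell^2(\mathbb{F}_n^+)$ with orthonormal basis $\{\xi_w\}$, and let $L_v\xi_w=\xi_{vw}$. The free semigroup algebra generated by $L_1,\dots,L_n$ is denoted $\mathcal{L}_n$ (the non-commutative analytic Toeplitz algebra). A free semigroup algebra on $n$ generators is of type L if it is algebraically isomorphic to $\mathcal{L}_n$. A unit vector $x\in\mathcal{H}$ is wandering for $\mathcal{S}$ if the set $\{S_wx:w\in\mathbb{F}_n^+\}$ is orthonormal (i.e. $(S_ux,S_vx)=0$ for distinct words $u,v$). *)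

theory Defs
  imports "HOL-Analysis.Analysis" "HOL-Library.Countable"
begin

section \<open>Complex Hilbert spaces\<close>

text \<open>
  The inner product \<open>cinner\<close> is linear in its first and conjugate-linear in its second argument.
  Its real part is the inner product of the class \<^class>\<open>real_inner\<close>, from which norm and metric
  are inherited; positive definiteness is part of that class.
\<close>

class complex_hilbert = real_inner + complete_space +
  fixes scaleC :: "complex \<Rightarrow> 'a \<Rightarrow> 'a" (infixr "*\<^sub>C" 75)
    and cinner :: "'a \<Rightarrow> 'a \<Rightarrow> complex"
  assumes scaleC_add_right: "c *\<^sub>C (x + y) = c *\<^sub>C x + c *\<^sub>C y"
    and scaleC_add_left: "(c + d) *\<^sub>C x = c *\<^sub>C x + d *\<^sub>C x"
    and scaleC_scaleC: "c *\<^sub>C (d *\<^sub>C x) = (c * d) *\<^sub>C x"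
    and scaleC_of_real: "complex_of_real r *\<^sub>C x = r *\<^sub>R x"
    and cinner_add_left: "cinner (x + y) z = cinner x z + cinner y z"
    and cinner_scaleC_left: "cinner (c *\<^sub>C x) y = c * cinner x y"
    and cinner_cnj: "cinner y x = cnj (cinner x y)"
    and inner_eq_Re_cinner: "inner x y = Re (cinner x y)"

text \<open>\<open>bounded_clinear\<close> is membership in \<open>\<B>(\<H>)\<close>; operators are plain functions.\<close>

definition bounded_clinear :: "('a::complex_hilbert \<Rightarrow> 'a) \<Rightarrow> bool" where
  "bounded_clinear T \<longleftrightarrow> bounded_linear T \<and> (\<forall>c x. T (c *\<^sub>C x) = c *\<^sub>C T x)"

definition cadjoint :: "('a::complex_hilbert \<Rightarrow> 'a) \<Rightarrow> ('a \<Rightarrow> 'a)" where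
  "cadjoint T = (THE T'. \<forall>x y. cinner (T x) y = cinner x (T' y))"

lemma scaleC_one [simp]: "1 *\<^sub>C (x::'a::complex_hilbert) = x"
  using scaleC_of_real[of 1 x] by simp

lemma cinner_add_right: "cinner x (y + z) = cinner x y + cinner x (z::'a::complex_hilbert)"
  using cinner_add_left[of y z x] by (simp add: cinner_cnj[of x])

lemma cinner_scaleC_right: "cinner x (c *\<^sub>C y) = cnj c * cinner x (y::'a::complex_hilbert)"
  using cinner_scaleC_left[of c y x] by (simp add: cinner_cnj[of x])

lemma Im_cinner: "Im (cinner x y) = - inner (\<i> *\<^sub>C x) (y::'a::complex_hilbert)"
  by (simp add: inner_eq_Re_cinner cinner_scaleC_left)

lemma cinner_eqI:
  assumes "\<And>x. cinner x y = cinner x (z::'a::complex_hilbert)"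
  shows "y = z"
proof -
  have "inner x y = inner x z" for x
    by (simp add: inner_eq_Re_cinner assms)
  from this[of "y - z"] have "inner (y - z) (y - z) = 0"
    by (simp add: inner_diff_right)
  then show ?thesis by simp
qed

lemma riesz_real:
  fixes f :: "'a::{real_inner,complete_space} \<Rightarrow> real"
  assumes "bounded_linear f"
  shows "\<exists>z. \<forall>v. f v = inner v z"
proof -
  interpret f: bounded_linear f by fact
  obtain K where K: "\<And>x. \<bar>f x\<bar> \<le> norm x * K" using f.bounded by auto
  define J where "J x = (norm x)\<^sup>2 - 2 * f x" for x
  have J_lower: "- K\<^sup>2 \<le> J x" for x
  proof -
    have "0 \<le> (norm x - K)\<^sup>2" by simp
    then show ?thesis using K[of x] by (simp add: J_def power2_diff)
  qed
  define m where "m = Inf (range J)"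
  have bdd: "bdd_below (range J)" using J_lower by (auto intro!: bdd_belowI)
  have m_le: "m \<le> J x" for x unfolding m_def by (intro cInf_lower bdd) auto
  have "\<exists>x. J x < m + 1 / Suc n" for n
  proof -
    have "Inf (range J) < m + 1 / Suc n" by (simp add: m_def)
    then show ?thesis by (subst (asm) cInf_less_iff[OF _ bdd]) auto
  qed
  then obtain X where X: "\<And>n. J (X n) < m + 1 / Suc n" by metis
  have par: "(norm (x - y))\<^sup>2 \<le> 2 * (J x - m) + 2 * (J y - m)" for x y
  proof -
    have "(norm (x - y))\<^sup>2 = 2 * J x + 2 * J y - 4 * J ((1/2) *\<^sub>R (x + y))"
      unfolding J_def power2_norm_eq_inner
      by (simp add: f.add f.scaleR algebra_simps inner_commute)
    then show ?thesis using m_le[of "(1/2) *\<^sub>R (x + y)"] by simp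
  qed
  have "Cauchy X"
  proof (rule metric_CauchyI)
    fix e :: real assume "e > 0"
    then obtain N where N: "N \<noteq> 0" "inverse (real N) < e\<^sup>2 / 4"
      using real_arch_inverse[of "e\<^sup>2/4"] by auto
    have small: "4 * (J (X k) - m) < e\<^sup>2" if "k \<ge> N" for k
    proof -
      have "1 / real (Suc k) \<le> inverse (real N)"
        using that N(1) by (simp add: field_simps)
      then have "J (X k) - m < e\<^sup>2 / 4" using X[of k] N(2) by linarith
      then show ?thesis by simp
    qed
    have "dist (X k) (X l) < e" if "k \<ge> N" "l \<ge> N" for k l
    proof -
      have "(norm (X k - X l))\<^sup>2 < e\<^sup>2"
        using par[of "X k" "X l"] small[OF that(1)] small[OF that(2)] by linarith
      then show ?thesis using \<open>e > 0\<close> by (simp add: dist_norm power_less_imp_less_base)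
    qed
    then show "\<exists>M. \<forall>k\<ge>M. \<forall>l\<ge>M. dist (X k) (X l) < e" by blast
  qed
  then obtain z where z: "X \<longlonglongrightarrow> z" using Cauchy_convergent convergent_def by blast
  have "(\<lambda>n. J (X n)) \<longlonglongrightarrow> J z"
    unfolding J_def by (intro tendsto_intros z f.tendsto)
  moreover have "(\<lambda>n. m + 1 / Suc n) \<longlonglongrightarrow> m + 0"
    by (intro tendsto_intros LIMSEQ_Suc[OF lim_1_over_n])
  ultimately have "J z \<le> m + 0"
    by (rule LIMSEQ_le) (use X less_imp_le in blast)
  then have min: "J z \<le> J x" for x using m_le[of x] by simp
  have "f v = inner v z" for v
  proof -
    define a where "a = inner v z - f v"
    have ge: "0 \<le> 2 * t * a + t\<^sup>2 * inner v v" for t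
      using min[of "z + t *\<^sub>R v"]
      unfolding J_def power2_norm_eq_inner a_def
      by (simp add: f.add f.scaleR algebra_simps inner_commute power2_eq_square)
    have "a = 0"
    proof (cases "inner v v = 0")
      case True
      then show ?thesis using ge[of "-1"] ge[of 1] by simp
    next
      case False
      then have pos: "inner v v > 0" by (simp add: less_le)
      have "0 \<le> 2 * (- a / inner v v) * a + (- a / inner v v)\<^sup>2 * inner v v" by (rule ge)
      also have "\<dots> = - (a\<^sup>2 / inner v v)"
        using pos by (simp add: field_simps power2_eq_square)
      finally have "a\<^sup>2 / inner v v \<le> 0" by simp
      then show ?thesis using pos by (simp add: divide_le_0_iff)
    qed
    then show ?thesis by (simp add: a_def)
  qed
  then show ?thesis by blast
qed

lemma cadjoint_unique:
  assumes "\<And>x y. cinner (T x) y = cinner x (T' y)"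
  shows "cadjoint T = T'"
  unfolding cadjoint_def
proof (rule the_equality)
  show "\<forall>x y. cinner (T x) y = cinner x (T' y)" using assms by blast
next
  fix R assume "\<forall>x y. cinner (T x) y = cinner x (R y)"
  then show "R = T'" using assms by (intro ext cinner_eqI) metis
qed

lemma cadjoint_works:
  assumes "bounded_clinear T"
  shows "cinner (T x) y = cinner x (cadjoint T y)"
proof -
  interpret T: bounded_linear T using assms by (simp add: bounded_clinear_def)
  have "\<exists>z. \<forall>x. inner (T x) y = inner x z" for y
    by (rule riesz_real) (intro bounded_linear_inner_left_comp T.bounded_linear_axioms)
  then obtain R where R: "\<And>x y. inner (T x) y = inner x (R y)" by metis
  have "cinner (T x) y = cinner x (R y)" for x y
  proof (rule complex_eqI)
    show "Re (cinner (T x) y) = Re (cinner x (R y))"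
      using R by (simp add: inner_eq_Re_cinner)
    have "T (\<i> *\<^sub>C x) = \<i> *\<^sub>C T x" using assms by (simp add: bounded_clinear_def)
    then show "Im (cinner (T x) y) = Im (cinner x (R y))"
      using R[of "\<i> *\<^sub>C x" y] by (simp add: Im_cinner)
  qed
  then show ?thesis using cadjoint_unique[of T R] by simp
qed


section \<open>The weak operator topology and WOT-closed algebras\<close>

text \<open>
  The weakest topology on \<open>\<B>(\<H>)\<close> making all the maps \<open>T \<mapsto> (Tx, y)\<close> continuous.
\<close>

definition wot :: "('a::complex_hilbert \<Rightarrow> 'a) topology" where
  "wot = pullback_topology {T. bounded_clinear T} (\<lambda>T (x, y). cinner (T x) y)
           (product_topology (\<lambda>_. euclidean) UNIV)"

definition operator_algebra :: "('a::complex_hilbert \<Rightarrow> 'a) set \<Rightarrow> bool" where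
  "operator_algebra A \<longleftrightarrow>
     A \<subseteq> {T. bounded_clinear T} \<and>
     (\<lambda>_. 0) \<in> A \<and>
     (\<forall>T\<in>A. \<forall>R\<in>A. (\<lambda>x. T x + R x) \<in> A) \<and>
     (\<forall>c. \<forall>T\<in>A. (\<lambda>x. c *\<^sub>C T x) \<in> A) \<and>
     (\<forall>T\<in>A. \<forall>R\<in>A. T \<circ> R \<in> A)"

definition wot_algebra_generated :: "('a::complex_hilbert \<Rightarrow> 'a) set \<Rightarrow> ('a \<Rightarrow> 'a) set" where
  "wot_algebra_generated G = \<Inter>{A. operator_algebra A \<and> closedin wot A \<and> G \<subseteq> A}"

definition algebra_isomorphism ::
  "('a::complex_hilbert \<Rightarrow> 'a) set \<Rightarrow> ('b::complex_hilbert \<Rightarrow> 'b) set \<Rightarrow>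
   (('a \<Rightarrow> 'a) \<Rightarrow> ('b \<Rightarrow> 'b)) \<Rightarrow> bool" where
  "algebra_isomorphism A B \<phi> \<longleftrightarrow>
     bij_betw \<phi> A B \<and>
     (\<forall>T\<in>A. \<forall>R\<in>A. \<phi> (\<lambda>x. T x + R x) = (\<lambda>x. \<phi> T x + \<phi> R x)) \<and>
     (\<forall>c. \<forall>T\<in>A. \<phi> (\<lambda>x. c *\<^sub>C T x) = (\<lambda>x. c *\<^sub>C \<phi> T x)) \<and>
     (\<forall>T\<in>A. \<forall>R\<in>A. \<phi> (T \<circ> R) = \<phi> T \<circ> \<phi> R)"

definition algebraically_isomorphic ::
  "('a::complex_hilbert \<Rightarrow> 'a) set \<Rightarrow> ('b::complex_hilbert \<Rightarrow> 'b) set \<Rightarrow> bool" where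
  "algebraically_isomorphic A B \<longleftrightarrow> (\<exists>\<phi>. algebra_isomorphism A B \<phi>)"

lemma topspace_wot: "topspace wot = {T. bounded_clinear T}"
  by (simp add: wot_def topspace_pullback_topology)

lemma limitin_wot:
  "limitin wot f T F \<longleftrightarrow>
     bounded_clinear T \<and> (\<forall>\<^sub>F s in F. bounded_clinear (f s)) \<and>
     (\<forall>x y. ((\<lambda>s. cinner (f s x) y) \<longlongrightarrow> cinner (T x) y) F)"
  (is "?L \<longleftrightarrow> ?R")
proof -
  let ?m = "\<lambda>T (x, y). cinner (T x) (y::'a)"
  let ?P = "product_topology (\<lambda>_::'a \<times> 'a. euclidean :: complex topology) UNIV"
  have coord: "limitin ?P (\<lambda>s. ?m (f s)) (?m T) F
      \<longleftrightarrow> (\<forall>x y. ((\<lambda>s. cinner (f s x) y) \<longlongrightarrow> cinner (T x) y) F)"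
    by (simp add: limitin_componentwise split: prod.splits)
  show ?thesis
  proof
    assume L: ?L
    have T: "bounded_clinear T" using limitin_topspace[OF L] by (simp add: topspace_wot)
    have "\<forall>\<^sub>F s in F. f s \<in> topspace wot"
      using L limitin_topspace[OF L] unfolding limitin_def by blast
    moreover have "limitin ?P (\<lambda>s. ?m (f s)) (?m T) F"
      unfolding limitin_def
    proof (intro conjI allI impI)
      fix U assume U: "openin ?P U \<and> ?m T \<in> U"
      then have "openin wot (?m -` U \<inter> {T. bounded_clinear T})"
        unfolding wot_def openin_pullback_topology by blast
      with L U T have "\<forall>\<^sub>F s in F. f s \<in> ?m -` U \<inter> {T. bounded_clinear T}"
        unfolding limitin_def by blast
      then show "\<forall>\<^sub>F s in F. ?m (f s) \<in> U" by (rule eventually_mono) auto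
    qed auto
    ultimately show ?R using T coord by (simp add: topspace_wot)
  next
    assume R: ?R
    then have lim: "limitin ?P (\<lambda>s. ?m (f s)) (?m T) F" using coord by blast
    show ?L unfolding limitin_def
    proof (intro conjI allI impI)
      show "T \<in> topspace wot" using R by (simp add: topspace_wot)
      fix V assume "openin wot V \<and> T \<in> V"
      then obtain U where U: "openin ?P U" "V = ?m -` U \<inter> {T. bounded_clinear T}" "?m T \<in> U"
        unfolding wot_def openin_pullback_topology by auto
      then have "\<forall>\<^sub>F s in F. ?m (f s) \<in> U" using lim unfolding limitin_def by blast
      with R show "\<forall>\<^sub>F s in F. f s \<in> V" unfolding U(2)
        by (auto elim: eventually_elim2)
    qed
  qed
qed

lemma operator_algebra_bounded_clinear: "operator_algebra {T. bounded_clinear T}"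
proof -
  have "linear (\<lambda>x::'a. c *\<^sub>C x)" for c
    by (rule linearI)
      (simp_all add: scaleC_add_right scaleC_scaleC mult.commute flip: scaleC_of_real)
  moreover have "norm (c *\<^sub>C (x::'a)) = norm x * cmod c" for c x
  proof -
    have "cinner (c *\<^sub>C x) (c *\<^sub>C x) = complex_of_real ((cmod c)\<^sup>2) * cinner x x"
      unfolding cinner_scaleC_left cinner_scaleC_right complex_norm_square by simp
    then show ?thesis
      by (simp add: norm_eq_sqrt_inner inner_eq_Re_cinner real_sqrt_mult)
  qed
  ultimately have scale: "bounded_linear (\<lambda>x::'a. c *\<^sub>C x)" for c
    unfolding bounded_linear_def bounded_linear_axioms_def
    by (metis order_refl)
  have zero: "c *\<^sub>C 0 = (0::'a)" for c
    by (metis scaleC_add_right add_cancel_right_left add.right_neutral)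
  show ?thesis
    unfolding operator_algebra_def mem_Collect_eq
  proof (intro conjI ballI allI subset_refl)
    fix c and T R :: "'a \<Rightarrow> 'a"
    show "bounded_clinear (\<lambda>_. 0 :: 'a)"
      by (simp add: bounded_clinear_def zero bounded_linear_zero)
    assume "T \<in> {T. bounded_clinear T}"
    then have T: "bounded_linear T" "\<And>c x. T (c *\<^sub>C x) = c *\<^sub>C T x"
      by (auto simp: bounded_clinear_def)
    show "bounded_clinear (\<lambda>x. c *\<^sub>C T x)"
      unfolding bounded_clinear_def
      using bounded_linear_compose[OF scale T(1)] by (simp add: T(2) scaleC_scaleC mult.commute)
    assume "R \<in> {T. bounded_clinear T}"
    then have R: "bounded_linear R" "\<And>c x. R (c *\<^sub>C x) = c *\<^sub>C R x"
      by (auto simp: bounded_clinear_def)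
    show "bounded_clinear (\<lambda>x. T x + R x)"
      unfolding bounded_clinear_def
      using bounded_linear_add[OF T(1) R(1)] by (simp add: T(2) R(2) scaleC_add_right)
    show "bounded_clinear (T \<circ> R)"
      unfolding bounded_clinear_def o_def
      using bounded_linear_compose[OF T(1) R(1)] by (simp add: T(2) R(2))
  qed
qed

lemma wot_algebra_generated:
  assumes "\<And>T. T \<in> G \<Longrightarrow> bounded_clinear T"
  shows "operator_algebra (wot_algebra_generated G)"
    and "closedin wot (wot_algebra_generated G)"
    and "G \<subseteq> wot_algebra_generated G"
proof -
  let ?F = "{A. operator_algebra A \<and> closedin wot A \<and> G \<subseteq> A}"
  have mem: "{T. bounded_clinear T} \<in> ?F"
    using operator_algebra_bounded_clinear assms closedin_topspace[of wot]
    by (auto simp: topspace_wot)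
  then show "closedin wot (wot_algebra_generated G)"
    unfolding wot_algebra_generated_def by (intro closedin_Inter) auto
  show "G \<subseteq> wot_algebra_generated G" by (auto simp: wot_algebra_generated_def)
  have "wot_algebra_generated G \<subseteq> {T. bounded_clinear T}"
    unfolding wot_algebra_generated_def by (rule Inter_lower[OF mem])
  then show "operator_algebra (wot_algebra_generated G)"
    unfolding operator_algebra_def[of "wot_algebra_generated G"]
    unfolding wot_algebra_generated_def
    by (intro conjI) (auto simp: operator_algebra_def)
qed


section \<open>Free semigroup algebras\<close>

text \<open>
  The generators are indexed by a type \<open>'i\<close> of class \<^class>\<open>countable\<close>, so the number \<open>n\<close> of
  generators is \<open>CARD('i)\<close> if \<open>'i\<close> is finite and \<open>\<infinity>\<close> otherwise; types being inhabited, \<open>n \<ge> 1\<close>.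
  The free semigroup with unit on \<open>'i\<close> is \<open>'i list\<close>.
\<close>

definition isometries_with_orthogonal_ranges ::
  "('i::countable \<Rightarrow> 'a::complex_hilbert \<Rightarrow> 'a) \<Rightarrow> bool" where
  "isometries_with_orthogonal_ranges S \<longleftrightarrow>
     (\<forall>i. bounded_clinear (S i)) \<and>
     (\<forall>i. cadjoint (S i) \<circ> S i = id) \<and>
     (\<forall>i j. i \<noteq> j \<longrightarrow> cadjoint (S i) \<circ> S j = (\<lambda>_. 0))"

definition free_semigroup_algebra ::
  "('i::countable \<Rightarrow> 'a::complex_hilbert \<Rightarrow> 'a) \<Rightarrow> ('a \<Rightarrow> 'a) set" where
  "free_semigroup_algebra S = wot_algebra_generated (insert id (range S))"

primrec word_op :: "('i \<Rightarrow> 'a \<Rightarrow> 'a) \<Rightarrow> 'i list \<Rightarrow> 'a \<Rightarrow> 'a" where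
  "word_op S [] = id"
| "word_op S (i # w) = S i \<circ> word_op S w"

definition wandering :: "('i \<Rightarrow> 'a::complex_hilbert \<Rightarrow> 'a) \<Rightarrow> 'a \<Rightarrow> bool" where
  "wandering S x \<longleftrightarrow> norm x = 1 \<and>
     (\<forall>u. norm (word_op S u x) = 1) \<and>
     (\<forall>u v. u \<noteq> v \<longrightarrow> cinner (word_op S u x) (word_op S v x) = 0)"

lemma isometries_with_orthogonal_ranges_iff:
  fixes S :: "'i::countable \<Rightarrow> 'a::complex_hilbert \<Rightarrow> 'a"
  shows "isometries_with_orthogonal_ranges S \<longleftrightarrow>
     (\<forall>i. bounded_clinear (S i)) \<and>
     (\<forall>i j x y. cinner (S i x) (S j y) = (if i = j then cinner x y else 0))"
  (is "?L \<longleftrightarrow> ?R")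
proof -
  have zero: "cinner x 0 = 0" for x :: 'a
    using cinner_add_right[of x 0 0] by simp
  show ?thesis
  proof
    assume L: ?L
    then have bdd: "bounded_clinear (S i)" for i
      by (simp add: isometries_with_orthogonal_ranges_def)
    have "cinner (S i x) (S j y) = (if i = j then cinner x y else 0)" for i j x y
      using L unfolding isometries_with_orthogonal_ranges_def cadjoint_works[OF bdd]
      by (auto simp: fun_eq_iff zero)
    with bdd show ?R by blast
  next
    assume R: ?R
    have "cadjoint (S i) (S i y) = y" for i y
      using R by (intro cinner_eqI) (auto simp flip: cadjoint_works)
    moreover have "cadjoint (S i) (S j y) = 0" if "i \<noteq> j" for i j y
      using R that by (intro cinner_eqI) (auto simp: zero simp flip: cadjoint_works)
    ultimately show ?L
      using R by (auto simp: isometries_with_orthogonal_ranges_def fun_eq_iff)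
  qed
qed


section \<open>The Hilbert space \<open>\<ell>\<^sup>2\<close> over an index type\<close>

typedef 'w ell2 = "{f :: 'w \<Rightarrow> complex. (\<lambda>w. (cmod (f w))\<^sup>2) summable_on UNIV}"
  morphisms ell2_coord Abs_ell2
  by (rule exI[of _ "\<lambda>_. 0"]) simp

setup_lifting type_definition_ell2

lemma ell2_mult_summable:
  fixes f g :: "'w \<Rightarrow> complex"
  assumes "(\<lambda>w. (cmod (f w))\<^sup>2) summable_on A" "(\<lambda>w. (cmod (g w))\<^sup>2) summable_on A"
  shows "(\<lambda>w. f w * cnj (g w)) summable_on A"
proof (rule Infinite_Sum.abs_summable_summable, rule Infinite_Sum.abs_summable_on_comparison_test')
  show "(\<lambda>w. (cmod (f w))\<^sup>2 + (cmod (g w))\<^sup>2) summable_on A"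
    by (intro summable_on_add assms)
  fix w
  have "0 \<le> (cmod (f w) - cmod (g w))\<^sup>2" by simp
  then have "2 * (cmod (f w) * cmod (g w)) \<le> (cmod (f w))\<^sup>2 + (cmod (g w))\<^sup>2"
    by (simp add: power2_diff)
  moreover have "0 \<le> cmod (f w) * cmod (g w)" by simp
  ultimately have "cmod (f w) * cmod (g w) \<le> (cmod (f w))\<^sup>2 + (cmod (g w))\<^sup>2"
    by linarith
  then show "norm (f w * cnj (g w)) \<le> (cmod (f w))\<^sup>2 + (cmod (g w))\<^sup>2"
    by (simp add: norm_mult)
qed

lemma ell2_add_summable:
  fixes f g :: "'w \<Rightarrow> complex"
  assumes "(\<lambda>w. (cmod (f w))\<^sup>2) summable_on A" "(\<lambda>w. (cmod (g w))\<^sup>2) summable_on A"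
  shows "(\<lambda>w. (cmod (f w + g w))\<^sup>2) summable_on A"
proof (rule summable_on_comparison_test)
  show "(\<lambda>w. 2 * (cmod (f w))\<^sup>2 + 2 * (cmod (g w))\<^sup>2) summable_on A"
    by (intro summable_on_add summable_on_cmult_right assms)
  fix w
  have "(cmod (f w + g w))\<^sup>2 \<le> (cmod (f w) + cmod (g w))\<^sup>2"
    by (intro power_mono norm_triangle_ineq) auto
  moreover have "0 \<le> (cmod (f w) - cmod (g w))\<^sup>2" by simp
  ultimately show "(cmod (f w + g w))\<^sup>2 \<le> 2 * (cmod (f w))\<^sup>2 + 2 * (cmod (g w))\<^sup>2"
    by (simp add: power2_diff power2_sum)
qed simp

lemma ell2_cmult_summable:
  fixes f :: "'w \<Rightarrow> complex"
  assumes "(\<lambda>w. (cmod (f w))\<^sup>2) summable_on A"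
  shows "(\<lambda>w. (cmod (c * f w))\<^sup>2) summable_on A"
  unfolding norm_mult power_mult_distrib by (intro summable_on_cmult_right assms)

instantiation ell2 :: (type) real_inner
begin

lift_definition zero_ell2 :: "'a ell2" is "\<lambda>_. 0" by simp

lift_definition plus_ell2 :: "'a ell2 \<Rightarrow> 'a ell2 \<Rightarrow> 'a ell2" is "\<lambda>f g w. f w + g w"
  by (rule ell2_add_summable)

lift_definition uminus_ell2 :: "'a ell2 \<Rightarrow> 'a ell2" is "\<lambda>f w. - f w" by simp

lift_definition minus_ell2 :: "'a ell2 \<Rightarrow> 'a ell2 \<Rightarrow> 'a ell2" is "\<lambda>f g w. f w - g w"
  by (subst diff_conv_add_uminus, rule ell2_add_summable) simp_all

lift_definition scaleR_ell2 :: "real \<Rightarrow> 'a ell2 \<Rightarrow> 'a ell2" is "\<lambda>r f w. complex_of_real r * f w"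
  by (rule ell2_cmult_summable)

lift_definition inner_ell2 :: "'a ell2 \<Rightarrow> 'a ell2 \<Rightarrow> real"
  is "\<lambda>f g. Re (\<Sum>\<^sub>\<infinity>w. f w * cnj (g w))" .

definition norm_ell2 :: "'a ell2 \<Rightarrow> real" where "norm_ell2 x = sqrt (inner x x)"
definition dist_ell2 :: "'a ell2 \<Rightarrow> 'a ell2 \<Rightarrow> real" where "dist_ell2 x y = norm (x - y)"
definition sgn_ell2 :: "'a ell2 \<Rightarrow> 'a ell2" where "sgn_ell2 x = inverse (norm x) *\<^sub>R x"
definition uniformity_ell2 :: "('a ell2 \<times> 'a ell2) filter" where
  "uniformity_ell2 = (INF e\<in>{0<..}. principal {(x, y). dist x y < e})"
definition open_ell2 :: "'a ell2 set \<Rightarrow> bool" where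
  "open_ell2 U = (\<forall>x\<in>U. \<forall>\<^sub>F (x', y) in uniformity. x' = x \<longrightarrow> y \<in> U)"

lemma inner_ell2_self: "inner x x = (\<Sum>\<^sub>\<infinity>w. (cmod (ell2_coord x w))\<^sup>2)" for x :: "'a ell2"
proof -
  have "inner x x = Re (\<Sum>\<^sub>\<infinity>w. complex_of_real ((cmod (ell2_coord x w))\<^sup>2))"
    unfolding inner_ell2.rep_eq complex_norm_square ..
  also have "\<dots> = (\<Sum>\<^sub>\<infinity>w. Re (complex_of_real ((cmod (ell2_coord x w))\<^sup>2)))"
    using ell2_coord[of x] by (intro infsum_Re[symmetric] summable_on_of_real) simp
  finally show ?thesis by simp
qed

instance
proof
  fix x y z :: "'a ell2" and r s :: real
  show "x + y + z = x + (y + z)" by transfer (simp add: add.assoc)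
  show "x + y = y + x" by transfer (simp add: add.commute)
  show "0 + x = x" by transfer simp
  show "- x + x = 0" by transfer simp
  show "x - y = x + - y" by transfer simp
  show "r *\<^sub>R (x + y) = r *\<^sub>R x + r *\<^sub>R y" by transfer (simp add: distrib_left)
  show "(r + s) *\<^sub>R x = r *\<^sub>R x + s *\<^sub>R x" by transfer (simp add: distrib_right)
  show "r *\<^sub>R s *\<^sub>R x = (r * s) *\<^sub>R x" by transfer (simp add: mult.assoc)
  show "1 *\<^sub>R x = x" by transfer simp
  show "dist x y = norm (x - y)" by (rule dist_ell2_def)
  show "sgn x = inverse (norm x) *\<^sub>R x" by (rule sgn_ell2_def)
  show "(uniformity :: ('a ell2 \<times> 'a ell2) filter)
      = (INF e\<in>{0<..}. principal {(x, y). dist x y < e})"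
    by (rule uniformity_ell2_def)
  show "open U = (\<forall>x\<in>U. \<forall>\<^sub>F (x', y) in uniformity. x' = x \<longrightarrow> y \<in> U)" for U :: "'a ell2 set"
    by (rule open_ell2_def)
  show "norm x = sqrt (inner x x)" by (rule norm_ell2_def)
  show "inner x y = inner y x"
  proof transfer
    fix f g :: "'a \<Rightarrow> complex"
    have "(\<Sum>\<^sub>\<infinity>w. f w * cnj (g w)) = cnj (\<Sum>\<^sub>\<infinity>w. g w * cnj (f w))"
      by (subst infsum_cnj[symmetric]) (simp add: mult.commute)
    then show "Re (\<Sum>\<^sub>\<infinity>w. f w * cnj (g w)) = Re (\<Sum>\<^sub>\<infinity>w. g w * cnj (f w))" by simp
  qed
  show "inner (x + y) z = inner x z + inner y z"
    by transfer (simp add: distrib_right infsum_add ell2_mult_summable)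
  show "inner (r *\<^sub>R x) y = r * inner x y"
    by transfer (simp add: mult.assoc infsum_cmult_right')
  show "0 \<le> inner x x" unfolding inner_ell2_self by (intro infsum_nonneg) simp
  show "inner x x = 0 \<longleftrightarrow> x = 0"
  proof
    assume "inner x x = 0"
    then have "(cmod (ell2_coord x w))\<^sup>2 = 0" for w
      using nonneg_infsum_le_0D[of "\<lambda>w. (cmod (ell2_coord x w))\<^sup>2" UNIV w] ell2_coord[of x]
      by (simp add: inner_ell2_self)
    then show "x = 0" by (simp add: ell2_coord_inject[symmetric] zero_ell2.rep_eq fun_eq_iff)
  next
    assume "x = 0"
    then show "inner x x = 0" by (simp add: inner_ell2_self zero_ell2.rep_eq)
  qed
qed

end

lemma ell2_sum_le_norm:
  assumes "finite F"
  shows "(\<Sum>w\<in>F. (cmod (ell2_coord x w))\<^sup>2) \<le> (norm x)\<^sup>2"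
  unfolding power2_norm_eq_inner[of x] inner_ell2_self
  using ell2_coord[of x] by (intro finite_sum_le_infsum) (auto simp: assms)

lemma ell2_coord_le_norm: "cmod (ell2_coord x w) \<le> norm x"
  using ell2_sum_le_norm[of "{w}" x] by - (rule power2_le_imp_le, simp_all)

instance ell2 :: (type) complete_space
proof
  fix X :: "nat \<Rightarrow> 'a ell2" assume X: "Cauchy X"
  have "Cauchy (\<lambda>n. ell2_coord (X n) w)" for w
  proof (rule metric_CauchyI)
    fix e :: real assume "e > 0"
    then obtain M where M: "\<And>m n. m \<ge> M \<Longrightarrow> n \<ge> M \<Longrightarrow> dist (X m) (X n) < e"
      using metric_CauchyD[OF X] by blast
    have "dist (ell2_coord (X m) w) (ell2_coord (X n) w) \<le> dist (X m) (X n)" for m n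
      using ell2_coord_le_norm[of "X m - X n" w] by (simp add: dist_norm minus_ell2.rep_eq)
    then show "\<exists>M. \<forall>m\<ge>M. \<forall>n\<ge>M. dist (ell2_coord (X m) w) (ell2_coord (X n) w) < e"
      using M by (meson order_le_less_trans)
  qed
  then have "\<exists>l. (\<lambda>n. ell2_coord (X n) w) \<longlonglongrightarrow> l" for w
    using Cauchy_convergent convergent_def by blast
  then obtain g where g: "\<And>w. (\<lambda>n. ell2_coord (X n) w) \<longlonglongrightarrow> g w" by metis
  have bound: "(\<Sum>w\<in>F. (cmod (g w - ell2_coord (X n) w))\<^sup>2) \<le> e\<^sup>2"
    if "finite F" "n \<ge> M" and M: "\<And>m n. m \<ge> M \<Longrightarrow> n \<ge> M \<Longrightarrow> dist (X m) (X n) < e"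
    for F n M and e :: real
  proof (rule LIMSEQ_le_const2)
    show "(\<lambda>m. \<Sum>w\<in>F. (cmod (ell2_coord (X m) w - ell2_coord (X n) w))\<^sup>2)
        \<longlonglongrightarrow> (\<Sum>w\<in>F. (cmod (g w - ell2_coord (X n) w))\<^sup>2)"
      by (intro tendsto_intros g)
    have "(\<Sum>w\<in>F. (cmod (ell2_coord (X m) w - ell2_coord (X n) w))\<^sup>2) \<le> e\<^sup>2" if "m \<ge> M" for m
    proof -
      have "(\<Sum>w\<in>F. (cmod (ell2_coord (X m) w - ell2_coord (X n) w))\<^sup>2) \<le> (norm (X m - X n))\<^sup>2"
        using ell2_sum_le_norm[OF \<open>finite F\<close>, of "X m - X n"] by (simp add: minus_ell2.rep_eq)
      also have "\<dots> \<le> e\<^sup>2"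
        using M[OF that \<open>n \<ge> M\<close>] by (intro power_mono) (auto simp: dist_norm)
      finally show ?thesis .
    qed
    then show "\<exists>N. \<forall>m\<ge>N. (\<Sum>w\<in>F. (cmod (ell2_coord (X m) w - ell2_coord (X n) w))\<^sup>2) \<le> e\<^sup>2"
      by blast
  qed
  have diff_summable: "(\<lambda>w. (cmod (g w - ell2_coord (X n) w))\<^sup>2) summable_on UNIV"
    if "n \<ge> M" and M: "\<And>m n. m \<ge> M \<Longrightarrow> n \<ge> M \<Longrightarrow> dist (X m) (X n) < e" for n M and e :: real
    using bound[OF _ that]
    by (intro nonneg_bdd_above_summable_on bdd_aboveI2[where M = "e\<^sup>2"]) auto
  obtain M where M: "\<And>m n. m \<ge> M \<Longrightarrow> n \<ge> M \<Longrightarrow> dist (X m) (X n) < 1"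
    using metric_CauchyD[OF X, of 1] by auto
  have "(\<lambda>w. (cmod ((g w - ell2_coord (X M) w) + ell2_coord (X M) w))\<^sup>2) summable_on UNIV"
    using ell2_coord[of "X M"] by (intro ell2_add_summable diff_summable[OF order_refl M]) auto
  then have "g \<in> {f. (\<lambda>w. (cmod (f w))\<^sup>2) summable_on UNIV}" by simp
  then obtain G where G: "ell2_coord G = g" using Abs_ell2_inverse by blast
  have "X \<longlonglongrightarrow> G"
  proof (rule metric_LIMSEQ_I)
    fix r :: real assume "r > 0"
    then obtain M where M: "\<And>m n. m \<ge> M \<Longrightarrow> n \<ge> M \<Longrightarrow> dist (X m) (X n) < r/2"
      using metric_CauchyD[OF X, of "r/2"] by auto
    have "dist (X n) G < r" if "n \<ge> M" for n
    proof -
      have "(norm (G - X n))\<^sup>2 \<le> (r/2)\<^sup>2"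
        unfolding power2_norm_eq_inner[of "G - X n"] inner_ell2_self minus_ell2.rep_eq G
        by (intro infsum_le_finite_sums diff_summable[OF that M] bound[OF _ that M]) auto
      then have "norm (G - X n) \<le> r/2"
        by (rule power2_le_imp_le) (use \<open>r > 0\<close> in simp)
      then show ?thesis using \<open>r > 0\<close> by (simp add: dist_norm norm_minus_commute)
    qed
    then show "\<exists>N. \<forall>n\<ge>N. dist (X n) G < r" by blast
  qed
  then show "convergent X" by (rule convergentI)
qed

instantiation ell2 :: (type) complex_hilbert
begin

lift_definition scaleC_ell2 :: "complex \<Rightarrow> 'a ell2 \<Rightarrow> 'a ell2" is "\<lambda>c f w. c * f w"
  by (rule ell2_cmult_summable)

lift_definition cinner_ell2 :: "'a ell2 \<Rightarrow> 'a ell2 \<Rightarrow> complex"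
  is "\<lambda>f g. \<Sum>\<^sub>\<infinity>w. f w * cnj (g w)" .

instance
proof
  fix x y z :: "'a ell2" and c d :: complex and r :: real
  show "c *\<^sub>C (x + y) = c *\<^sub>C x + c *\<^sub>C y" by transfer (simp add: distrib_left)
  show "(c + d) *\<^sub>C x = c *\<^sub>C x + d *\<^sub>C x" by transfer (simp add: distrib_right)
  show "c *\<^sub>C d *\<^sub>C x = (c * d) *\<^sub>C x" by transfer (simp add: mult.assoc)
  show "complex_of_real r *\<^sub>C x = r *\<^sub>R x" by transfer simp
  show "cinner (x + y) z = cinner x z + cinner y z"
    by transfer (simp add: distrib_right infsum_add ell2_mult_summable)
  show "cinner (c *\<^sub>C x) y = c * cinner x y"
    by transfer (simp add: mult.assoc infsum_cmult_right')
  show "cinner y x = cnj (cinner x y)"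
    by transfer (subst infsum_cnj[symmetric], simp add: mult.commute)
  show "inner x y = Re (cinner x y)" by transfer simp
qed

end

lift_definition ket :: "'w \<Rightarrow> 'w ell2" is "\<lambda>v w. if w = v then 1 else 0"
proof -
  fix v :: 'w
  have "(\<lambda>w. (cmod (if w = v then 1 else 0))\<^sup>2) summable_on {v}" by simp
  then show "(\<lambda>w. (cmod (if w = v then 1 else 0))\<^sup>2) summable_on UNIV"
    by (rule summable_on_cong_neutral[THEN iffD1, rotated -1]) auto
qed

lemma cinner_ket: "cinner x (ket v) = ell2_coord x v"
proof transfer
  fix f :: "'a \<Rightarrow> complex" and v :: 'a
  have "(\<Sum>\<^sub>\<infinity>w. f w * cnj (if w = v then 1 else 0))
      = (\<Sum>\<^sub>\<infinity>w\<in>{v}. f w * cnj (if w = v then 1 else 0))"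
    by (rule infsum_cong_neutral) auto
  then show "(\<Sum>\<^sub>\<infinity>w. f w * cnj (if w = v then 1 else 0)) = f v" by simp
qed


section \<open>The non-commutative analytic Toeplitz algebra and type L\<close>

text \<open>
  \<open>left_creation v\<close> is the operator \<open>L\<^sub>v\<close> determined by \<open>L\<^sub>v \<xi>\<^sub>w = \<xi>\<^sub>v\<^sub>w\<close> (lemma
  \<open>left_creation_ket\<close>), given in coordinates.
\<close>

lemma left_shift_summable:
  fixes f :: "'i list \<Rightarrow> 'b::{comm_monoid_add,topological_space}"
  assumes "f summable_on UNIV"
  shows "(\<lambda>w. if take (length v) w = v then f (drop (length v) w) else 0) summable_on UNIV"
proof -
  let ?g = "\<lambda>w. if take (length v) w = v then f (drop (length v) w) else 0"
  have "?g summable_on range ((@) v)"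
    by (subst summable_on_reindex) (simp_all add: o_def assms inj_on_def)
  then show ?thesis
    by (rule summable_on_cong_neutral[THEN iffD1, rotated -1])
      (auto, metis append_take_drop_id rangeI)
qed

lift_definition left_creation :: "'i list \<Rightarrow> 'i list ell2 \<Rightarrow> 'i list ell2"
  is "\<lambda>v f w. if take (length v) w = v then f (drop (length v) w) else 0"
proof -
  fix v and f :: "'i list \<Rightarrow> complex"
  assume "(\<lambda>w. (cmod (f w))\<^sup>2) summable_on UNIV"
  from left_shift_summable[OF this, of v]
  show "(\<lambda>w. (cmod (if take (length v) w = v then f (drop (length v) w) else 0))\<^sup>2)
      summable_on UNIV"
    by (rule summable_on_cong[THEN iffD1, rotated]) auto
qed

definition nc_analytic_toeplitz :: "('i::countable list ell2 \<Rightarrow> 'i list ell2) set" where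
  "nc_analytic_toeplitz = free_semigroup_algebra (\<lambda>i. left_creation [i])"

text \<open>
  The algebra generated by \<open>S\<close> is compared with \<open>\<L>\<^sub>n\<close> for the same \<open>n\<close>, that is, over the same
  index type.
\<close>

definition type_L :: "('i::countable \<Rightarrow> 'a::complex_hilbert \<Rightarrow> 'a) \<Rightarrow> bool" where
  "type_L S \<longleftrightarrow> algebraically_isomorphic (free_semigroup_algebra S)
     (nc_analytic_toeplitz :: ('i list ell2 \<Rightarrow> 'i list ell2) set)"

lemma left_creation_ket: "left_creation v (ket w) = ket (v @ w)"
proof (transfer, rule ext)
  fix v w x :: "'a list"
  have "x = v @ w \<longleftrightarrow> take (length v) x = v \<and> drop (length v) x = w"
    by (metis append_eq_conv_conj)
  then show "(if take (length v) x = v then if drop (length v) x = w then 1 else 0 else 0)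
      = (if x = v @ w then 1 else (0::complex))"
    by simp
qed

lemma cinner_left_creation: "cinner (left_creation v x) (left_creation v y) = cinner x y"
proof transfer
  fix v :: "'a list" and f g :: "'a list \<Rightarrow> complex"
  let ?h = "\<lambda>w. (if take (length v) w = v then f (drop (length v) w) else 0)
      * cnj (if take (length v) w = v then g (drop (length v) w) else 0)"
  have "infsum ?h UNIV = infsum ?h (range ((@) v))"
    by (rule infsum_cong_neutral) (auto, metis append_take_drop_id rangeI)
  also have "\<dots> = (\<Sum>\<^sub>\<infinity>w. f w * cnj (g w))"
    by (subst infsum_reindex) (simp_all add: o_def inj_on_def)
  finally show "infsum ?h UNIV = (\<Sum>\<^sub>\<infinity>w. f w * cnj (g w))" .
qed

lemma bounded_clinear_left_creation: "bounded_clinear (left_creation v)"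
  unfolding bounded_clinear_def
proof (intro conjI allI)
  show "left_creation v (c *\<^sub>C x) = c *\<^sub>C left_creation v x" for c x
    by transfer (auto simp: fun_eq_iff)
  have "norm (left_creation v x) = norm x" for x
    by (simp add: norm_eq_sqrt_inner inner_eq_Re_cinner cinner_left_creation)
  moreover have "left_creation v (x + y) = left_creation v x + left_creation v y" for x y
    by transfer (auto simp: fun_eq_iff)
  moreover have "left_creation v (r *\<^sub>R x) = r *\<^sub>R left_creation v x" for r x
    by transfer (auto simp: fun_eq_iff)
  ultimately show "bounded_linear (left_creation v)"
    by (intro bounded_linear_intro[where K = 1]) auto
qed

lemma isometries_with_orthogonal_ranges_left_creation:
  "isometries_with_orthogonal_ranges (\<lambda>i::'i::countable. left_creation [i])"
proof -
  have "cinner (left_creation [i] x) (left_creation [j] y) = 0" if "i \<noteq> j" for i j :: 'i and x y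
    using that
  proof transfer
    fix i j :: 'i and f g :: "'i list \<Rightarrow> complex"
    assume "i \<noteq> j"
    then have "(if take (length [i]) w = [i] then f (drop (length [i]) w) else 0) *
        cnj (if take (length [j]) w = [j] then g (drop (length [j]) w) else 0) = 0" for w
      by (cases w) auto
    then show "(\<Sum>\<^sub>\<infinity>w. (if take (length [i]) w = [i] then f (drop (length [i]) w) else 0) *
        cnj (if take (length [j]) w = [j] then g (drop (length [j]) w) else 0)) = 0"
      by (simp only: infsum_0_simp)
  qed
  then show ?thesis
    by (auto simp: isometries_with_orthogonal_ranges_iff bounded_clinear_left_creation
        cinner_left_creation)
qed

end

theory Submission
  imports Defs
begin

text \<open>
  If the identity is in the weak closure of the span of the \<open>S\<^sub>w\<close> with \<open>w\<close> nonempty, then every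
  \<open>S\<^sub>i\<^sup>*\<close> is in the algebra; an algebra of convolution operators has no zero divisors, and this rules out
  type L. Otherwise a finite ampliation of \<open>S\<close> has a wandering vector \<open>(z\<^sub>j)\<close>, and a single vector \<open>x\<close>
  at positive distance from the closed span of \<open>S\<^sub>w x\<close>, \<open>w\<close> nonempty, is all that is needed.

  For one generator, which may be taken to be unitary, the spectral densities of the \<open>z\<^sub>j\<close> sum to \<open>1\<close>,
  and two vectors can be merged into one by choosing on each part of the spectrum the one with the
  larger density. For several generators suppose that there is no wandering vector. The maps
  \<open>\<xi>\<^sub>w \<mapsto> S\<^sub>w z\<^sub>j\<close> are bounded, so that \<open>((S\<^sub>w z\<^sub>j, y))\<^sub>w\<close> is square summable and, for a long word \<open>u\<close>
  without overlaps, \<open>S\<^sub>u z\<^sub>j\<close> is almost wandering in the \<open>\<ell>\<^sup>2\<close> sense. Successive corrections by such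
  vectors give \<open>x, y\<close> with \<open>(S\<^sub>w x, y) = 0\<close> for all nonempty \<open>w\<close> and \<open>(x, y) = 1\<close>, a contradiction.
\<close>

section \<open>Complex Hilbert spaces\<close>

text \<open>The weak topology tests an operator on finitely many pairs of vectors, so separating the
  identity gives orthogonality only in a finite direct sum: it holds for the sum over
  \<open>j\<close>, and a single \<open>z j\<close> may have none of it. The difficulty is to
  condense the family into one vector. What survives in each coordinate is Bessel's inequality for
  the vectors \<open>W w (z j)\<close>, and both cases are built on it. With several generators no
  spectral calculus chooses between the coordinates. There the coefficient functional of a pair of
  vectors is prescribed instead: if it is 1 at the identity and 0 at every nonempty word, it keeps
  the first vector away from its proper images. Coefficients are sesquilinear, so an error of norm
  \<beta> is reduced to \<beta>/4 by corrections of norm at most \<open>sqrt \<beta>\<close>; errors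
  decay like \<open>4^-n\<close>, corrections like \<open>2^-n\<close>, and both vectors converge.
  The absence of wandering vectors is itself a tool: it makes the ranges of the words of each length
  span a dense subspace, and makes every \<open>x\<close> a limit of vectors \<open>- p x\<close>
  with \<open>p\<close> in \<open>proper_polys S\<close>.\<close>

lemma norm_scaleC: "norm (c *\<^sub>C (x::'a::complex_hilbert)) = cmod c * norm x"
proof -
  have "cinner (c *\<^sub>C x) (c *\<^sub>C x) = complex_of_real ((cmod c)\<^sup>2) * cinner x x"
    unfolding cinner_scaleC_left cinner_scaleC_right complex_norm_square by simp
  then show ?thesis
    by (simp add: norm_eq_sqrt_inner inner_eq_Re_cinner real_sqrt_mult)
qed

lemma cinner_zero [simp]:
  "cinner 0 (x::'a::complex_hilbert) = 0" "cinner (x::'a::complex_hilbert) 0 = 0"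
  using cinner_add_left[of 0 0 x] cinner_add_right[of x 0 0] by simp_all

lemma scaleC_zero [simp]: "0 *\<^sub>C (x::'a::complex_hilbert) = 0" "c *\<^sub>C (0::'a::complex_hilbert) = 0"
  using scaleC_add_left[of 0 0 x] scaleC_add_right[of c 0 0] by simp_all

lemma scaleC_minus_one: "(-1) *\<^sub>C (x::'a::complex_hilbert) = - x"
  using scaleC_add_left[of 1 "-1" x] by (simp add: minus_unique)

lemma cinner_self: "cinner x x = complex_of_real ((norm (x::'a::complex_hilbert))\<^sup>2)"
proof (rule complex_eqI)
  show "Re (cinner x x) = Re (complex_of_real ((norm x)\<^sup>2))"
    by (simp add: inner_eq_Re_cinner power2_norm_eq_inner)
  have "Im (cinner x x) = - Im (cinner x x)" using cinner_cnj[of x x]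
    by (metis complex_cnj_cnj cnj.simps(2))
  then show "Im (cinner x x) = Im (complex_of_real ((norm x)\<^sup>2))" by simp
qed

lemma norm_sq_eq_Re_cinner: "(norm (x::'a::complex_hilbert))\<^sup>2 = Re (cinner x x)"
  by (simp add: cinner_self)

lemma norm_cinner_le: "cmod (cinner x y) \<le> norm x * norm (y::'a::complex_hilbert)"
proof (cases "cinner x y = 0")
  case False
  let ?c = "cinner x y"
  have "(cmod ?c)\<^sup>2 = Re (cinner (cnj ?c *\<^sub>C x) y)"
    unfolding cinner_scaleC_left mult.commute[of "cnj ?c"] complex_norm_square[symmetric] by simp
  also have "\<dots> \<le> norm (cnj ?c *\<^sub>C x) * norm y"
    unfolding inner_eq_Re_cinner[symmetric] by (rule norm_cauchy_schwarz)
  also have "\<dots> = cmod ?c * (norm x * norm y)" by (simp add: norm_scaleC)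
  finally show ?thesis using False by (simp add: power2_eq_square)
qed simp

interpretation cinner: bounded_bilinear "cinner :: 'a::complex_hilbert \<Rightarrow> 'a \<Rightarrow> complex"
proof
  fix x y z :: 'a and r :: real
  show "cinner (x + y) z = cinner x z + cinner y z" by (rule cinner_add_left)
  show "cinner x (y + z) = cinner x y + cinner x z" by (rule cinner_add_right)
  show "cinner (r *\<^sub>R x) y = r *\<^sub>R cinner x y"
    using cinner_scaleC_left[of "of_real r" x y] by (simp add: scaleC_of_real scaleR_conv_of_real)
  show "cinner x (r *\<^sub>R y) = r *\<^sub>R cinner x y"
    using cinner_scaleC_right[of x "of_real r" y] by (simp add: scaleC_of_real scaleR_conv_of_real)
  show "\<exists>K. \<forall>(x::'a) y. norm (cinner x y) \<le> norm x * norm y * K"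
    using norm_cinner_le by (intro exI[of _ 1]) auto
qed

interpretation scaleC: bounded_bilinear "scaleC :: complex \<Rightarrow> 'a::complex_hilbert \<Rightarrow> 'a"
proof
  fix x y :: 'a and c d :: complex and r :: real
  show "(c + d) *\<^sub>C x = c *\<^sub>C x + d *\<^sub>C x" by (rule scaleC_add_left)
  show "c *\<^sub>C (x + y) = c *\<^sub>C x + c *\<^sub>C y" by (rule scaleC_add_right)
  show "(r *\<^sub>R c) *\<^sub>C x = r *\<^sub>R (c *\<^sub>C x)"
    by (simp add: scaleR_conv_of_real scaleC_of_real[symmetric] scaleC_scaleC)
  show "c *\<^sub>C (r *\<^sub>R x) = r *\<^sub>R (c *\<^sub>C x)"
    by (simp add: scaleC_of_real[symmetric] scaleC_scaleC mult.commute)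
  show "\<exists>K. \<forall>c (x::'a). norm (c *\<^sub>C x) \<le> norm c * norm x * K"
    using norm_scaleC by (intro exI[of _ 1]) (simp add: norm_scaleC)
qed

lemma norm_sq_add:
  "(norm (x + y))\<^sup>2 = (norm x)\<^sup>2 + (norm y)\<^sup>2 + 2 * Re (cinner x (y::'a::complex_hilbert))"
  unfolding power2_norm_eq_inner
  by (simp add: inner_add_left inner_add_right inner_eq_Re_cinner[of x y, symmetric] inner_commute)

lemma norm_sq_add_orthogonal:
  "cinner x y = 0 \<Longrightarrow> (norm (x + y))\<^sup>2 = (norm x)\<^sup>2 + (norm (y::'a::complex_hilbert))\<^sup>2"
  by (simp add: norm_sq_add)

lemma norm_sq_diff:
  "(norm (x - y))\<^sup>2 = (norm x)\<^sup>2 + (norm y)\<^sup>2 - 2 * Re (cinner x (y::'a::complex_hilbert))"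
  using norm_sq_add[of x "- y"] by (simp add: cinner.minus_right)

lemma norm_sq_sum_orthogonal:
  fixes x :: "'j \<Rightarrow> 'a::complex_hilbert"
  assumes "finite F" and "\<And>i j. i \<in> F \<Longrightarrow> j \<in> F \<Longrightarrow> i \<noteq> j \<Longrightarrow> cinner (x i) (x j) = 0"
  shows "(norm (\<Sum>i\<in>F. x i))\<^sup>2 = (\<Sum>i\<in>F. (norm (x i))\<^sup>2)"
  using assms
proof (induction F rule: finite_induct)
  case (insert i F)
  have "cinner (x i) (\<Sum>j\<in>F. x j) = 0"
    unfolding cinner.sum_right using insert by (intro sum.neutral) auto
  then show ?case using insert by (simp add: norm_sq_add_orthogonal)
qed simp

lemma bessel_inequality:
  fixes e :: "'j \<Rightarrow> 'a::complex_hilbert"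
  assumes "finite F" and "\<And>i j. i \<in> F \<Longrightarrow> j \<in> F \<Longrightarrow> cinner (e i) (e j) = (if i = j then 1 else 0)"
  shows "(\<Sum>i\<in>F. (cmod (cinner x (e i)))\<^sup>2) \<le> (norm x)\<^sup>2"
proof -
  let ?p = "\<Sum>i\<in>F. cinner x (e i) *\<^sub>C e i"
  have ne: "norm (e i) = 1" if "i \<in> F" for i
  proof -
    have "(norm (e i))\<^sup>2 = 1" unfolding norm_sq_eq_Re_cinner using assms(2)[OF that that] by simp
    then show ?thesis using norm_ge_zero[of "e i"] by (auto simp: power2_eq_1_iff simp del: norm_ge_zero)
  qed
  have p: "(norm ?p)\<^sup>2 = (\<Sum>i\<in>F. (cmod (cinner x (e i)))\<^sup>2)"
    using assms by (subst norm_sq_sum_orthogonal)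
      (auto simp: cinner_scaleC_left cinner_scaleC_right norm_scaleC ne intro!: sum.cong)
  have "cinner x ?p = of_real (\<Sum>i\<in>F. (cmod (cinner x (e i)))\<^sup>2)"
    unfolding cinner.sum_right of_real_sum complex_norm_square
    by (intro sum.cong) (auto simp: cinner_scaleC_right mult.commute)
  then have "(norm (x - ?p))\<^sup>2 = (norm x)\<^sup>2 - (\<Sum>i\<in>F. (cmod (cinner x (e i)))\<^sup>2)"
    unfolding norm_sq_diff p by simp
  then show ?thesis by (metis diff_ge_0_iff_ge zero_le_power2)
qed

text \<open>Families indexed by \<open>J\<close> stand in for a direct sum of Hilbert spaces.\<close>

lemma minimizing_family:
  fixes K :: "('j \<Rightarrow> 'a::complex_hilbert) set"
  assumes "finite J" "K \<noteq> {}"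
    and mid: "\<And>f g. f \<in> K \<Longrightarrow> g \<in> K \<Longrightarrow> (\<lambda>j. (1/2) *\<^sub>R (f j + g j)) \<in> K"
  obtains z X where "\<And>m::nat. X m \<in> K" "\<And>j. j \<in> J \<Longrightarrow> (\<lambda>m. X m j) \<longlonglongrightarrow> z j"
    "\<And>g. g \<in> K \<Longrightarrow> (\<Sum>j\<in>J. (norm (z j))\<^sup>2) \<le> (\<Sum>j\<in>J. (norm (g j))\<^sup>2)"
proof -
  define q where "q f = (\<Sum>j\<in>J. (norm (f j))\<^sup>2)" for f :: "'j \<Rightarrow> 'a"
  define m where "m = Inf (q ` K)"
  have bdd: "bdd_below (q ` K)" by (rule bdd_belowI[of _ 0]) (auto simp: q_def sum_nonneg)
  have m_le: "m \<le> q f" if "f \<in> K" for f unfolding m_def using that by (intro cInf_lower bdd) auto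
  have "\<exists>f\<in>K. q f < m + 1 / Suc n" for n
  proof -
    have "Inf (q ` K) < m + 1 / Suc n" by (simp add: m_def)
    then show ?thesis using assms(2) by (subst (asm) cInf_less_iff[OF _ bdd]) auto
  qed
  then obtain X where XK: "\<And>n. X n \<in> K" and X: "\<And>n. q (X n) < m + 1 / Suc n" by metis
  \<comment> \<open>Parallelogram law: the midpoint lies in \<open>K\<close> and so has value at
    least \<open>m\<close>, hence two nearly minimal members are close in every coordinate.\<close>
  have par: "q (\<lambda>j. f j - g j) \<le> 2 * (q f - m) + 2 * (q g - m)" if "f \<in> K" "g \<in> K" for f g
  proof -
    have "q (\<lambda>j. f j - g j) = 2 * q f + 2 * q g - 4 * q (\<lambda>j. (1/2) *\<^sub>R (f j + g j))"
      unfolding q_def power2_norm_eq_inner sum_distrib_left sum.distrib[symmetric] sum_subtractf[symmetric]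
      by (intro sum.cong) (simp_all add: algebra_simps inner_commute)
    then show ?thesis using m_le[OF mid[OF that]] by simp
  qed
  have cau: "Cauchy (\<lambda>n. X n j)" if j: "j \<in> J" for j
  proof (rule metric_CauchyI)
    fix e :: real assume "e > 0"
    then obtain N where N: "N \<noteq> 0" "inverse (real N) < e\<^sup>2 / 4"
      using real_arch_inverse[of "e\<^sup>2/4"] by auto
    have small: "4 * (q (X k) - m) < e\<^sup>2" if "k \<ge> N" for k
    proof -
      have "1 / real (Suc k) \<le> inverse (real N)"
        using that N(1) by (simp add: field_simps)
      then have "q (X k) - m < e\<^sup>2 / 4" using X[of k] N(2) by linarith
      then show ?thesis by simp
    qed
    have "dist (X k j) (X l j) < e" if "k \<ge> N" "l \<ge> N" for k l
    proof -
      have "(norm (X k j - X l j))\<^sup>2 \<le> q (\<lambda>j. X k j - X l j)"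
        unfolding q_def using j assms(1) by (intro member_le_sum) auto
      also have "\<dots> < e\<^sup>2"
        using par[OF XK XK, of k l] small[OF that(1)] small[OF that(2)] by linarith
      finally show ?thesis using \<open>e > 0\<close> by (simp add: dist_norm power_less_imp_less_base)
    qed
    then show "\<exists>M. \<forall>k\<ge>M. \<forall>l\<ge>M. dist (X k j) (X l j) < e" by blast
  qed
  define z where "z j = lim (\<lambda>n. X n j)" for j
  have z: "(\<lambda>n. X n j) \<longlonglongrightarrow> z j" if "j \<in> J" for j
    unfolding z_def using cau[OF that] by (simp add: Cauchy_convergent_iff convergent_LIMSEQ_iff)
  have "(\<lambda>n. q (X n)) \<longlonglongrightarrow> q z"
    unfolding q_def by (intro tendsto_intros z)
  moreover have "(\<lambda>n. m + 1 / Suc n) \<longlonglongrightarrow> m + 0"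
    by (intro tendsto_intros LIMSEQ_Suc[OF lim_1_over_n])
  ultimately have "q z \<le> m + 0"
    by (rule LIMSEQ_le) (use X less_imp_le in blast)
  then have "q z \<le> q g" if "g \<in> K" for g using m_le[OF that] by simp
  then show thesis using that[OF XK z] unfolding q_def by blast
qed

text \<open>First-order condition at a minimum. Let \<open>s\<close> be the sum in question and
  \<open>Y\<close> the sum of the squared norms of the \<open>y j\<close>. Moving by the coefficient
  \<open>- t * s\<close> changes the value by \<open>(cmod s)^2 * (t^2 * Y - 2 * t)\<close>, which
  is negative for small \<open>t > 0\<close> unless \<open>s = 0\<close>.\<close>

lemma sum_cinner_eq_0_if_minimal:
  fixes z y :: "'j \<Rightarrow> 'a::complex_hilbert"
  assumes "\<And>c. (\<Sum>j\<in>J. (norm (z j))\<^sup>2) \<le> (\<Sum>j\<in>J. (norm (z j + c *\<^sub>C y j))\<^sup>2)"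
  shows "(\<Sum>j\<in>J. cinner (z j) (y j)) = 0"
proof (rule ccontr)
  let ?s = "\<Sum>j\<in>J. cinner (z j) (y j)" and ?Y = "\<Sum>j\<in>J. (norm (y j))\<^sup>2"
  assume ne: "?s \<noteq> 0"
  have exp: "(\<Sum>j\<in>J. (norm (z j + c *\<^sub>C y j))\<^sup>2)
      = (\<Sum>j\<in>J. (norm (z j))\<^sup>2) + (cmod c)\<^sup>2 * ?Y + 2 * Re (cnj c * ?s)" for c
    by (simp add: norm_sq_add norm_scaleC power_mult_distrib sum.distrib sum_distrib_left
        cinner_scaleC_right)
  \<comment> \<open>Adding 1 keeps the denominator positive when all \<open>y j\<close> vanish and
    gives \<open>t * ?Y < 1\<close>.\<close>
  define t where "t = 1 / (?Y + 1)"
  have Y: "?Y \<ge> 0" by (simp add: sum_nonneg)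
  then have t: "t > 0" "t * ?Y < 1" by (auto simp: t_def field_simps)
  have "cnj ?s * ?s = of_real ((cmod ?s)\<^sup>2)"
    unfolding complex_norm_square by (rule mult.commute)
  then have "Re (cnj (- of_real t * ?s) * ?s) = - t * (cmod ?s)\<^sup>2"
    by (simp add: mult.assoc del: cnj_sum)
  then have "0 \<le> (cmod ?s)\<^sup>2 * t * (t * ?Y) - 2 * t * (cmod ?s)\<^sup>2"
    using assms[of "- of_real t * ?s"] t unfolding exp
    by (simp add: norm_mult power_mult_distrib power2_eq_square mult_ac)
  then have "2 * (t * (cmod ?s)\<^sup>2) \<le> (t * (cmod ?s)\<^sup>2) * (t * ?Y)" by (simp add: mult_ac)
  moreover have "t * (cmod ?s)\<^sup>2 > 0" using t ne by simp
  ultimately show False using t by (smt (verit) mult_less_cancel_left2)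
qed

text \<open>Projection onto the closure of \<open>M\<close>, from the minimizing argument with a
  single index. \<open>M\<close> is merely a subspace, so \<open>e\<close> is a limit of elements of
  \<open>M\<close>.\<close>

lemma orthogonal_decomposition:
  fixes M :: "'a::complex_hilbert set"
  assumes "0 \<in> M" "\<And>x y. x \<in> M \<Longrightarrow> y \<in> M \<Longrightarrow> x + y \<in> M" "\<And>c x. x \<in> M \<Longrightarrow> c *\<^sub>C x \<in> M"
  obtains e f where "x = e + f" "e \<in> closure M" "\<And>y. y \<in> M \<Longrightarrow> cinner f y = 0"
proof -
  define K where "K = (\<lambda>m (_::unit). x - m) ` M"
  obtain z X where X: "\<And>m::nat. X m \<in> K" and lim: "\<And>j. j \<in> {()} \<Longrightarrow> (\<lambda>m. X m j) \<longlonglongrightarrow> z j"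
    and min: "\<And>g. g \<in> K \<Longrightarrow> (\<Sum>j\<in>{()}. (norm (z j))\<^sup>2) \<le> (\<Sum>j\<in>{()}. (norm (g j))\<^sup>2)"
  proof (rule minimizing_family[of "{()}" K])
    show "K \<noteq> {}" using assms(1) by (auto simp: K_def)
    fix f g assume "f \<in> K" "g \<in> K"
    then obtain a b where ab: "a \<in> M" "b \<in> M" "f = (\<lambda>_. x - a)" "g = (\<lambda>_. x - b)" by (auto simp: K_def)
    have "x - of_real (1/2) *\<^sub>C (a + b) = (1/2) *\<^sub>R ((x - a) + (x - b))"
      unfolding scaleC_of_real by (simp add: scaleR_add_right scaleR_diff_right scaleR_2[symmetric] algebra_simps flip: scaleR_2)
    moreover have "of_real (1/2) *\<^sub>C (a + b) \<in> M" using assms ab by blast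
    ultimately show "(\<lambda>j. (1/2) *\<^sub>R (f j + g j)) \<in> K"
      unfolding K_def ab by (intro image_eqI) auto
  qed auto
  have "\<forall>n. \<exists>m. m \<in> M \<and> X n = (\<lambda>_. x - m)" using X unfolding K_def by blast
  from choice[OF this] obtain m where m: "\<And>n. m n \<in> M" "\<And>n. X n = (\<lambda>_. x - m n)" by auto
  have lim': "(\<lambda>n. x - m n) \<longlonglongrightarrow> z ()" using lim[of "()"] m(2) by simp
  then have "(\<lambda>n. x - (x - m n)) \<longlonglongrightarrow> x - z ()" by (intro tendsto_intros)
  then have cl: "x - z () \<in> closure M" using m(1) by (auto simp: closure_sequential)
  have "cinner (z ()) y = 0" if y: "y \<in> M" for y
  proof -
    have "(norm (z ()))\<^sup>2 \<le> (norm (z () + c *\<^sub>C y))\<^sup>2" for c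
    proof (rule tendsto_lowerbound)
      show "(\<lambda>n. (norm ((x - m n) + c *\<^sub>C y))\<^sup>2) \<longlonglongrightarrow> (norm (z () + c *\<^sub>C y))\<^sup>2"
        by (intro tendsto_intros lim')
      have "m n + (- c) *\<^sub>C y \<in> M" for n using assms m y by blast
      then have "(\<lambda>_. x - (m n + (- c) *\<^sub>C y)) \<in> K" for n unfolding K_def by blast
      from min[OF this] show "\<forall>\<^sub>F n in sequentially. (norm (z ()))\<^sup>2 \<le> (norm ((x - m n) + c *\<^sub>C y))\<^sup>2"
        by (simp add: scaleC.minus_left algebra_simps)
    qed simp
    then show ?thesis
      using sum_cinner_eq_0_if_minimal[where J = "{()}" and z = z and y = "\<lambda>_. y"] by simp
  qed
  then show thesis using that[of "x - z ()" "z ()"] cl by simp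
qed

lemma bounded_clinear_bounded_linear: "bounded_clinear T \<Longrightarrow> bounded_linear T"
  and bounded_clinear_scaleC: "bounded_clinear T \<Longrightarrow> T (c *\<^sub>C x) = c *\<^sub>C T x"
  by (auto simp: bounded_clinear_def)

lemma bounded_clinear_add: "bounded_clinear T \<Longrightarrow> T (x + y) = T x + T y"
  and bounded_clinear_diff: "bounded_clinear T \<Longrightarrow> T (x - y) = T x - T y"
  and bounded_clinear_zero: "bounded_clinear T \<Longrightarrow> T 0 = 0"
  and bounded_clinear_sum: "bounded_clinear T \<Longrightarrow> T (\<Sum>i\<in>F. f i) = (\<Sum>i\<in>F. T (f i))"
  and bounded_clinear_scaleR: "bounded_clinear T \<Longrightarrow> T (r *\<^sub>R x) = r *\<^sub>R T x"
  by (auto simp: bounded_clinear_def linear_add linear_diff linear_0 linear_sum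
      linear_scale bounded_linear.linear)

lemma bounded_clinear_tendsto: "bounded_clinear T \<Longrightarrow> (f \<longlongrightarrow> l) F \<Longrightarrow> ((\<lambda>s. T (f s)) \<longlongrightarrow> T l) F"
  by (rule bounded_linear.tendsto[OF bounded_clinear_bounded_linear])

lemma bounded_clinearI:
  assumes "\<And>x y. T (x + y) = T x + T y" "\<And>c x. T (c *\<^sub>C x) = c *\<^sub>C T x"
    "\<And>x. norm (T x) \<le> K * norm (x::'a::complex_hilbert)"
  shows "bounded_clinear T"
  unfolding bounded_clinear_def
proof
  show "bounded_linear T"
    by (rule bounded_linear_intro[where K = K])
      (use assms in \<open>auto simp: mult.commute simp flip: scaleC_of_real\<close>)
qed (use assms(2) in auto)

lemma bounded_clinear_id: "bounded_clinear id"
  and bounded_clinear_ident: "bounded_clinear (\<lambda>x. x)"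
  by (auto simp: bounded_clinear_def bounded_linear_ident id_def)

lemma bounded_clinear_comp:
  "bounded_clinear T \<Longrightarrow> bounded_clinear R \<Longrightarrow> bounded_clinear (\<lambda>x. T (R x))"
  and bounded_clinear_plus:
  "bounded_clinear T \<Longrightarrow> bounded_clinear R \<Longrightarrow> bounded_clinear (\<lambda>x. T x + R x)"
  and bounded_clinear_scale:
  "bounded_clinear T \<Longrightarrow> bounded_clinear (\<lambda>x. c *\<^sub>C T x)"
  using operator_algebra_bounded_clinear unfolding operator_algebra_def
  by (auto simp: o_def)

lemma bounded_clinear_cadjoint:
  assumes T: "bounded_clinear (T :: 'a::complex_hilbert \<Rightarrow> 'a)"
  shows "bounded_clinear (cadjoint T)"
proof -
  note w = cadjoint_works[OF T, symmetric]
  obtain K where K: "\<And>x. norm (T x) \<le> norm x * K" "K > 0"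
    using bounded_linear.pos_bounded[OF bounded_clinear_bounded_linear[OF T]] by auto
  show ?thesis
  proof (rule bounded_clinearI)
    show "cadjoint T (x + y) = cadjoint T x + cadjoint T y" for x y
      by (rule cinner_eqI) (simp add: w cinner_add_right)
    show "cadjoint T (c *\<^sub>C x) = c *\<^sub>C cadjoint T x" for c x
      by (rule cinner_eqI) (simp add: w cinner_scaleC_right)
    fix x
    have "(norm (cadjoint T x))\<^sup>2 = cmod (cinner (T (cadjoint T x)) x)"
      by (simp add: cadjoint_works[OF T] cinner_self norm_power)
    also have "\<dots> \<le> norm (T (cadjoint T x)) * norm x" by (rule norm_cinner_le)
    also have "\<dots> \<le> (norm (cadjoint T x) * K) * norm x" using K by (intro mult_right_mono) auto
    finally have "norm (cadjoint T x) * norm (cadjoint T x) \<le> norm (cadjoint T x) * (K * norm x)"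
      by (simp add: power2_eq_square mult_ac)
    then show "norm (cadjoint T x) \<le> K * norm x"
      using K(2) by (cases "norm (cadjoint T x) = 0") auto
  qed
qed

lemma cinner_cadjoint_left:
  "bounded_clinear T \<Longrightarrow> cinner (cadjoint T x) y = cinner x (T y)"
  by (subst (1 2) cinner_cnj) (simp add: cadjoint_works)

section \<open>Words in isometries with orthogonal ranges\<close>

text \<open>The span of the operators of nonempty words, generated one monomial at a time so that
  rule induction reaches all its elements. The constant term is left out: \<open>x + p x\<close>
  formally has coefficient 1 at the empty word.\<close>

inductive_set proper_polys :: "('i \<Rightarrow> 'a::complex_hilbert \<Rightarrow> 'a) \<Rightarrow> ('a \<Rightarrow> 'a) set"
  for S :: "'i \<Rightarrow> 'a \<Rightarrow> 'a" where
  zero: "(\<lambda>_. 0) \<in> proper_polys S"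
| add: "p \<in> proper_polys S \<Longrightarrow> w \<noteq> [] \<Longrightarrow> (\<lambda>x. p x + c *\<^sub>C word_op S w x) \<in> proper_polys S"

locale orthogonal_isometries =
  fixes S :: "'i::countable \<Rightarrow> 'a::complex_hilbert \<Rightarrow> 'a"
  assumes iso: "isometries_with_orthogonal_ranges S"
begin

abbreviation W where "W \<equiv> word_op S"

lemma S_bounded [simp]: "bounded_clinear (S i)"
  and cinner_S: "cinner (S i x) (S j y) = (if i = j then cinner x y else 0)"
  using iso by (auto simp: isometries_with_orthogonal_ranges_iff)

lemma W_bounded [simp]: "bounded_clinear (W w)"
  by (induction w) (auto simp: bounded_clinear_ident bounded_clinear_id bounded_clinear_comp o_def)

lemma W_append: "W (u @ v) x = W u (W v x)"
  by (induction u) auto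

lemma cinner_W_same [simp]: "cinner (W u x) (W u y) = cinner x y"
  by (induction u) (auto simp: cinner_S)

lemma norm_S [simp]: "norm (S i x) = norm x"
  by (simp add: norm_eq_sqrt_inner inner_eq_Re_cinner cinner_S)

lemma norm_W [simp]: "norm (W u x) = norm x"
  by (induction u) auto

lemma cinner_W_append:
  "cinner (W u x) (W (u @ t) y) = cinner x (W t y)"
  "cinner (W (u @ t) x) (W u y) = cinner (W t x) y"
  by (simp_all add: W_append)

text \<open>Words that are not prefixes of each other differ at some first position. The common
  prefix cancels because it acts isometrically, and the ranges of the two differing letters are
  orthogonal.\<close>

lemma cinner_W_eq_0:
  assumes "\<And>t. u \<noteq> v @ t" "\<And>t. v \<noteq> u @ t"
  shows "cinner (W u x) (W v y) = 0"
  using assms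
proof (induction u arbitrary: v)
  case (Cons i u)
  then obtain j v' where v: "v = j # v'" by (cases v) auto
  show ?case
  proof (cases "i = j")
    case True
    then have "cinner (W u x) (W v' y) = 0" using Cons.prems v by (intro Cons.IH) auto
    then show ?thesis using True v by (simp add: cinner_S)
  qed (simp add: v cinner_S)
qed (metis append_Nil)

lemma cadjoint_S_W:
  "cadjoint (S i) (W w x) = (case w of [] \<Rightarrow> cadjoint (S i) x | j # v \<Rightarrow> if i = j then W v x else 0)"
proof (cases w)
  case (Cons j v)
  have "cinner y (cadjoint (S i) (S j (W v x))) = cinner y (if i = j then W v x else 0)" for y
    by (simp add: cadjoint_works[symmetric] cinner_S)
  from cinner_eqI[OF this] show ?thesis by (simp add: Cons)
qed simp

lemma proper_polys_bounded: "p \<in> proper_polys S \<Longrightarrow> bounded_clinear p"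
proof (induction rule: proper_polys.induct)
  case zero
  show ?case by (rule bounded_clinearI[where K = 0]) simp_all
qed (intro bounded_clinear_plus bounded_clinear_scale, auto)

lemma proper_polys_add:
  assumes "p \<in> proper_polys S" "q \<in> proper_polys S"
  shows "(\<lambda>x. p x + q x) \<in> proper_polys S"
  using assms(2,1)
proof (induction rule: proper_polys.induct)
  case (add q w c)
  from proper_polys.add[OF add.IH[OF add.prems] add.hyps(2), of c]
  show ?case by (simp add: add.assoc)
qed simp

lemma proper_polys_W: "w \<noteq> [] \<Longrightarrow> (\<lambda>x. c *\<^sub>C W w x) \<in> proper_polys S"
  using proper_polys.add[OF proper_polys.zero, where c = c] by simp

lemma proper_polys_scale: "p \<in> proper_polys S \<Longrightarrow> (\<lambda>x. c *\<^sub>C p x) \<in> proper_polys S"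
proof (induction rule: proper_polys.induct)
  case (add p w d)
  from proper_polys.add[OF add.IH add.hyps(2), of "c * d"]
  show ?case by (simp add: scaleC_add_right scaleC_scaleC)
qed (simp add: proper_polys.zero)

lemma proper_polys_W_comp: "p \<in> proper_polys S \<Longrightarrow> (\<lambda>x. W v (p x)) \<in> proper_polys S"
proof (induction rule: proper_polys.induct)
  case (add p w d)
  from proper_polys.add[OF add.IH, of "v @ w" d] add.hyps(2)
  show ?case by (simp add: bounded_clinear_add bounded_clinear_scaleC W_append)
qed (simp add: proper_polys.zero bounded_clinear_zero)

text \<open>The point of \<open>(1 + p) x\<close> of least norm is orthogonal to its images under nonempty words.\<close>

lemma wandering_family_if_positive_distance:
  fixes x :: "'j \<Rightarrow> 'a"
  assumes J: "finite J"
    and pos: "\<delta> > 0" "\<And>p. p \<in> proper_polys S \<Longrightarrow> (\<Sum>j\<in>J. (norm (x j + p (x j)))\<^sup>2) \<ge> \<delta>"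
  obtains z where "(\<Sum>j\<in>J. (norm (z j))\<^sup>2) > 0"
    "\<And>w. w \<noteq> [] \<Longrightarrow> (\<Sum>j\<in>J. cinner (z j) (W w (z j))) = 0"
proof -
  define K where "K = {\<lambda>j. x j + p (x j) |p. p \<in> proper_polys S}"
  have K: "(\<lambda>j. x j + p (x j)) \<in> K" if "p \<in> proper_polys S" for p using that by (auto simp: K_def)
  obtain z X where X: "\<And>m::nat. X m \<in> K" and lim: "\<And>j. j \<in> J \<Longrightarrow> (\<lambda>m. X m j) \<longlonglongrightarrow> z j"
    and min: "\<And>g. g \<in> K \<Longrightarrow> (\<Sum>j\<in>J. (norm (z j))\<^sup>2) \<le> (\<Sum>j\<in>J. (norm (g j))\<^sup>2)"
  proof (rule minimizing_family[OF J])
    show "K \<noteq> {}" using K[OF proper_polys.zero] by blast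
    fix f g assume "f \<in> K" "g \<in> K"
    then obtain p q where pq: "p \<in> proper_polys S" "q \<in> proper_polys S"
      "f = (\<lambda>j. x j + p (x j))" "g = (\<lambda>j. x j + q (x j))" by (auto simp: K_def)
    have "(1/2) *\<^sub>R (f j + g j) = x j + of_real (1/2) *\<^sub>C (p (x j) + q (x j))" for j
    proof -
      have "(1/2) *\<^sub>R (f j + g j) = (1/2) *\<^sub>R (x j + x j) + (1/2) *\<^sub>R (p (x j) + q (x j))"
        unfolding pq by (simp add: algebra_simps del: scaleR_half_double)
      then show ?thesis by (simp only: scaleC_of_real scaleR_half_double)
    qed
    then show "(\<lambda>j. (1/2) *\<^sub>R (f j + g j)) \<in> K"
      using K[OF proper_polys_scale[OF proper_polys_add[OF pq(1,2)], of "of_real (1/2)"]] by simp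
  qed blast
  have "\<delta> \<le> (\<Sum>j\<in>J. (norm (z j))\<^sup>2)"
  proof (rule tendsto_lowerbound)
    show "(\<lambda>m. \<Sum>j\<in>J. (norm (X m j))\<^sup>2) \<longlonglongrightarrow> (\<Sum>j\<in>J. (norm (z j))\<^sup>2)"
      by (intro tendsto_intros lim)
    show "\<forall>\<^sub>F m in sequentially. \<delta> \<le> (\<Sum>j\<in>J. (norm (X m j))\<^sup>2)"
    proof (intro always_eventually allI)
      fix m
      obtain p where "p \<in> proper_polys S" "X m = (\<lambda>j. x j + p (x j))"
        using X[of m] by (auto simp: K_def)
      then show "\<delta> \<le> (\<Sum>j\<in>J. (norm (X m j))\<^sup>2)" using pos(2) by simp
    qed
  qed simp
  moreover have "(\<Sum>j\<in>J. cinner (z j) (W w (z j))) = 0" if w: "w \<noteq> []" for w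
  proof (rule sum_cinner_eq_0_if_minimal)
    fix c
    show "(\<Sum>j\<in>J. (norm (z j))\<^sup>2) \<le> (\<Sum>j\<in>J. (norm (z j + c *\<^sub>C W w (z j)))\<^sup>2)"
    proof (rule tendsto_lowerbound)
      show "(\<lambda>m. \<Sum>j\<in>J. (norm (X m j + c *\<^sub>C W w (X m j)))\<^sup>2)
          \<longlonglongrightarrow> (\<Sum>j\<in>J. (norm (z j + c *\<^sub>C W w (z j)))\<^sup>2)"
        by (intro tendsto_sum tendsto_power tendsto_norm tendsto_add scaleC.tendsto tendsto_const
            bounded_clinear_tendsto[OF W_bounded] lim)
      \<comment> \<open>As \<open>w\<close> is nonempty, adding a multiple of \<open>W w\<close>
        applied to \<open>x + p x\<close> only changes \<open>p\<close> within
        \<open>proper_polys S\<close>; the perturbed family stays in \<open>K\<close>.\<close>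
      have "(\<lambda>j. X m j + c *\<^sub>C W w (X m j)) \<in> K" for m
      proof -
        obtain p where p: "p \<in> proper_polys S" "X m = (\<lambda>j. x j + p (x j))"
          using X[of m] by (auto simp: K_def)
        have "(\<lambda>x. p x + (c *\<^sub>C W w x + c *\<^sub>C W w (p x))) \<in> proper_polys S"
          by (intro proper_polys_add proper_polys_scale proper_polys_W_comp proper_polys_W p w)
        from K[OF this] show ?thesis
          unfolding p by (simp add: bounded_clinear_add scaleC_add_right add.assoc)
      qed
      then show "\<forall>\<^sub>F m in sequentially. (\<Sum>j\<in>J. (norm (z j))\<^sup>2)
          \<le> (\<Sum>j\<in>J. (norm (X m j + c *\<^sub>C W w (X m j)))\<^sup>2)"
        using min by (intro always_eventually allI) blast
    qed simp
  qed
  ultimately show thesis using that[of z] pos(1) by simp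
qed

text \<open>For comparable words the common prefix cancels and leaves a nonempty word against the
  identity; incomparable words have orthogonal ranges anyway. So orthogonality of \<open>x\<close>
  to its proper images is all that has to be checked.\<close>

lemma wanderingI:
  assumes "x \<noteq> 0" "\<And>w. w \<noteq> [] \<Longrightarrow> cinner x (W w x) = 0"
  shows "\<exists>y. wandering S y"
proof -
  have *: "cinner (W w x) x = 0" if "w \<noteq> []" for w
    using assms(2)[OF that] by (subst cinner_cnj) simp
  have 0: "cinner (W u x) (W v x) = 0" if "u \<noteq> v" for u v
  proof (cases "(\<exists>t. u = v @ t) \<or> (\<exists>t. v = u @ t)")
    case True
    then show ?thesis
    proof (elim disjE exE)
      fix t assume "u = v @ t"
      with that show ?thesis using *[of t] by (auto simp: cinner_W_append)
    next
      fix t assume "v = u @ t"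
      with that show ?thesis using assms(2)[of t] by (auto simp: cinner_W_append)
    qed
  qed (auto intro!: cinner_W_eq_0)
  define y where "y = (1 / norm x) *\<^sub>R x"
  have "norm y = 1" using assms(1) by (simp add: y_def)
  then have "wandering S y"
    using 0 unfolding wandering_def y_def
    by (simp add: bounded_clinear_scaleR cinner.scaleR_left cinner.scaleR_right)
  then show ?thesis by blast
qed

text \<open>The form in which wandering vectors are produced below. Read contrapositively: without
  wandering vectors every \<open>x\<close> is approximated by \<open>- p x\<close> with
  \<open>p\<close> proper.\<close>

lemma wandering_if_positive_distance:
  assumes "\<delta> > 0" "\<And>p. p \<in> proper_polys S \<Longrightarrow> (norm (x + p x))\<^sup>2 \<ge> \<delta>"
  shows "\<exists>y. wandering S y"
proof -
  obtain z :: "unit \<Rightarrow> 'a" where "(\<Sum>j\<in>{()}. (norm (z j))\<^sup>2) > 0"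
    "\<And>w. w \<noteq> [] \<Longrightarrow> (\<Sum>j\<in>{()}. cinner (z j) (W w (z j))) = 0"
    by (rule wandering_family_if_positive_distance[of "{()}" \<delta> "\<lambda>_. x"]) (use assms in auto)
  then show ?thesis by (intro wanderingI[of "z ()"]) auto
qed

end

section \<open>Closures in the weak operator topology\<close>

lemma continuous_map_wot:
  "continuous_map wot euclidean (\<lambda>T. cinner (T x) (y::'a::complex_hilbert))"
proof -
  have "continuous_map wot (product_topology (\<lambda>_. euclidean) UNIV) (\<lambda>T (x, y). cinner (T x) (y::'a))"
    unfolding wot_def by (rule continuous_map_pullback[OF continuous_map_id, unfolded o_def id_def])
  then have "continuous_map wot euclidean (\<lambda>T. (\<lambda>(x, y). cinner (T x) (y::'a)) (x, y))"
    by (rule continuous_map_componentwise_UNIV[THEN iffD1, THEN spec])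
  then show ?thesis by simp
qed

text \<open>A basic weak neighbourhood constrains finitely many matrix entries. When the condition
  fails for the identity, the finite set \<open>F\<close> of pairs becomes the index set of the
  ampliation.\<close>

lemma in_wot_closure_iff:
  fixes T :: "'a::complex_hilbert \<Rightarrow> 'a"
  assumes A: "A \<subseteq> {T. bounded_clinear T}" and T: "bounded_clinear T"
  shows "T \<in> wot closure_of A \<longleftrightarrow>
    (\<forall>F e. finite F \<longrightarrow> e > 0 \<longrightarrow> (\<exists>R\<in>A. \<forall>(x, y)\<in>F. cmod (cinner (T x) y - cinner (R x) y) < e))"
proof
  assume L: "T \<in> wot closure_of A"
  show "\<forall>F e. finite F \<longrightarrow> e > 0 \<longrightarrow> (\<exists>R\<in>A. \<forall>(x, y)\<in>F. cmod (cinner (T x) y - cinner (R x) y) < e)"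
  proof (intro allI impI)
    fix F :: "('a \<times> 'a) set" and e :: real assume F: "finite F" "e > 0"
    let ?V = "{R \<in> topspace wot. \<forall>z\<in>F. cinner (R (fst z)) (snd z) \<in> ball (cinner (T (fst z)) (snd z)) e}"
    have "openin wot (topspace wot \<inter> (\<Inter>z\<in>F. {R \<in> topspace wot.
        cinner (R (fst z)) (snd z) \<in> ball (cinner (T (fst z)) (snd z)) e}))"
    proof (cases "F = {}")
      case False
      have "openin wot {R \<in> topspace wot. cinner (R (fst z)) (snd z) \<in> ball (cinner (T (fst z)) (snd z)) e}" for z
        by (rule openin_continuous_map_preimage[OF continuous_map_wot]) (simp add: open_openin[symmetric])
      then show ?thesis using F(1) False by (intro openin_Int openin_topspace openin_Inter) auto
    qed simp
    also have "topspace wot \<inter> (\<Inter>z\<in>F. {R \<in> topspace wot.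
        cinner (R (fst z)) (snd z) \<in> ball (cinner (T (fst z)) (snd z)) e}) = ?V" by auto
    finally have "openin wot ?V" .
    moreover have "T \<in> ?V" using F T by (auto simp: topspace_wot)
    ultimately have "\<exists>R. R \<in> A \<and> R \<in> ?V"
      by (intro L[unfolded in_closure_of, THEN conjunct2, rule_format] conjI)
    then obtain R where "R \<in> A" "R \<in> ?V" by (elim exE conjE)
    then show "\<exists>R\<in>A. \<forall>(x, y)\<in>F. cmod (cinner (T x) y - cinner (R x) y) < e"
      by (intro bexI[of _ R]) (auto simp: dist_norm)
  qed
next
  assume R: "\<forall>F e. finite F \<longrightarrow> e > 0 \<longrightarrow> (\<exists>R\<in>A. \<forall>(x, y)\<in>F. cmod (cinner (T x) y - cinner (R x) y) < e)"
  show "T \<in> wot closure_of A"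
    unfolding in_closure_of
  proof (intro conjI allI impI)
    show "T \<in> topspace wot" using T by (simp add: topspace_wot)
    fix V assume "T \<in> V \<and> openin wot V"
    then obtain U where U: "openin (product_topology (\<lambda>_::'a \<times> 'a. euclidean :: complex topology) UNIV) U"
      "V = (\<lambda>T (x, y). cinner (T x) (y::'a)) -` U \<inter> {T. bounded_clinear T}"
      "(\<lambda>(x, y). cinner (T x) y) \<in> U"
      unfolding wot_def openin_pullback_topology by auto
    then obtain X where X: "finite {i. X i \<noteq> UNIV}" "\<And>i. open (X i)"
      "(\<lambda>(x, y). cinner (T x) y) \<in> Pi\<^sub>E UNIV X" "Pi\<^sub>E UNIV X \<subseteq> U"
      unfolding openin_product_topology_alt by (auto simp: open_openin[symmetric])
    let ?F = "{i. X i \<noteq> UNIV}"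
    have "\<exists>e>0. ball (cinner (T (fst i)) (snd i)) e \<subseteq> X i" for i
      using X(2)[of i] X(3) by (cases i; intro open_contains_ball[THEN iffD1, rule_format])
        (auto simp: PiE_iff)
    then obtain e where e: "\<And>i. e i > 0" "\<And>i. ball (cinner (T (fst i)) (snd i)) (e i) \<subseteq> X i" by metis
    \<comment> \<open>One radius for all constrained entries; the inserted 1 covers the case that
      nothing is constrained.\<close>
    define d where "d = Min (insert 1 (e ` ?F))"
    have d: "d > 0" "\<And>i. i \<in> ?F \<Longrightarrow> d \<le> e i" unfolding d_def using X(1) e(1) by auto
    from R[rule_format, OF X(1) d(1)] obtain R where
      R: "R \<in> A" "\<And>x y. (x, y) \<in> ?F \<Longrightarrow> cmod (cinner (T x) y - cinner (R x) y) < d" by auto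
    have "cinner (R x) y \<in> X (x, y)" for x y
    proof (cases "(x, y) \<in> ?F")
      case True
      then have "cinner (R x) y \<in> ball (cinner (T x) y) (e (x, y))"
        using R(2)[OF True] d(2)[OF True] by (auto simp: dist_norm)
      then show ?thesis using e(2)[of "(x, y)"] by auto
    qed auto
    then have "(\<lambda>(x, y). cinner (R x) y) \<in> U" using X(4) by (auto simp: PiE_iff)
    then have "R \<in> V" unfolding U(2) using R(1) A by auto
    then show "\<exists>y. y \<in> A \<and> y \<in> V" using R(1) by blast
  qed
qed

section \<open>The absolute value of a selfadjoint operator\<close>

definition selfadjoint :: "('a::complex_hilbert \<Rightarrow> 'a) \<Rightarrow> bool" where
  "selfadjoint A \<longleftrightarrow> bounded_clinear A \<and> (\<forall>x y. cinner (A x) y = cinner x (A y))"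

lemma operator_algebraD:
  assumes "operator_algebra A"
  shows "T \<in> A \<Longrightarrow> bounded_clinear T"
    and "T \<in> A \<Longrightarrow> R \<in> A \<Longrightarrow> (\<lambda>x. T x + R x) \<in> A"
    and "T \<in> A \<Longrightarrow> (\<lambda>x. c *\<^sub>C T x) \<in> A"
    and "T \<in> A \<Longrightarrow> R \<in> A \<Longrightarrow> (\<lambda>x. T (R x)) \<in> A"
    and "(\<lambda>_. 0) \<in> A"
  using assms by (auto simp: operator_algebra_def o_def)

lemma operator_algebra_diff:
  assumes "operator_algebra A" "T \<in> A" "R \<in> A"
  shows "(\<lambda>x. T x - R x) \<in> A"
  using operator_algebraD(2)[OF assms(1,2) operator_algebraD(3)[OF assms(1,3), of "-1"]]
  by (simp add: scaleC_minus_one)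

lemma operator_algebra_scaleR:
  assumes "operator_algebra A" "T \<in> A"
  shows "(\<lambda>x. r *\<^sub>R T x) \<in> A"
  using operator_algebraD(3)[OF assms, of "of_real r"] by (simp add: scaleC_of_real)

lemma closedin_wot_pointwise_limit:
  fixes Y :: "nat \<Rightarrow> 'a::complex_hilbert \<Rightarrow> 'a"
  assumes "closedin wot A" "\<And>n. Y n \<in> A" "bounded_clinear T" "\<And>x. (\<lambda>n. Y n x) \<longlonglongrightarrow> T x"
  shows "T \<in> A"
proof (rule limitin_closedin[of wot Y T sequentially A])
  have "\<And>n. bounded_clinear (Y n)"
    using assms(1,2) closedin_subset topspace_wot by blast
  then show "limitin wot Y T sequentially"
    unfolding limitin_wot using assms by (auto intro!: cinner.tendsto)
qed (use assms in auto)

text \<open>The absolute value is \<open>K (1 - Y)\<close>, where \<open>Y\<close> solves \<open>Y = (R + Y\<^sup>2) / 2\<close> for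
  \<open>R = 1 - (B / K)\<^sup>2\<close>; the iteration converges because it is dominated by its scalar version.\<close>

lemma selfadjoint_absolute_value:
  fixes B :: "'a::complex_hilbert \<Rightarrow> 'a"
  assumes B: "selfadjoint B"
  obtains C where "selfadjoint C" "\<And>x. 0 \<le> Re (cinner (C x) x)" "\<And>x. C (C x) = B (B x)"
    "\<And>D x. bounded_clinear D \<Longrightarrow> (\<And>x. D (B x) = B (D x)) \<Longrightarrow> D (C x) = C (D x)"
    "\<And>A. operator_algebra A \<Longrightarrow> closedin wot A \<Longrightarrow> id \<in> A \<Longrightarrow> B \<in> A \<Longrightarrow> C \<in> A"
proof -
  have Bb: "bounded_clinear B" and Bs: "\<And>x y. cinner (B x) y = cinner x (B y)"
    using B by (auto simp: selfadjoint_def)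
  obtain K where K: "\<And>x. norm (B x) \<le> norm x * K" "K > 0"
    using bounded_linear.pos_bounded[OF bounded_clinear_bounded_linear[OF Bb]] by auto
  define B' where "B' x = (1 / K) *\<^sub>R B x" for x
  have B'_c: "B' = (\<lambda>x. of_real (1 / K) *\<^sub>C B x)" by (rule ext) (simp only: B'_def scaleC_of_real)
  have B'b: "bounded_clinear B'" unfolding B'_c by (rule bounded_clinear_scale[OF Bb])
  have B's: "cinner (B' x) y = cinner x (B' y)" for x y
    by (simp add: B'_def cinner.scaleR_left cinner.scaleR_right Bs)
  have B'n: "norm (B' x) \<le> norm x" for x
    using K by (simp add: B'_def divide_le_eq)
  define R where "R x = x - B' (B' x)" for x
  have Rb: "bounded_clinear R"
    unfolding R_def
    using bounded_clinear_plus[OF bounded_clinear_ident bounded_clinear_scale[OF bounded_clinear_comp[OF B'b B'b], of "-1"]]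
    by (simp add: scaleC_minus_one)
  have Rs: "cinner (R x) y = cinner x (R y)" for x y
    by (simp add: R_def cinner.diff_left cinner.diff_right B's)
  have Rn: "norm (R x) \<le> norm x" for x
  proof -
    have "(norm (R x))\<^sup>2 = (norm x)\<^sup>2 + (norm (B' (B' x)))\<^sup>2 - 2 * (norm (B' x))\<^sup>2"
      unfolding R_def norm_sq_diff by (simp add: B's[symmetric] norm_sq_eq_Re_cinner[of "B' x"])
    moreover have "(norm (B' (B' x)))\<^sup>2 \<le> (norm (B' x))\<^sup>2" by (intro power_mono B'n) auto
    ultimately have "(norm (R x))\<^sup>2 \<le> (norm x)\<^sup>2" using zero_le_power2[of "norm (B' x)"] by linarith
    then show ?thesis by (rule power2_le_imp_le) simp
  qed
  define Y where "Y = rec_nat (\<lambda>_::'a. 0::'a) (\<lambda>_ T x. (1/2) *\<^sub>R (R x + T (T x)))"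
  have Y0: "Y 0 = (\<lambda>_. 0)" and YS: "Y (Suc n) = (\<lambda>x. (1/2) *\<^sub>R (R x + Y n (Y n x)))" for n
    by (simp_all add: Y_def)
  \<comment> \<open>The same iteration with the contraction \<open>R\<close> replaced by the number
    1. It increases and stays below 1, so it is Cauchy and dominates the increments of
    \<open>Y\<close>.\<close>
  define s where "s = rec_nat (0::real) (\<lambda>_ t. (1/2) * (1 + t\<^sup>2))"
  have s0: "s 0 = 0" and sS: "s (Suc n) = (1/2) * (1 + (s n)\<^sup>2)" for n by (simp_all add: s_def)
  have s01: "0 \<le> s n \<and> s n \<le> 1" for n
    by (induction n) (auto simp: s0 sS power_le_one intro: add_nonneg_nonneg)
  have sinc: "s n \<le> s (Suc n)" for n
    using zero_le_power2[of "s n - 1"] unfolding sS power2_diff by simp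
  have Yb: "bounded_clinear (Y n)" for n
  proof (induction n)
    case 0
    show ?case unfolding Y0 by (rule bounded_clinearI[where K = 0]) simp_all
  next
    case (Suc n)
    have "bounded_clinear (\<lambda>x. of_real (1/2) *\<^sub>C (R x + Y n (Y n x)))"
      by (intro bounded_clinear_scale bounded_clinear_plus Rb bounded_clinear_comp[OF Suc Suc])
    then show ?case unfolding YS scaleC_of_real .
  qed
  have Ys: "cinner (Y n x) y = cinner x (Y n y)" for n x y
    by (induction n arbitrary: x y)
      (simp_all add: Y0 YS cinner.scaleR_left cinner.scaleR_right cinner_add_left cinner_add_right Rs)
  have Yn: "norm (Y n x) \<le> s n * norm x" for n x
  proof (induction n arbitrary: x)
    case (Suc n)
    have "norm (Y n (Y n x)) \<le> s n * (s n * norm x)"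
      using Suc[of "Y n x"] Suc[of x] s01[of n] by (meson mult_left_mono order_trans)
    then have "norm (R x + Y n (Y n x)) \<le> norm x + s n * (s n * norm x)"
      using Rn[of x] by (intro norm_triangle_mono) auto
    then show ?case unfolding YS sS norm_scaleR by (simp add: power2_eq_square algebra_simps)
  qed (simp add: Y0 s0)
  have DY: "D (Y n x) = Y n (D x)" if "bounded_clinear D" "\<And>x. D (B x) = B (D x)" for D n x
  proof (induction n arbitrary: x)
    case 0
    show ?case using that(1) by (simp add: Y0 bounded_clinear_zero)
  next
    case (Suc n)
    have "D (R x) = R (D x)" for x
      by (simp add: R_def B'_def bounded_clinear_diff[OF that(1)] bounded_clinear_scaleR[OF that(1)] bounded_clinear_scaleR[OF Bb] that(2))
    then show ?case by (simp add: YS bounded_clinear_scaleR[OF that(1)] bounded_clinear_add[OF that(1)] Suc)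
  qed
  have YB: "Y n (B x) = B (Y n x)" for n x using DY[of B] Bb by simp
  \<comment> \<open>Because the iterates commute, the difference of the squares of
    \<open>Y (Suc n)\<close> and \<open>Y n\<close> factors as it does for numbers.\<close>
  have YY: "Y m (Y n x) = Y n (Y m x)" for m n x using DY[of "Y m"] Yb YB by simp
  have step: "norm (Y (Suc n) x - Y n x) \<le> (s (Suc n) - s n) * norm x" for n x
  proof (induction n)
    case 0
    then show ?case using Rn[of x] by (simp add: Y0 YS s0 sS)
  next
    case (Suc n)
    let ?d = "Y (Suc n) x - Y n x"
    have "Y (Suc n) (Y (Suc n) x) - Y n (Y n x) = Y (Suc n) ?d + Y n ?d"
      by (simp add: bounded_clinear_diff[OF Yb] YY[of n "Suc n"])
    then have "Y (Suc (Suc n)) x - Y (Suc n) x = (1/2) *\<^sub>R (Y (Suc n) ?d + Y n ?d)"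
      unfolding YS[of "Suc n"] YS[of n] by (simp add: algebra_simps)
    then have "norm (Y (Suc (Suc n)) x - Y (Suc n) x) \<le> (1/2) * (norm (Y (Suc n) ?d) + norm (Y n ?d))"
      by (simp add: norm_triangle_ineq)
    also have "\<dots> \<le> (1/2) * ((s (Suc n) + s n) * norm ?d)"
      using Yn[of "Suc n" ?d] Yn[of n ?d] by (simp add: algebra_simps)
    also have "\<dots> \<le> (1/2) * ((s (Suc n) + s n) * ((s (Suc n) - s n) * norm x))"
      using Suc s01 by (intro mult_left_mono) auto
    also have "\<dots> = (s (Suc (Suc n)) - s (Suc n)) * norm x"
      unfolding sS[of "Suc n"] sS[of n] by (simp add: power2_eq_square algebra_simps)
    finally show ?case .
  qed
  have dom: "norm (Y (n + k) x - Y n x) \<le> (s (n + k) - s n) * norm x" for n k x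
  proof (induction k)
    case (Suc k)
    have "norm (Y (n + Suc k) x - Y n x) \<le> norm (Y (Suc (n + k)) x - Y (n + k) x) + norm (Y (n + k) x - Y n x)"
      by (rule order_trans[OF _ norm_triangle_ineq]) simp
    then show ?case using step[of "n + k" x] Suc by (simp add: algebra_simps)
  qed simp
  have "convergent s"
  proof -
    have "incseq s" using sinc by (intro incseq_SucI)
    then show ?thesis using s01 by (metis convergentI incseq_convergent)
  qed
  then have sC: "Cauchy s" by (rule convergent_Cauchy)
  have "Cauchy (\<lambda>n. Y n x)" for x
  proof (rule metric_CauchyI)
    fix e :: real assume e: "e > 0"
    then have "e / (norm x + 1) > 0" by (simp add: add_nonneg_pos)
    then obtain M where M: "\<And>m n. m \<ge> M \<Longrightarrow> n \<ge> M \<Longrightarrow> dist (s m) (s n) < e / (norm x + 1)"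
      using metric_CauchyD[OF sC] by blast
    have *: "dist (Y (n + k) x) (Y n x) < e" if "n \<ge> M" for n k
    proof -
      have "s (n + k) - s n < e / (norm x + 1)" using M[of "n + k" n] that by (auto simp: dist_real_def)
      moreover have "0 \<le> s (n + k) - s n" using sinc by (simp add: lift_Suc_mono_le)
      ultimately have "(s (n + k) - s n) * norm x \<le> e / (norm x + 1) * norm x"
        by (intro mult_right_mono) auto
      also have "\<dots> < e" using e by (simp add: pos_divide_less_eq add_nonneg_pos)
      finally show ?thesis using dom[of n k x] by (simp add: dist_norm)
    qed
    have "dist (Y m x) (Y n x) < e" if "m \<ge> M" "n \<ge> M" for m n
      using *[of n "m - n"] *[of m "n - m"] that by (cases "n \<le> m") (auto simp: dist_commute)
    then show "\<exists>M. \<forall>m\<ge>M. \<forall>n\<ge>M. dist (Y m x) (Y n x) < e" by blast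
  qed
  then have "\<forall>x. \<exists>l. (\<lambda>n. Y n x) \<longlonglongrightarrow> l" using Cauchy_convergent convergent_def by blast
  from choice[OF this] obtain L where L: "\<And>x. (\<lambda>n. Y n x) \<longlonglongrightarrow> L x" by auto
  have Ln: "norm (L x) \<le> norm x" for x
  proof (rule tendsto_upperbound[OF tendsto_norm[OF L]])
    show "\<forall>\<^sub>F n in sequentially. norm (Y n x) \<le> norm x"
      using Yn s01 by (intro always_eventually allI) (meson mult_left_le_one_le norm_ge_zero order_trans)
  qed simp
  have Lb: "bounded_clinear L"
  proof (rule bounded_clinearI[where K = 1])
    show "L (x + y) = L x + L y" for x y
      by (rule LIMSEQ_unique[OF L]) (simp add: bounded_clinear_add[OF Yb] tendsto_add L)
    show "L (c *\<^sub>C x) = c *\<^sub>C L x" for c x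
      by (rule LIMSEQ_unique[OF L]) (simp add: bounded_clinear_scaleC[OF Yb] scaleC.tendsto L)
  qed (use Ln in simp)
  have Ls: "cinner (L x) y = cinner x (L y)" for x y
    by (rule LIMSEQ_unique[OF cinner.tendsto[OF L tendsto_const]])
      (simp add: Ys cinner.tendsto L)
  have YYL: "(\<lambda>n. Y n (Y n x)) \<longlonglongrightarrow> L (L x)" for x
  proof -
    have "(\<lambda>n. Y n (Y n x - L x)) \<longlonglongrightarrow> 0"
    proof (rule Lim_null_comparison)
      show "\<forall>\<^sub>F n in sequentially. norm (Y n (Y n x - L x)) \<le> norm (Y n x - L x)"
        using Yn s01 by (intro always_eventually allI) (meson mult_left_le_one_le norm_ge_zero order_trans)
      show "(\<lambda>n. norm (Y n x - L x)) \<longlonglongrightarrow> 0"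
        using L[of x] by (simp add: LIM_zero tendsto_norm_zero)
    qed
    from tendsto_add[OF this L[of "L x"]] show ?thesis by (simp add: bounded_clinear_diff[OF Yb])
  qed
  have Leq: "L x = (1/2) *\<^sub>R (R x + L (L x))" for x
  proof (rule LIMSEQ_unique)
    show "(\<lambda>n. Y (Suc n) x) \<longlonglongrightarrow> L x" by (rule LIMSEQ_Suc[OF L])
    show "(\<lambda>n. Y (Suc n) x) \<longlonglongrightarrow> (1/2) *\<^sub>R (R x + L (L x))"
      unfolding YS by (intro tendsto_intros YYL)
  qed
  define C where "C x = K *\<^sub>R (x - L x)" for x
  have C_c: "C = (\<lambda>x. of_real K *\<^sub>C (x + (-1) *\<^sub>C L x))"
    by (rule ext) (simp only: C_def scaleC_of_real scaleC_minus_one diff_conv_add_uminus)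
  have Cb: "bounded_clinear C" unfolding C_c
    by (intro bounded_clinear_scale bounded_clinear_plus bounded_clinear_ident Lb)
  have Cs: "cinner (C x) y = cinner x (C y)" for x y
    by (simp add: C_def cinner.scaleR_left cinner.scaleR_right cinner.diff_left cinner.diff_right Ls)
  show thesis
  proof
    show "selfadjoint C" using Cb Cs by (simp add: selfadjoint_def)
    fix x
    have "Re (cinner (L x) x) \<le> norm (L x) * norm x"
      using complex_Re_le_cmod norm_cinner_le order_trans by blast
    also have "\<dots> \<le> norm x * norm x" using Ln by (intro mult_right_mono) auto
    finally show "0 \<le> Re (cinner (C x) x)"
      using K(2) by (simp add: C_def cinner.scaleR_left cinner.diff_left cinner_self power2_eq_square)
    have "2 *\<^sub>R L x = R x + L (L x)" by (subst Leq) simp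
    \<comment> \<open>The fixed point equation \<open>2 L = R + L^2\<close> says that
      \<open>(1 - L)^2 = 1 - R\<close>, which is the square of \<open>B'\<close>.\<close>
    then have "x - L x - (L x - L (L x)) = B' (B' x)"
      by (simp add: R_def scaleR_2 algebra_simps)
    then have "C (C x) = (K * K) *\<^sub>R B' (B' x)"
      by (simp add: C_def bounded_clinear_scaleR[OF Lb] bounded_clinear_diff[OF Lb] flip: scaleR_diff_right)
    then show "C (C x) = B (B x)"
      using K(2) by (simp add: B'_def bounded_clinear_scaleR[OF Bb])
  next
    fix D x assume D: "bounded_clinear D" "\<And>x. D (B x) = B (D x)"
    have "D (L x) = L (D x)"
      by (rule LIMSEQ_unique[OF bounded_clinear_tendsto[OF D(1) L]]) (simp add: DY[OF D] L)
    then show "D (C x) = C (D x)"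
      by (simp add: C_def bounded_clinear_scaleR[OF D(1)] bounded_clinear_diff[OF D(1)])
  next
    fix A assume A: "operator_algebra A" "closedin wot A" "id \<in> A" "B \<in> A"
    have id: "(\<lambda>x. x) \<in> A" using A(3) by (simp add: id_def)
    have B'A: "B' \<in> A" unfolding B'_c by (rule operator_algebraD(3)[OF A(1,4)])
    have RA: "R \<in> A" unfolding R_def
      by (rule operator_algebra_diff[OF A(1) id operator_algebraD(4)[OF A(1) B'A B'A]])
    have "Y n \<in> A" for n
    proof (induction n)
      case (Suc n)
      show ?case unfolding YS
        by (rule operator_algebra_scaleR[OF A(1) operator_algebraD(2)[OF A(1) RA operator_algebraD(4)[OF A(1) Suc Suc]]])
    qed (simp add: Y0 operator_algebraD(5)[OF A(1)])
    then have "L \<in> A" using closedin_wot_pointwise_limit[OF A(2) _ Lb L] by blast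
    then show "C \<in> A" unfolding C_def
      by (intro operator_algebra_scaleR[OF A(1)] operator_algebra_diff[OF A(1) id])
  qed
qed

text \<open>Let \<open>T = B - t\<close> and let \<open>C\<close> be its absolute value, which lies
  in \<open>A\<close> and commutes with \<open>T\<close>. Then \<open>(C - T) (C + T) = 0\<close>,
  so \<open>T\<close> is \<open>C\<close> or \<open>- C\<close>, and \<open>B - t\<close> has a sign
  for every real \<open>t\<close>. At the largest \<open>t\<close> with \<open>B\<close> at least
  \<open>t\<close> the quadratic form of \<open>B\<close> is exactly \<open>t\<close> times the
  squared norm.\<close>

lemma selfadjoint_scalar_if_no_zero_divisors:
  fixes A :: "('a::complex_hilbert \<Rightarrow> 'a) set"
  assumes A: "operator_algebra A" "closedin wot A" "id \<in> A"
    and dom: "\<And>T R. T \<in> A \<Longrightarrow> R \<in> A \<Longrightarrow> (\<And>x. T (R x) = 0) \<Longrightarrow> (\<forall>x. T x = 0) \<or> (\<forall>x. R x = 0)"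
    and B: "selfadjoint B" "B \<in> A"
  obtains t where "\<And>x. B x = t *\<^sub>R x"
proof -
  have Bb: "bounded_clinear B" and Bs: "\<And>x y. cinner (B x) y = cinner x (B y)"
    using B by (auto simp: selfadjoint_def)
  have id: "(\<lambda>x. x) \<in> A" using A(3) by (simp add: id_def)
  have sign: "(\<forall>x. Re (cinner (B x) x) \<ge> t * (norm x)\<^sup>2) \<or> (\<forall>x. Re (cinner (B x) x) \<le> t * (norm x)\<^sup>2)" for t
  proof -
    define T where "T x = B x - t *\<^sub>R x" for x
    have TA: "T \<in> A" unfolding T_def by (intro operator_algebra_diff operator_algebra_scaleR A B id)
    have Ts: "selfadjoint T"
      using operator_algebraD(1)[OF A(1) TA] unfolding selfadjoint_def
      by (simp add: T_def cinner.diff_left cinner.diff_right cinner.scaleR_left cinner.scaleR_right Bs)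
    have Tb: "bounded_clinear T" using Ts by (simp add: selfadjoint_def)
    obtain C where C: "selfadjoint C" "\<And>x. 0 \<le> Re (cinner (C x) x)" "\<And>x. C (C x) = T (T x)"
      "\<And>D x. bounded_clinear D \<Longrightarrow> (\<And>x. D (T x) = T (D x)) \<Longrightarrow> D (C x) = C (D x)"
      "\<And>A. operator_algebra A \<Longrightarrow> closedin wot A \<Longrightarrow> id \<in> A \<Longrightarrow> T \<in> A \<Longrightarrow> C \<in> A"
      by (fact selfadjoint_absolute_value[OF Ts])
    note CA = C(5)[OF A TA]
    have Cb: "bounded_clinear C" using C(1) by (simp add: selfadjoint_def)
    have "T (C x) = C (T x)" for x by (rule C(4)[OF Tb]) simp
    then have "C (C x + T x) - T (C x + T x) = 0" for x
      by (simp add: bounded_clinear_add[OF Cb] bounded_clinear_add[OF Tb] C(3))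
    then have "(\<forall>x. C x - T x = 0) \<or> (\<forall>x. C x + T x = 0)"
      by (intro dom operator_algebra_diff operator_algebraD(2) A(1) TA CA)
    then have "(\<forall>x. T x = C x) \<or> (\<forall>x. T x = - C x)"
      by (auto simp: eq_neg_iff_add_eq_0 add.commute)
    then have "(\<forall>x. Re (cinner (T x) x) \<ge> 0) \<or> (\<forall>x. Re (cinner (T x) x) \<le> 0)"
      using C(2) by (auto simp: cinner.minus_left)
    then show ?thesis
      by (simp add: T_def cinner.diff_left cinner.scaleR_left cinner_self)
  qed
  define P where "P t \<longleftrightarrow> (\<forall>x. Re (cinner (B x) x) \<ge> t * (norm x)\<^sup>2)" for t
  obtain K where K: "\<And>x. norm (B x) \<le> norm x * K" "K > 0"
    using bounded_linear.pos_bounded[OF bounded_clinear_bounded_linear[OF Bb]] by auto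
  have BK: "\<bar>Re (cinner (B x) x)\<bar> \<le> K * (norm x)\<^sup>2" for x
  proof -
    have "\<bar>Re (cinner (B x) x)\<bar> \<le> norm (B x) * norm x"
      using abs_Re_le_cmod norm_cinner_le order_trans by blast
    also have "\<dots> \<le> norm x * K * norm x" by (intro mult_right_mono K) auto
    finally show ?thesis by (simp add: power2_eq_square mult_ac)
  qed
  show thesis
  proof (cases "\<exists>x::'a. x \<noteq> 0")
    case False
    then show thesis using that[of 0] by metis
  next
    case True
    then obtain x0 :: 'a where x0: "x0 \<noteq> 0" by blast
    have P_le: "t \<le> K" if "P t" for t
    proof -
      have "t * (norm x0)\<^sup>2 \<le> K * (norm x0)\<^sup>2" using that BK[of x0] unfolding P_def by (smt (verit))
      then show ?thesis using x0 by simp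
    qed
    have PK: "P (- K)" unfolding P_def using BK by (smt (verit) mult_minus_left)
    define t where "t = Sup {t. P t}"
    have bdd: "bdd_above {t. P t}" using P_le by (intro bdd_aboveI[of _ K]) auto
    have eq: "Re (cinner (B x) x) = t * (norm x)\<^sup>2" for x
    proof (cases "x = 0")
      case False
      then have nx: "(norm x)\<^sup>2 > 0" by simp
      let ?r = "Re (cinner (B x) x) / (norm x)\<^sup>2"
      have "t \<le> ?r" unfolding t_def
      proof (rule cSup_least)
        show "{t. P t} \<noteq> {}" using PK by blast
      qed (use nx in \<open>auto simp: P_def pos_le_divide_eq\<close>)
      moreover have "?r \<le> t"
      proof (rule dense_le)
        fix u assume "u < ?r"
        then have "\<not> Re (cinner (B x) x) \<le> u * (norm x)\<^sup>2" using nx by (simp add: pos_less_divide_eq)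
        then have "P u" using sign[of u] unfolding P_def by blast
        then show "u \<le> t" unfolding t_def by (intro cSup_upper bdd) auto
      qed
      ultimately have "?r = t" by simp
      then show ?thesis using nx by (simp add: field_simps)
    qed simp
    have "B x - t *\<^sub>R x = 0" for x
    proof -
      define T where "T x = B x - t *\<^sub>R x" for x
      have T0: "Re (cinner (T x) x) = 0" for x
        by (simp add: T_def cinner.diff_left cinner.scaleR_left cinner_self eq)
      have Tadd: "T (x + y) = T x + T y" for x y
        by (simp add: T_def bounded_clinear_add[OF Bb] algebra_simps)
      \<comment> \<open>Polarization of the vanishing quadratic form. With the symmetry of
        \<open>T\<close> it gives \<open>Re (cinner (T x) y) = 0\<close>, and \<open>y = T x\<close>
        concludes.\<close>
      have "Re (cinner (T x) y) + Re (cinner (T y) x) = 0" for x y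
        using T0[of "x + y"] T0[of x] T0[of y] by (simp add: Tadd cinner_add_left cinner_add_right)
      moreover have "Re (cinner (T y) x) = Re (cinner (T x) y)" for x y
        unfolding T_def cinner.diff_left cinner.scaleR_left Bs[of y x]
        by (subst (1 2) cinner_cnj) (simp add: Bs)
      ultimately have "Re (cinner (T x) (T x)) = 0" by (smt (verit))
      then show ?thesis by (simp add: cinner_self T_def)
    qed
    then show thesis using that[of t] by simp
  qed
qed

section \<open>The algebra of type L\<close>

lemma ell2_eqI: "(\<And>w. ell2_coord x w = ell2_coord y w) \<Longrightarrow> x = y"
  by (simp add: ell2_coord_inject[symmetric] fun_eq_iff)

lemma continuous_map_wot_mult:
  "continuous_map wot euclidean (\<lambda>T. cinner (T x) (y::'a::complex_hilbert) * c)"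
  using continuous_map_wot[of x "cnj c *\<^sub>C y"] by (simp add: cinner_scaleC_right mult.commute)

definition splits :: "'i list \<Rightarrow> ('i list \<times> 'i list) set" where
  "splits t = {(u, v). u @ v = t}"

lemma finite_splits [simp]: "finite (splits t)"
proof (rule finite_subset)
  show "splits t \<subseteq> (\<lambda>k. (take k t, drop k t)) ` {..length t}"
  proof
    fix z assume "z \<in> splits t"
    then have "z = (take (length (fst z)) t, drop (length (fst z)) t)" "length (fst z) \<le> length t"
      by (auto simp: splits_def)
    then show "z \<in> (\<lambda>k. (take k t, drop k t)) ` {..length t}" by blast
  qed
qed simp

text \<open>Associativity of convolution on the free semigroup: both sides run over the
  factorizations of \<open>t\<close> into three words.\<close>

lemma sum_splits_assoc:
  fixes f g h :: "'i list \<Rightarrow> complex"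
  shows "(\<Sum>(u, v)\<in>splits t. f u * (\<Sum>(v1, v2)\<in>splits v. g v1 * h v2))
    = (\<Sum>(u, v)\<in>splits t. (\<Sum>(u1, u2)\<in>splits u. f u1 * g u2) * h v)"
proof -
  have "(\<Sum>(u, v)\<in>splits t. f u * (\<Sum>(v1, v2)\<in>splits v. g v1 * h v2))
      = (\<Sum>z\<in>(SIGMA z:splits t. splits (snd z)). f (fst (fst z)) * (g (fst (snd z)) * h (snd (snd z))))"
    unfolding split_def sum_distrib_left by (subst sum.Sigma) (simp_all add: split_def)
  also have "\<dots> = (\<Sum>z\<in>(SIGMA z:splits t. splits (fst z)). f (fst (snd z)) * g (snd (snd z)) * h (snd (fst z)))"
    by (rule sum.reindex_bij_witness[
          where i = "\<lambda>((u, v), u1, u2). ((u1, u2 @ v), u2, v)"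
            and j = "\<lambda>((u, v), v1, v2). ((u @ v1, v2), u, v1)"])
      (auto simp: splits_def)
  also have "\<dots> = (\<Sum>(u, v)\<in>splits t. (\<Sum>(u1, u2)\<in>splits u. f u1 * g u2) * h v)"
    unfolding split_def sum_distrib_right by (subst sum.Sigma) (simp_all add: split_def)
  finally show ?thesis .
qed

text \<open>Operators acting as left convolution by their symbol \<open>T \<xi>\<^sub>\<emptyset>\<close>; these conditions are stable
  under weak limits.\<close>

definition convolution_operators :: "('i list ell2 \<Rightarrow> 'i list ell2) set" where
  "convolution_operators = {T. bounded_clinear T \<and>
     (\<forall>x t. ell2_coord (T x) t = (\<Sum>(u, v)\<in>splits t. ell2_coord (T (ket [])) u * ell2_coord x v))}"

lemma convolution_operatorsD:
  assumes "T \<in> convolution_operators"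
  shows "bounded_clinear T"
    and "ell2_coord (T x) t = (\<Sum>(u, v)\<in>splits t. ell2_coord (T (ket [])) u * ell2_coord x v)"
  using assms unfolding convolution_operators_def by blast+

lemma convolution_operatorsI:
  assumes "bounded_clinear T"
    and "\<And>x t. ell2_coord (T x) t = (\<Sum>(u, v)\<in>splits t. ell2_coord (T (ket [])) u * ell2_coord x v)"
  shows "T \<in> convolution_operators"
  using assms unfolding convolution_operators_def by blast

lemma operator_algebra_convolution_operators: "operator_algebra convolution_operators"
  unfolding operator_algebra_def
proof (intro conjI ballI allI)
  show "convolution_operators \<subseteq> {T. bounded_clinear T}" using convolution_operatorsD(1) by blast
  show "(\<lambda>_. 0) \<in> convolution_operators"
    by (intro convolution_operatorsI bounded_clinearI[where K = 0]) (simp_all add: zero_ell2.rep_eq split_def)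
next
  fix T R :: "'i list ell2 \<Rightarrow> 'i list ell2" and c
  assume T: "T \<in> convolution_operators"
  note T' = convolution_operatorsD[OF T]
  have "ell2_coord (c *\<^sub>C T x) t = (\<Sum>(u, v)\<in>splits t. ell2_coord (c *\<^sub>C T (ket [])) u * ell2_coord x v)" for x t
    unfolding scaleC_ell2.rep_eq T'(2)[of x] by (simp add: sum_distrib_left mult.assoc split_def)
  then show "(\<lambda>x. c *\<^sub>C T x) \<in> convolution_operators"
    by (intro convolution_operatorsI bounded_clinear_scale T'(1))
  assume R: "R \<in> convolution_operators"
  note R' = convolution_operatorsD[OF R]
  have "ell2_coord (T x + R x) t = (\<Sum>(u, v)\<in>splits t. ell2_coord (T (ket []) + R (ket [])) u * ell2_coord x v)" for x t
    unfolding plus_ell2.rep_eq T'(2)[of x] R'(2)[of x] by (simp add: distrib_right sum.distrib split_def)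
  then show "(\<lambda>x. T x + R x) \<in> convolution_operators"
    by (intro convolution_operatorsI bounded_clinear_plus T'(1) R'(1))
  have "ell2_coord (T (R x)) t = (\<Sum>(u, v)\<in>splits t. ell2_coord (T (R (ket []))) u * ell2_coord x v)" for x t
    unfolding T'(2)[of "R x"] T'(2)[of "R (ket [])"] R'(2)[of x] by (rule sum_splits_assoc)
  then show "T \<circ> R \<in> convolution_operators"
    unfolding o_def by (intro convolution_operatorsI bounded_clinear_comp[OF T'(1) R'(1)])
qed

text \<open>A word has finitely many splits, so for fixed \<open>x\<close> and \<open>t\<close> the
  defining identity is a linear equation between finitely many matrix entries of \<open>T\<close>,
  which is a weakly closed condition.\<close>

lemma closedin_convolution_operators: "closedin wot (convolution_operators :: ('i list ell2 \<Rightarrow> 'i list ell2) set)"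
proof -
  let ?f = "\<lambda>x t (T :: 'i list ell2 \<Rightarrow> 'i list ell2). cinner (T x) (ket t)
    - (\<Sum>(u, v)\<in>splits t. cinner (T (ket [])) (ket u) * ell2_coord x v)"
  have "closedin wot {T \<in> topspace wot. ?f x t T \<in> {0}}" for x t
  proof (rule closedin_continuous_map_preimage)
    show "continuous_map wot euclidean (?f x t)"
      unfolding split_def
      by (intro continuous_map_diff continuous_map_sum continuous_map_wot continuous_map_wot_mult) simp
  qed simp
  then have "closedin wot (\<Inter>z. {T \<in> topspace wot. ?f (fst z) (snd z) T \<in> {0}})"
    by (intro closedin_Inter) auto
  also have "(\<Inter>z. {T \<in> topspace wot. ?f (fst z) (snd z) T \<in> {0}}) = convolution_operators"
  proof (intro equalityI subsetI)
    fix T :: "'i list ell2 \<Rightarrow> 'i list ell2"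
    assume "T \<in> (\<Inter>z. {T \<in> topspace wot. ?f (fst z) (snd z) T \<in> {0}})"
    then have *: "T \<in> {T \<in> topspace wot. ?f (fst z) (snd z) T \<in> {0}}" for z by (rule INT_D) simp
    have "bounded_clinear T" using *[of undefined] unfolding topspace_wot by (elim CollectE conjE)
    moreover have "?f x t T = 0" for x t using *[of "(x, t)"] unfolding fst_conv snd_conv by (elim CollectE conjE singletonE)
    ultimately show "T \<in> convolution_operators"
      unfolding cinner_ket right_minus_eq by (intro convolution_operatorsI)
  next
    fix T :: "'i list ell2 \<Rightarrow> 'i list ell2" assume "T \<in> convolution_operators"
    note T = convolution_operatorsD[OF this]
    show "T \<in> (\<Inter>z. {T \<in> topspace wot. ?f (fst z) (snd z) T \<in> {0}})"
      unfolding cinner_ket topspace_wot singleton_iff right_minus_eq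
      by (intro INT_I CollectI conjI T)
  qed
  finally show ?thesis .
qed

lemma id_in_convolution_operators: "(id :: 'i list ell2 \<Rightarrow> _) \<in> convolution_operators"
proof -
  have "ell2_coord x t = (\<Sum>(u, v)\<in>splits t. ell2_coord (ket []) u * ell2_coord x v)" for x :: "'i list ell2" and t
  proof -
    have "(\<Sum>(u, v)\<in>splits t. ell2_coord (ket []) u * ell2_coord x v)
        = (\<Sum>(u, v)\<in>{([] :: 'i list, t)}. ell2_coord (ket []) u * ell2_coord x v)"
    proof (rule sum.mono_neutral_right)
      show "\<forall>z\<in>splits t - {([], t)}. (case z of (u, v) \<Rightarrow> ell2_coord (ket []) u * ell2_coord x v) = 0"
        by (auto simp: splits_def ket.rep_eq split: if_splits)
      show "{([] :: 'i list, t)} \<subseteq> splits t" by (simp add: splits_def)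
    qed (rule finite_splits)
    then show ?thesis by (simp add: ket.rep_eq)
  qed
  then show ?thesis by (intro convolution_operatorsI bounded_clinear_id) (unfold id_apply)
qed

lemma left_creation_in_convolution_operators: "left_creation (w :: 'i list) \<in> convolution_operators"
proof -
  have "ell2_coord (left_creation w x) t
      = (\<Sum>(u, v)\<in>splits t. ell2_coord (left_creation w (ket [])) u * ell2_coord x v)" for x :: "'i list ell2" and t
  proof -
    have "(\<Sum>(u, v)\<in>splits t. ell2_coord (left_creation w (ket [])) u * ell2_coord x v)
        = (\<Sum>(u, v)\<in>(if take (length w) t = w then {(w, drop (length w) t)} else {}).
            ell2_coord (left_creation w (ket [])) u * ell2_coord x v)"
    proof (rule sum.mono_neutral_right)
      show "(if take (length w) t = w then {(w, drop (length w) t)} else {}) \<subseteq> splits t"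
        by (auto simp: splits_def) (metis append_take_drop_id)
      show "\<forall>z\<in>splits t - (if take (length w) t = w then {(w, drop (length w) t)} else {}).
          (case z of (u, v) \<Rightarrow> ell2_coord (left_creation w (ket [])) u * ell2_coord x v) = 0"
        by (auto simp: splits_def left_creation_ket ket.rep_eq split: if_splits)
    qed (rule finite_splits)
    then show ?thesis by (simp add: left_creation.rep_eq left_creation_ket ket.rep_eq)
  qed
  then show ?thesis by (intro convolution_operatorsI bounded_clinear_left_creation)
qed

lemma nc_analytic_toeplitz_subset: "nc_analytic_toeplitz \<subseteq> convolution_operators"
  unfolding nc_analytic_toeplitz_def free_semigroup_algebra_def wot_algebra_generated_def
  using operator_algebra_convolution_operators closedin_convolution_operators
    id_in_convolution_operators left_creation_in_convolution_operators
  by (intro Inter_lower) auto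

text \<open>Lowest-term argument. Take shortest words \<open>w\<close> and \<open>v\<close> in the
  supports of the two symbols. In the coefficient of the product at \<open>w @ v\<close>, every
  other split has a left factor shorter than \<open>w\<close> or a right factor shorter than
  \<open>v\<close>, so one nonzero term is left.\<close>

lemma convolution_operators_no_zero_divisors:
  assumes T: "T \<in> convolution_operators" and R: "R \<in> convolution_operators" and 0: "\<And>x. T (R x) = 0"
  shows "(\<forall>x. T x = 0) \<or> (\<forall>x. R x = 0)"
proof (rule ccontr)
  note T' = convolution_operatorsD(2)[OF T] and R' = convolution_operatorsD(2)[OF R]
  let ?a = "ell2_coord (T (ket []))" and ?b = "ell2_coord (R (ket []))"
  assume *: "\<not> ((\<forall>x. T x = 0) \<or> (\<forall>x. R x = 0))"
  have "\<exists>w. ?a w \<noteq> 0"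
  proof (rule ccontr)
    assume "\<not> (\<exists>w. ?a w \<noteq> 0)"
    then have "T x = 0" for x by (intro ell2_eqI) (subst T', simp add: zero_ell2.rep_eq split_def)
    with * show False by blast
  qed
  then obtain w where w: "?a w \<noteq> 0" "\<And>u. length u < length w \<Longrightarrow> ?a u = 0"
    using ex_has_least_nat[of "\<lambda>w. ?a w \<noteq> 0" _ length] by (meson leD)
  have "\<exists>w. ?b w \<noteq> 0"
  proof (rule ccontr)
    assume "\<not> (\<exists>w. ?b w \<noteq> 0)"
    then have "R x = 0" for x by (intro ell2_eqI) (subst R', simp add: zero_ell2.rep_eq split_def)
    with * show False by blast
  qed
  then obtain v where v: "?b v \<noteq> 0" "\<And>u. length u < length v \<Longrightarrow> ?b u = 0"
    using ex_has_least_nat[of "\<lambda>w. ?b w \<noteq> 0" _ length] by (meson leD)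
  have "ell2_coord (T (R (ket []))) (w @ v) = (\<Sum>(x, y)\<in>{(w, v)}. ?a x * ?b y)"
    unfolding T'[of "R (ket [])"]
  proof (rule sum.mono_neutral_right)
    show "\<forall>z\<in>splits (w @ v) - {(w, v)}. (case z of (x, y) \<Rightarrow> ?a x * ?b y) = 0"
    proof
      fix z assume z: "z \<in> splits (w @ v) - {(w, v)}"
      obtain x y where zxy: "z = (x, y)" by (cases z)
      then have xy: "(x, y) \<in> splits (w @ v)" "(x, y) \<notin> {(w, v)}" using z by auto
      then have e: "x @ y = w @ v" by (simp add: splits_def)
      then have l: "length x + length y = length w + length v" by (metis length_append)
      have "length x \<noteq> length w" using e xy(2) by (auto simp: append_eq_append_conv)
      then have "length x < length w \<or> length y < length v" using l by linarith
      then show "(case z of (x, y) \<Rightarrow> ?a x * ?b y) = 0" using w(2) v(2) zxy by auto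
    qed
    show "{(w, v)} \<subseteq> splits (w @ v)" by (simp add: splits_def)
  qed (rule finite_splits)
  then show False using w(1) v(1) unfolding 0 zero_ell2.rep_eq by simp
qed

section \<open>Type L keeps the identity out of the closure of the proper polynomials\<close>

context orthogonal_isometries
begin

abbreviation alg where "alg \<equiv> free_semigroup_algebra S"

lemma alg: "operator_algebra alg" "closedin wot alg" "id \<in> alg" "S i \<in> alg"
proof -
  have *: "\<And>T. T \<in> insert id (range S) \<Longrightarrow> bounded_clinear T" by (auto simp: bounded_clinear_id)
  show "operator_algebra alg" "closedin wot alg" "id \<in> alg" "S i \<in> alg"
    using wot_algebra_generated(1-3)[of "insert id (range S)"] *
    unfolding free_semigroup_algebra_def by auto
qed

lemma W_in_alg: "W w \<in> alg"
proof (induction w)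
  case (Cons i w)
  from operator_algebraD(4)[OF alg(1) alg(4)[of i] Cons] show ?case by (simp add: o_def)
qed (use alg(3) in \<open>simp add: id_def\<close>)

text \<open>Multiplying a nonempty word on the left by the adjoint of \<open>S i\<close> removes its
  first letter or gives 0, so the adjoint times a proper polynomial stays in the algebra. Letting
  the polynomial approach the identity yields the adjoint itself.\<close>

lemma cadjoint_in_alg:
  assumes id: "id \<in> wot closure_of proper_polys S"
  shows "cadjoint (S i) \<in> alg"
proof -
  have adj: "(\<lambda>x. cadjoint (S i) (p x)) \<in> alg" if "p \<in> proper_polys S" for p
    using that
  proof (induction rule: proper_polys.induct)
    case zero
    show ?case using operator_algebraD(5)[OF alg(1)]
      by (simp add: bounded_clinear_zero bounded_clinear_cadjoint)
  next
    case (add p w c)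
    obtain j v where w: "w = j # v" using add.hyps by (cases w) auto
    have "(\<lambda>x. cadjoint (S i) (W w x)) \<in> alg"
      unfolding cadjoint_S_W w
      using W_in_alg operator_algebraD(5)[OF alg(1)] by (cases "i = j") auto
    from operator_algebraD(2)[OF alg(1) add.IH operator_algebraD(3)[OF alg(1) this, of c]]
    show ?case
      by (simp add: bounded_clinear_add[OF bounded_clinear_cadjoint] bounded_clinear_scaleC[OF bounded_clinear_cadjoint])
  qed
  have algb: "alg \<subseteq> {T. bounded_clinear T}" using operator_algebraD(1)[OF alg(1)] by blast
  have pb: "proper_polys S \<subseteq> {T. bounded_clinear T}" using proper_polys_bounded by blast
  have "cadjoint (S i) \<in> wot closure_of alg"
    unfolding in_wot_closure_iff[OF algb bounded_clinear_cadjoint[OF S_bounded]]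
  proof (intro allI impI)
    fix F :: "('a \<times> 'a) set" and e :: real assume F: "finite F" "e > 0"
    \<comment> \<open>The adjoint is moved to the right argument, so the approximation of the
      identity has to be tested against \<open>S i y\<close> in place of \<open>y\<close>.\<close>
    have "finite ((\<lambda>(x, y). (x, S i y)) ` F)" using F by simp
    from id[unfolded in_wot_closure_iff[OF pb bounded_clinear_id], rule_format, OF this F(2)]
    obtain p where "p \<in> proper_polys S"
      "\<forall>(x, y)\<in>(\<lambda>(x, y). (x, S i y)) ` F. cmod (cinner (id x) y - cinner (p x) y) < e" by blast
    then have p: "p \<in> proper_polys S" "\<And>x y. (x, y) \<in> F \<Longrightarrow> cmod (cinner x (S i y) - cinner (p x) (S i y)) < e"
      by auto
    then show "\<exists>R\<in>alg. \<forall>(x, y)\<in>F. cmod (cinner (cadjoint (S i) x) y - cinner (R x) y) < e"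
      by (intro bexI[OF _ adj[OF p(1)]]) (auto simp: cinner_cadjoint_left)
  qed
  then show ?thesis using alg(2) by (simp add: closure_of_closedin)
qed

text \<open>An isomorphism would make the Toeplitz algebra at most one-dimensional, while the
  identity and a creation operator are independent on \<open>ket []\<close>. Isomorphisms are not
  assumed to be unital, so the image of the identity is carried along as an unknown
  operator.\<close>

lemma not_type_L_if_scalar:
  assumes "\<And>T. T \<in> alg \<Longrightarrow> \<exists>c. T = (\<lambda>x. c *\<^sub>C x)"
  shows "\<not> type_L S"
proof
  assume "type_L S"
  then obtain \<phi> where "algebra_isomorphism alg (nc_analytic_toeplitz :: ('i list ell2 \<Rightarrow> 'i list ell2) set) \<phi>"
    unfolding type_L_def algebraically_isomorphic_def by blast
  then have bij: "bij_betw \<phi> alg (nc_analytic_toeplitz :: ('i list ell2 \<Rightarrow> 'i list ell2) set)"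
    and sc: "\<And>c T. T \<in> alg \<Longrightarrow> \<phi> (\<lambda>x. c *\<^sub>C T x) = (\<lambda>x. c *\<^sub>C \<phi> T x)"
    by (auto simp: algebra_isomorphism_def)
  have ex: "\<exists>c. A = (\<lambda>x. c *\<^sub>C \<phi> (\<lambda>x. x) x)" if A: "A \<in> (nc_analytic_toeplitz :: ('i list ell2 \<Rightarrow> 'i list ell2) set)" for A
  proof -
    obtain T where T: "T \<in> alg" "A = \<phi> T" using bij A by (auto simp: bij_betw_def)
    obtain c where "T = (\<lambda>x. c *\<^sub>C x)" using assms[OF T(1)] by blast
    then show ?thesis using sc[of "\<lambda>x. x" c] alg(3) T(2) by (auto simp: id_def)
  qed
  interpret L: orthogonal_isometries "\<lambda>i::'i. left_creation [i]"
    by unfold_locales (rule isometries_with_orthogonal_ranges_left_creation)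
  obtain c d where cd: "id = (\<lambda>x. c *\<^sub>C \<phi> (\<lambda>x. x) x)" "left_creation [undefined] = (\<lambda>x. d *\<^sub>C \<phi> (\<lambda>x. x) x)"
    using ex L.alg(3,4) unfolding nc_analytic_toeplitz_def by blast
  have k: "ket w \<noteq> 0" for w :: "'i list"
    by (metis ket.rep_eq zero_ell2.rep_eq zero_neq_one)
  have "c \<noteq> 0" using fun_cong[OF cd(1), of "ket []"] k by auto
  moreover have "(ket [] :: 'i list ell2) = c *\<^sub>C \<phi> (\<lambda>x. x) (ket [])"
    using fun_cong[OF cd(1), of "ket []"] by simp
  ultimately have "(d / c) *\<^sub>C (ket [] :: 'i list ell2) = d *\<^sub>C \<phi> (\<lambda>x. x) (ket [])"
    by (metis nonzero_eq_divide_eq scaleC_scaleC)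
  then have "left_creation [undefined] (ket []) = (d / c) *\<^sub>C (ket [] :: 'i list ell2)"
    using fun_cong[OF cd(2), of "ket []"] by simp
  then have "ell2_coord (ket [undefined :: 'i]) [undefined] = ell2_coord ((d / c) *\<^sub>C ket []) [undefined :: 'i]"
    by (simp add: left_creation_ket)
  then show False by (simp add: ket.rep_eq scaleC_ell2.rep_eq)
qed

lemma type_L_no_zero_divisors:
  assumes "type_L S" "T \<in> alg" "R \<in> alg" "\<And>x. T (R x) = 0"
  shows "(\<forall>x. T x = 0) \<or> (\<forall>x. R x = 0)"
proof -
  obtain \<phi> where "algebra_isomorphism alg (nc_analytic_toeplitz :: ('i list ell2 \<Rightarrow> 'i list ell2) set) \<phi>"
    using assms(1) unfolding type_L_def algebraically_isomorphic_def by blast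
  then have bij: "bij_betw \<phi> alg (nc_analytic_toeplitz :: ('i list ell2 \<Rightarrow> 'i list ell2) set)"
    and sc: "\<And>c T. T \<in> alg \<Longrightarrow> \<phi> (\<lambda>x. c *\<^sub>C T x) = (\<lambda>x. c *\<^sub>C \<phi> T x)"
    and mult: "\<And>T R. T \<in> alg \<Longrightarrow> R \<in> alg \<Longrightarrow> \<phi> (T \<circ> R) = \<phi> T \<circ> \<phi> R"
    by (auto simp: algebra_isomorphism_def)
  have z: "(\<lambda>_. 0) \<in> alg" by (rule operator_algebraD(5)[OF alg(1)])
  have \<phi>0: "\<phi> (\<lambda>_. 0) = (\<lambda>_. 0)" using sc[OF z, of 0] by simp
  have "\<phi> T \<in> convolution_operators" "\<phi> R \<in> convolution_operators"
    using bij assms nc_analytic_toeplitz_subset by (auto simp: bij_betw_def)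
  moreover have "T \<circ> R = (\<lambda>_. 0)" using assms(4) by auto
  then have "\<phi> T \<circ> \<phi> R = (\<lambda>_. 0)" using mult[OF assms(2,3)] \<phi>0 by simp
  then have "\<And>x. \<phi> T (\<phi> R x) = 0" by (simp add: fun_eq_iff)
  ultimately have "\<phi> T = \<phi> (\<lambda>_. 0) \<or> \<phi> R = \<phi> (\<lambda>_. 0)"
    unfolding \<phi>0 using convolution_operators_no_zero_divisors by blast
  then have "T = (\<lambda>_. 0) \<or> R = (\<lambda>_. 0)"
    using bij assms z by (auto simp: bij_betw_def dest: inj_onD)
  then show ?thesis by auto
qed

text \<open>For closedness fix \<open>z \<noteq> 0\<close>. An operator is scalar iff each entry
  \<open>cinner (T x) y\<close> is the multiple of \<open>cinner (T z) z\<close> that it has to be,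
  and these are weakly closed conditions. On the zero space every operator is scalar.\<close>

lemma operator_algebra_scalars: "operator_algebra {T. \<exists>c. T = (\<lambda>x::'a. c *\<^sub>C x)}" (is "operator_algebra ?C")
  and closedin_scalars: "closedin wot {T. \<exists>c. T = (\<lambda>x::'a. c *\<^sub>C x)}"
proof -
  have b: "bounded_clinear (\<lambda>x::'a. c *\<^sub>C x)" for c
    using bounded_clinear_scale[OF bounded_clinear_ident] .
  show "operator_algebra ?C"
    unfolding operator_algebra_def
  proof (intro conjI ballI allI)
    show "(\<lambda>_. 0) \<in> ?C" by (rule CollectI, rule exI[of _ 0], rule ext) simp
  qed (auto simp: b scaleC_add_left[symmetric] scaleC_scaleC o_def)
  show "closedin wot ?C"
  proof (cases "\<exists>z::'a. z \<noteq> 0")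
    case True
    then obtain z :: 'a where z: "z \<noteq> 0" by blast
    let ?f = "\<lambda>(x::'a) y T. cinner (T x) y - cinner (T z) z * (cinner x y / cinner z z)"
    have "closedin wot {T \<in> topspace wot. ?f x y T \<in> {0}}" for x y
    proof (rule closedin_continuous_map_preimage)
      show "continuous_map wot euclidean (?f x y)"
        by (intro continuous_map_diff continuous_map_wot continuous_map_wot_mult)
    qed simp
    then have "closedin wot (\<Inter>v. {T \<in> topspace wot. ?f (fst v) (snd v) T \<in> {0}})"
      by (intro closedin_Inter) auto
    also have "(\<Inter>v. {T \<in> topspace wot. ?f (fst v) (snd v) T \<in> {0}}) = ?C"
    proof (intro equalityI subsetI)
      fix T assume "T \<in> (\<Inter>v. {T \<in> topspace wot. ?f (fst v) (snd v) T \<in> {0}})"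
      then have *: "T \<in> {T \<in> topspace wot. ?f (fst v) (snd v) T \<in> {0}}" for v by (rule INT_D) simp
      have "?f x y T = 0" for x y
        using *[of "(x, y)"] unfolding fst_conv snd_conv by (elim CollectE conjE singletonE)
      then have "cinner (T x) y = cinner ((cinner (T z) z / cinner z z) *\<^sub>C x) y" for x y
        unfolding right_minus_eq by (metis cinner_scaleC_left times_divide_eq_left times_divide_eq_right)
      then have "cinner y (T x) = cinner y ((cinner (T z) z / cinner z z) *\<^sub>C x)" for x y
        by (metis cinner_cnj)
      then have "T = (\<lambda>x. (cinner (T z) z / cinner z z) *\<^sub>C x)" by (intro ext cinner_eqI)
      then show "T \<in> ?C" by blast
    next
      fix T assume "T \<in> ?C"
      then show "T \<in> (\<Inter>v. {T \<in> topspace wot. ?f (fst v) (snd v) T \<in> {0}})"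
        using z by (auto simp: b topspace_wot cinner_scaleC_left cinner_self)
    qed
    finally show ?thesis .
  next
    case False
    then have "T = (\<lambda>x. 0 *\<^sub>C x)" for T :: "'a \<Rightarrow> 'a" by (intro ext) (metis (full_types))
    then have "T \<in> ?C" for T by blast
    moreover have "?C \<subseteq> topspace wot" using b by (auto simp: topspace_wot)
    ultimately have "?C = topspace wot" by blast
    then show ?thesis by (metis closedin_topspace)
  qed
qed

text \<open>Otherwise the adjoints are in the algebra. For two letters the relation between the
  adjoint of \<open>S i\<close> and \<open>S j\<close> exhibits zero divisors, unless the space is
  zero. For one letter the real and imaginary parts of the generator are selfadjoint elements of an
  algebra without zero divisors, hence scalar. Either way the algebra consists of scalars.\<close>

lemma id_not_in_closure_if_type_L:
  assumes L: "type_L S"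
  shows "id \<notin> wot closure_of proper_polys S"
proof
  assume id: "id \<in> wot closure_of proper_polys S"
  note adj = cadjoint_in_alg[OF id]
  have S_inj: "\<forall>y::'a. y = 0" if "\<forall>x. S i x = 0" for i
  proof
    fix y :: 'a
    have "norm y = norm (S i y)" by simp
    then show "y = 0" using that by simp
  qed
  have "alg \<subseteq> {T. \<exists>c. T = (\<lambda>x::'a. c *\<^sub>C x)}"
  proof -
    have "\<exists>c. S i = (\<lambda>x. c *\<^sub>C x)" for i
    proof (cases "\<exists>j. j \<noteq> i")
      case True
      then obtain j where j: "j \<noteq> i" by blast
      have "cadjoint (S i) (S j x) = 0" for x using cadjoint_S_W[of i "[j]" x] j by simp
      from type_L_no_zero_divisors[OF L adj alg(4) this]
      have "\<forall>y::'a. y = 0"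
      proof
        assume "\<forall>x. cadjoint (S i) x = 0"
        moreover have "cadjoint (S i) (S i x) = x" for x using cadjoint_S_W[of i "[i]" x] by simp
        ultimately show ?thesis by metis
      qed (rule S_inj)
      then show ?thesis by (metis)
    next
      case False
      let ?U = "S i" and ?V = "cadjoint (S i)"
      have Vb: "bounded_clinear ?V" by (simp add: bounded_clinear_cadjoint)
      have i1: "cinner (?U x) y = cinner x (?V y)" and i2: "cinner (?V x) y = cinner x (?U y)" for x y
        by (simp_all add: cadjoint_works cinner_cadjoint_left)
      define A where "A x = ?U x + ?V x" for x
      define B where "B x = \<i> *\<^sub>C ?U x + (- \<i>) *\<^sub>C ?V x" for x
      have AB: "A \<in> alg" "B \<in> alg" unfolding A_def B_def
        by (intro operator_algebraD(2,3)[OF alg(1)] alg(4) adj)+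
      have "selfadjoint A" unfolding selfadjoint_def
        using operator_algebraD(1)[OF alg(1) AB(1)]
        by (simp add: A_def cinner_add_left cinner_add_right i1 i2)
      then obtain s where s: "\<And>x. A x = s *\<^sub>R x"
        using selfadjoint_scalar_if_no_zero_divisors[OF alg(1-3) type_L_no_zero_divisors[OF L] _ AB(1)] by metis
      have "selfadjoint B" unfolding selfadjoint_def
        using operator_algebraD(1)[OF alg(1) AB(2)]
        by (simp add: B_def cinner_add_left cinner_add_right cinner_scaleC_left cinner_scaleC_right i1 i2)
      then obtain t where t: "\<And>x. B x = t *\<^sub>R x"
        using selfadjoint_scalar_if_no_zero_divisors[OF alg(1-3) type_L_no_zero_divisors[OF L] _ AB(2)] by metis
      \<comment> \<open>Recovers the generator from twice its real part \<open>A\<close> and minus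
        twice its imaginary part \<open>B\<close>.\<close>
      have "?U x = (1/2) *\<^sub>C (A x + (- \<i>) *\<^sub>C B x)" for x
        by (simp add: A_def B_def scaleC_add_right scaleC_scaleC scaleC_minus_one)
          (simp flip: scaleC_add_left)
      also have "\<dots> x = ((1/2) * (of_real s + (- \<i>) * of_real t)) *\<^sub>C x" for x
        unfolding s t 
        by (simp add: scaleC_of_real[symmetric] scaleC_add_right scaleC_scaleC algebra_simps flip: scaleC_add_left)
      finally show ?thesis by blast
    qed
    moreover have "\<exists>c. id = (\<lambda>x::'a. c *\<^sub>C x)" by (rule exI[of _ 1]) auto
    ultimately show ?thesis
      unfolding free_semigroup_algebra_def wot_algebra_generated_def
      using operator_algebra_scalars closedin_scalars by (intro Inter_lower) auto
  qed
  then show False using not_type_L_if_scalar L by blast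
qed

text \<open>A separating weak neighbourhood of the identity, given by the pairs in \<open>F\<close>,
  says that one vector of the direct sum over \<open>F\<close> is at positive distance from its
  proper images; minimization and normalization do the rest. The vectors \<open>W w (z j)\<close>,
  taken jointly in \<open>j\<close>, are orthonormal in that sum.\<close>

lemma wandering_family_if_id_not_in_closure:
  assumes "id \<notin> wot closure_of proper_polys S"
  obtains J :: "('a \<times> 'a) set" and z where "finite J"
    "\<And>u v. (\<Sum>j\<in>J. cinner (W u (z j)) (W v (z j))) = (if u = v then 1 else 0)"
proof -
  have pb: "proper_polys S \<subseteq> {T. bounded_clinear T}" using proper_polys_bounded by blast
  have "\<exists>F e. finite F \<and> e > 0 \<and>
      \<not> (\<exists>p\<in>proper_polys S. \<forall>(x, y)\<in>F. cmod (cinner x y - cinner (p x) y) < e)"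
    using assms unfolding in_wot_closure_iff[OF pb bounded_clinear_id] id_apply by (simp only: not_all not_imp)
  then obtain F e where F: "finite F" "e > 0"
    and "\<not> (\<exists>p\<in>proper_polys S. \<forall>(x, y)\<in>F. cmod (cinner x y - cinner (p x) y) < e)"
    by (elim exE conjE)
  then have far: "\<exists>(x, y)\<in>F. \<not> cmod (cinner x y - cinner (p x) y) < e" if "p \<in> proper_polys S" for p
    using that by fastforce
  \<comment> \<open>Weighting the first vector of a pair by the norm of the second turns the
    Cauchy-Schwarz bound for the entry into a lower bound for the norm of
    \<open>x j + p (x j)\<close>.\<close>
  define x where "x j = norm (snd j) *\<^sub>R fst j" for j :: "'a \<times> 'a"
  have dist: "e\<^sup>2 \<le> (\<Sum>j\<in>F. (norm (x j + p (x j)))\<^sup>2)" if p: "p \<in> proper_polys S" for p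
  proof -
    obtain a b where ab: "(a, b) \<in> F" "e \<le> cmod (cinner a b - cinner ((-1) *\<^sub>C p a) b)"
      using far[OF proper_polys_scale[OF p, of "-1"]] by force
    then have "e \<le> cmod (cinner (a + p a) b)"
      by (simp add: scaleC_minus_one cinner.minus_left cinner_add_left)
    also have "\<dots> \<le> norm (a + p a) * norm b" by (rule norm_cinner_le)
    also have "\<dots> = norm (x (a, b) + p (x (a, b)))"
      by (simp add: x_def bounded_clinear_scaleR[OF proper_polys_bounded[OF p]] flip: scaleR_add_right)
    finally have "e\<^sup>2 \<le> (norm (x (a, b) + p (x (a, b))))\<^sup>2" using F(2) by (intro power_mono) auto
    also have "\<dots> \<le> (\<Sum>j\<in>F. (norm (x j + p (x j)))\<^sup>2)"
      using F(1) ab(1) by (intro member_le_sum) auto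
    finally show ?thesis .
  qed
  have "e\<^sup>2 > 0" using F(2) by simp
  then obtain z where z: "(\<Sum>j\<in>F. (norm (z j))\<^sup>2) > 0"
    "\<And>w. w \<noteq> [] \<Longrightarrow> (\<Sum>j\<in>F. cinner (z j) (W w (z j))) = 0"
    by (rule wandering_family_if_positive_distance[OF F(1) _ dist]) (use that in blast)+
  have *: "(\<Sum>j\<in>F. cinner (W w (z j)) (z j)) = 0" if "w \<noteq> []" for w
  proof -
    have "(\<Sum>j\<in>F. cinner (W w (z j)) (z j)) = cnj (\<Sum>j\<in>F. cinner (z j) (W w (z j)))"
      unfolding cnj_sum by (intro sum.cong refl) (rule cinner_cnj)
    then show ?thesis using z(2)[OF that] by simp
  qed
  define r where "r = sqrt (\<Sum>j\<in>F. (norm (z j))\<^sup>2)"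
  have r: "r > 0" "r * r = (\<Sum>j\<in>F. (norm (z j))\<^sup>2)"
    using z(1) by (simp_all add: r_def flip: power2_eq_square)
  define y where "y j = (1 / r) *\<^sub>R z j" for j
  have "(\<Sum>j\<in>F. cinner (W u (y j)) (W v (y j))) = (if u = v then 1 else 0)" for u v
  proof -
    have "(\<Sum>j\<in>F. cinner (W u (y j)) (W v (y j))) = (1 / (r * r)) *\<^sub>R (\<Sum>j\<in>F. cinner (W u (z j)) (W v (z j)))"
      unfolding y_def scaleR_sum_right
      by (intro sum.cong refl) (simp add: bounded_clinear_scaleR cinner.scaleR_left cinner.scaleR_right)
    also have "(\<Sum>j\<in>F. cinner (W u (z j)) (W v (z j))) = (if u = v then of_real (r * r) else 0)"
    proof (cases "(\<exists>t. u = v @ t) \<or> (\<exists>t. v = u @ t)")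
      case True
      then show ?thesis
      proof (elim disjE exE)
        fix t assume "u = v @ t"
        then show ?thesis using *[of t] r(2)
          by (cases "t = []") (auto simp: cinner_W_append cinner_self)
      next
        fix t assume "v = u @ t"
        then show ?thesis using z(2)[of t] r(2)
          by (cases "t = []") (auto simp: cinner_W_append cinner_self)
      qed
    next
      case False
      then show ?thesis using cinner_W_eq_0[of u v] by (auto intro: sum.neutral)
    qed
    also have "(1 / (r * r)) *\<^sub>R (if u = v then of_real (r * r) else 0) = (if u = v then 1 else (0::complex))"
      using r(1) by (simp add: scaleR_conv_of_real)
    finally show ?thesis .
  qed
  then show thesis by (rule that[OF F(1)])
qed

text \<open>Bessel's inequality in the direct sum over \<open>J\<close>, applied to the orthonormal
  system of the families \<open>W w (z i)\<close> and to the vector that has \<open>h\<close> in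
  coordinate \<open>j\<close> and 0 elsewhere.\<close>

lemma bessel_wandering_family:
  assumes J: "finite J" and j: "j \<in> J"
    and z: "\<And>u v. (\<Sum>j\<in>J. cinner (W u (z j)) (W v (z j))) = (if u = v then 1 else 0)"
    and F: "finite F"
  shows "(\<Sum>w\<in>F. (cmod (cinner h (W w (z j))))\<^sup>2) \<le> (norm h)\<^sup>2"
proof -
  define c where "c w = cinner h (W w (z j))" for w
  define s where "s = (\<Sum>w\<in>F. (cmod (c w))\<^sup>2)"
  define a where "a i = (if i = j then h else 0)" for i
  define b where "b i = (\<Sum>w\<in>F. c w *\<^sub>C W w (z i))" for i
  have "(\<Sum>i\<in>J. cinner (b i) (b i)) = (\<Sum>i\<in>J. \<Sum>w\<in>F. \<Sum>v\<in>F. c w * cnj (c v) * cinner (W w (z i)) (W v (z i)))"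
    unfolding b_def cinner.sum_left cinner.sum_right
    by (subst sum.swap, intro sum.cong refl) (simp add: cinner_scaleC_left cinner_scaleC_right mult_ac)
  also have "\<dots> = (\<Sum>w\<in>F. \<Sum>v\<in>F. c w * cnj (c v) * (\<Sum>i\<in>J. cinner (W w (z i)) (W v (z i))))"
    unfolding sum_distrib_left
    by (subst sum.swap, intro sum.cong refl, subst sum.swap, rule refl)
  also have "\<dots> = (\<Sum>w\<in>F. c w * cnj (c w))"
    unfolding z using F by (intro sum.cong refl) (simp add: if_distrib[of "\<lambda>x. _ * x"] cong: if_cong)
  also have "\<dots> = of_real s" unfolding s_def of_real_sum complex_norm_square ..
  finally have bb: "(\<Sum>i\<in>J. (norm (b i))\<^sup>2) = s"
    unfolding cinner_self of_real_sum[symmetric] of_real_eq_iff .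
  have "(\<Sum>i\<in>J. cinner (a i) (b i)) = (\<Sum>i\<in>J. if i = j then cinner h (b j) else 0)"
    by (intro sum.cong refl) (simp add: a_def)
  also have "\<dots> = cinner h (b j)" using J j by simp
  also have "\<dots> = (\<Sum>w\<in>F. c w * cnj (c w))"
    unfolding b_def cinner.sum_right by (intro sum.cong refl) (simp add: cinner_scaleC_right c_def mult.commute)
  also have "\<dots> = of_real s" unfolding s_def of_real_sum complex_norm_square ..
  finally have ab: "Re (\<Sum>i\<in>J. cinner (a i) (b i)) = s" by simp
  have aa: "(\<Sum>i\<in>J. (norm (a i))\<^sup>2) = (norm h)\<^sup>2"
  proof -
    have "(\<Sum>i\<in>J. (norm (a i))\<^sup>2) = (\<Sum>i\<in>J. if i = j then (norm h)\<^sup>2 else 0)"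
      by (intro sum.cong refl) (simp add: a_def)
    then show ?thesis using J j by simp
  qed
  have "0 \<le> (\<Sum>i\<in>J. (norm (a i - b i))\<^sup>2)" by (intro sum_nonneg) simp
  also have "\<dots> = (norm h)\<^sup>2 + s - 2 * s"
    unfolding norm_sq_diff sum_subtractf sum.distrib aa bb
    using ab by (simp add: sum_distrib_left[symmetric] flip: Re_sum)
  finally show ?thesis by (simp add: s_def c_def)
qed

end

section \<open>One generator: merging Bessel vectors of a unitary group\<close>

text \<open>Adjoints between two different spaces, as wanted for maps between \<open>ell2\<close>
  and the given space; \<open>cadjoint\<close> is confined to operators on one space.\<close>

lemma heterogeneous_adjoint:
  fixes T :: "'a::complex_hilbert \<Rightarrow> 'b::complex_hilbert"
  assumes add: "\<And>x y. T (x + y) = T x + T y" and scale: "\<And>c x. T (c *\<^sub>C x) = c *\<^sub>C T x"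
    and bd: "\<And>x. norm (T x) \<le> K * norm x" and K: "K \<ge> 0"
  obtains R where "\<And>x y. R (x + y) = R x + R y" "\<And>c x. R (c *\<^sub>C x) = c *\<^sub>C R x"
    "\<And>x h. cinner (R x) h = cinner x (T h)" "\<And>x h. cinner h (R x) = cinner (T h) x"
    "\<And>x. norm (R x) \<le> K * norm x"
proof -
  have bl: "bounded_linear T"
    by (rule bounded_linear_intro[where K = K])
      (use assms in \<open>auto simp: mult.commute simp flip: scaleC_of_real\<close>)
  have "\<forall>x. \<exists>z. \<forall>h. inner (T h) x = inner h z"
    using bl by (intro allI riesz_real bounded_linear_inner_left_comp)
  from choice[OF this] obtain R where R: "\<And>x h. inner (T h) x = inner h (R x)" by auto
  have adj: "cinner h (R x) = cinner (T h) x" for h x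
  proof (rule complex_eqI)
    show "Re (cinner h (R x)) = Re (cinner (T h) x)"
      using R by (simp flip: inner_eq_Re_cinner)
    show "Im (cinner h (R x)) = Im (cinner (T h) x)"
      using R[of "\<i> *\<^sub>C h" x] by (simp add: Im_cinner scale)
  qed
  have adj': "cinner (R x) h = cinner x (T h)" for h x
    using adj[of h x] cinner_cnj[of "R x" h] cinner_cnj[of x "T h"] by simp
  show thesis
  proof
    show "cinner (R x) h = cinner x (T h)" "cinner h (R x) = cinner (T h) x" for x h
      by (fact adj' adj)+
    show "R (x + y) = R x + R y" for x y by (rule cinner_eqI) (simp add: adj cinner_add_right)
    show "R (c *\<^sub>C x) = c *\<^sub>C R x" for c x by (rule cinner_eqI) (simp add: adj cinner_scaleC_right)
    fix x
    have "(norm (R x))\<^sup>2 = cmod (cinner (T (R x)) x)"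
      unfolding adj[symmetric] cinner_self by (simp add: norm_power)
    also have "\<dots> \<le> norm (T (R x)) * norm x" by (rule norm_cinner_le)
    also have "\<dots> \<le> (K * norm (R x)) * norm x" using bd by (intro mult_right_mono) auto
    finally have *: "norm (R x) * norm (R x) \<le> norm (R x) * (K * norm x)"
      by (simp add: power2_eq_square mult_ac)
    then show "norm (R x) \<le> K * norm x"
      using K by (cases "norm (R x) = 0") auto
  qed
qed

text \<open>Expansion of \<open>x\<close> in the basis, read off through the adjoint: each
  coordinate of \<open>A x\<close> is an inner product with a fixed vector, hence an absolutely
  convergent sum. In particular \<open>A\<close> is determined by its values on the basis.\<close>

lemma bounded_clinear_ell2_coord:
  assumes "bounded_clinear A"
  shows "ell2_coord (A x) t = (\<Sum>\<^sub>\<infinity>s. ell2_coord x s * ell2_coord (A (ket s)) t)"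
proof -
  have *: "cnj (ell2_coord (cadjoint A (ket t)) s) = ell2_coord (A (ket s)) t" for s
    using cinner_cnj[of "A (ket s)" "ket t"]
    by (simp add: cinner_ket[symmetric] cinner_cadjoint_left[OF assms] cinner_cnj[of "ket t"])
  have "ell2_coord (A x) t = cinner x (cadjoint A (ket t))"
    by (simp add: cinner_ket[symmetric] cadjoint_works[OF assms])
  also have "\<dots> = (\<Sum>\<^sub>\<infinity>s. ell2_coord x s * cnj (ell2_coord (cadjoint A (ket t)) s))"
    by (rule cinner_ell2.rep_eq)
  finally show ?thesis unfolding * .
qed

section \<open>Powers of the bilateral shift and their commutant\<close>

lift_definition bishift :: "int \<Rightarrow> int ell2 \<Rightarrow> int ell2" is "\<lambda>n f m. f (m - n)"
proof -
  fix n :: int and f :: "int \<Rightarrow> complex"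
  assume "(\<lambda>w. (cmod (f w))\<^sup>2) summable_on UNIV"
  then show "(\<lambda>m. (cmod (f (m - n)))\<^sup>2) summable_on UNIV"
    by (subst summable_on_reindex_bij_betw[where g = "\<lambda>m. m - n" and B = UNIV])
      (auto intro!: bij_betwI[where g = "\<lambda>m. m + n"])
qed

lemma bishift_add: "bishift n (x + y) = bishift n x + bishift n y"
  by transfer auto

lemma bishift_scaleC: "bishift n (c *\<^sub>C x) = c *\<^sub>C bishift n x"
  by transfer auto

lemma cinner_bishift: "cinner (bishift n x) (bishift n y) = cinner x y"
  by transfer (rule infsum_reindex_bij_betw, auto intro!: bij_betwI[where g = "\<lambda>m. m + n" for n])

lemma bishift_bishift: "bishift m (bishift n x) = bishift (m + n) x"
  by transfer (simp add: algebra_simps)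

lemma bishift_0 [simp]: "bishift 0 x = x"
  by transfer simp

lemma bishift_ket: "bishift n (ket m) = ket (m + n)"
  by transfer (auto simp: fun_eq_iff)

lemma cinner_bishift_left: "cinner (bishift n x) y = cinner x (bishift (- n) y)"
  using cinner_bishift[of n x "bishift (- n) y"] by (simp add: bishift_bishift)

lemma bounded_clinear_bishift: "bounded_clinear (bishift n)"
  by (rule bounded_clinearI[where K = 1])
    (auto simp: bishift_add bishift_scaleC norm_eq_sqrt_inner inner_eq_Re_cinner cinner_bishift)

text \<open>An operator commuting with all shifts is convolution by its value at
  \<open>ket 0\<close>, and convolution on the integers is commutative. This replaces the
  description of the commutant as multiplications on the circle.\<close>

lemma bishift_commutant_abelian:
  assumes A: "bounded_clinear A" "\<And>n x. A (bishift n x) = bishift n (A x)"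
    and B: "bounded_clinear B" "\<And>n x. B (bishift n x) = bishift n (B x)"
  shows "A (B x) = B (A x)"
proof -
  have k: "C (ket s) = bishift s (C (ket 0))" if "\<And>n x. C (bishift n x) = bishift n (C x)" for C s
    using that[of s "ket 0"] by (simp add: bishift_ket)
  have conv: "ell2_coord (C (D (ket 0))) t
      = (\<Sum>\<^sub>\<infinity>s. ell2_coord (D (ket 0)) s * ell2_coord (C (ket 0)) (t - s))"
    if "bounded_clinear C" "\<And>n x. C (bishift n x) = bishift n (C x)" for C D t
    unfolding bounded_clinear_ell2_coord[OF that(1), of "D (ket 0)" t]
    by (intro infsum_cong) (subst k[OF that(2)], simp add: bishift.rep_eq)
  have "A (B (ket 0)) = B (A (ket 0))"
  proof (rule ell2_eqI)
    fix t
    have "ell2_coord (A (B (ket 0))) t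
        = (\<Sum>\<^sub>\<infinity>s. ell2_coord (B (ket 0)) (t - s) * ell2_coord (A (ket 0)) (t - (t - s)))"
      unfolding conv[OF A]
      by (rule infsum_reindex_bij_betw[symmetric]) (auto intro!: bij_betwI[where g = "\<lambda>s. t - s"])
    also have "\<dots> = ell2_coord (B (A (ket 0))) t"
      unfolding conv[OF B] by (simp add: mult.commute)
    finally show "ell2_coord (A (B (ket 0))) t = ell2_coord (B (A (ket 0))) t" .
  qed
  then have "A (B (ket s)) = B (A (ket s))" for s
    using k[OF A(2), of s] k[OF B(2), of s] by (simp add: A(2) B(2))
  then show ?thesis
    using bounded_clinear_ell2_coord[OF bounded_clinear_comp[OF A(1) B(1)], of x]
      bounded_clinear_ell2_coord[OF bounded_clinear_comp[OF B(1) A(1)], of x]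
    by (intro ell2_eqI) simp
qed

section \<open>Bessel vectors and synthesis operators\<close>

locale unitary_group =
  fixes u :: "int \<Rightarrow> 'a::complex_hilbert \<Rightarrow> 'a"
  assumes u_bounded: "bounded_clinear (u n)"
    and u_0: "u 0 x = x"
    and u_u: "u m (u n x) = u (m + n) x"
    and cinner_u: "cinner (u n x) (u n y) = cinner x y"
begin

text \<open>Equivalently, the spectral measure of \<open>x\<close> has a bounded density with
  respect to Lebesgue measure on the circle.\<close>

definition bessel :: "'a \<Rightarrow> bool" where
  "bessel x \<longleftrightarrow> (\<exists>K\<ge>0. \<forall>h F. finite F \<longrightarrow> (\<Sum>m\<in>F. (cmod (cinner h (u m x)))\<^sup>2) \<le> K * (norm h)\<^sup>2)"

lemma cinner_u_left: "cinner (u n x) y = cinner x (u (- n) y)"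
  using cinner_u[of n x "u (- n) y"] by (simp add: u_u u_0)

text \<open>\<open>T\<close> sends \<open>h\<close> to its coefficients against the orbit of
  \<open>x\<close> and is bounded by the Bessel condition; \<open>V\<close> is its adjoint. Both
  intertwine the group with the bilateral shift.\<close>

lemma synthesis_operator:
  assumes "bessel x"
  obtains V :: "int ell2 \<Rightarrow> 'a" and T :: "'a \<Rightarrow> int ell2" and K where
    "\<And>\<xi> \<eta>. V (\<xi> + \<eta>) = V \<xi> + V \<eta>" "\<And>c \<xi>. V (c *\<^sub>C \<xi>) = c *\<^sub>C V \<xi>"
    "\<And>n. V (ket n) = u n x" "\<And>n \<xi>. V (bishift n \<xi>) = u n (V \<xi>)"
    "\<And>x y. T (x + y) = T x + T y" "\<And>c x. T (c *\<^sub>C x) = c *\<^sub>C T x"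
    "\<And>n h. T (u n h) = bishift n (T h)"
    "\<And>h \<xi>. cinner (T h) \<xi> = cinner h (V \<xi>)" "\<And>h \<xi>. cinner \<xi> (T h) = cinner (V \<xi>) h"
    "\<And>h. norm (T h) \<le> K * norm h" "\<And>\<xi>. norm (V \<xi>) \<le> K * norm \<xi>" "K \<ge> 0"
proof -
  obtain K where K: "K \<ge> 0" "\<And>h F. finite F \<Longrightarrow> (\<Sum>m\<in>F. (cmod (cinner h (u m x)))\<^sup>2) \<le> K * (norm h)\<^sup>2"
    using assms unfolding bessel_def by blast
  have summ: "(\<lambda>m. (cmod (cinner h (u m x)))\<^sup>2) summable_on UNIV" for h
    using K(2) by (intro nonneg_bdd_above_summable_on bdd_aboveI2[where M = "K * (norm h)\<^sup>2"]) auto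
  define T where "T h = Abs_ell2 (\<lambda>m. cinner h (u m x))" for h
  have T: "ell2_coord (T h) m = cinner h (u m x)" for h m
    using summ[of h] by (simp add: T_def Abs_ell2_inverse)
  have Tn: "norm (T h) \<le> sqrt K * norm h" for h
  proof -
    have "(norm (T h))\<^sup>2 \<le> K * (norm h)\<^sup>2"
      unfolding power2_norm_eq_inner[of "T h"] inner_ell2_self T
      by (intro infsum_le_finite_sums summ K(2)) auto
    then show ?thesis using real_le_rsqrt real_sqrt_mult[of K "(norm h)\<^sup>2"] by fastforce
  qed
  have Tadd: "T (h + k) = T h + T k" for h k by (rule ell2_eqI) (simp add: T plus_ell2.rep_eq cinner_add_left)
  have Tsc: "T (c *\<^sub>C h) = c *\<^sub>C T h" for c h by (rule ell2_eqI) (simp add: T scaleC_ell2.rep_eq cinner_scaleC_left)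
  have Tu: "T (u n h) = bishift n (T h)" for n h
    by (rule ell2_eqI) (simp add: T bishift.rep_eq cinner_u_left u_u)
  obtain V where V: "\<And>\<xi> \<eta>. V (\<xi> + \<eta>) = V \<xi> + V \<eta>" "\<And>c \<xi>. V (c *\<^sub>C \<xi>) = c *\<^sub>C V \<xi>"
    "\<And>\<xi> h. cinner (V \<xi>) h = cinner \<xi> (T h)" "\<And>\<xi> h. cinner h (V \<xi>) = cinner (T h) \<xi>"
    "\<And>\<xi>. norm (V \<xi>) \<le> sqrt K * norm \<xi>"
    using heterogeneous_adjoint[OF Tadd Tsc Tn real_sqrt_ge_zero[OF K(1)]] by metis
  have "V (ket n) = u n x" for n
    by (rule cinner_eqI) (simp add: V(4) cinner_ket T)
  moreover have "V (bishift n \<xi>) = u n (V \<xi>)" for n \<xi>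
  proof (rule cinner_eqI)
    fix h
    have "cinner h (V (bishift n \<xi>)) = cnj (cinner (bishift n \<xi>) (T h))"
      unfolding V(4) by (rule cinner_cnj)
    also have "\<dots> = cnj (cinner (V \<xi>) (u (- n) h))"
      by (simp add: cinner_bishift_left V(3) Tu)
    also have "\<dots> = cinner h (u n (V \<xi>))"
      using cinner_u_left[of n "V \<xi>" h] cinner_cnj[of h "u n (V \<xi>)"] by simp
    finally show "cinner h (V (bishift n \<xi>)) = cinner h (u n (V \<xi>))" .
  qed
  ultimately show thesis
    using that[of V T "sqrt K"] V Tadd Tsc Tu Tn K(1) by simp
qed

text \<open>Let \<open>V\<^sub>1, V\<^sub>2\<close> be the synthesis operators. The space on which \<open>B = V\<^sub>1\<^sup>*V\<^sub>1 - V\<^sub>2\<^sup>*V\<^sub>2\<close> is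
  nonnegative and its complement reduce the commutant of the bilateral shift, so \<open>V\<^sub>1\<close> on the former
  and \<open>V\<^sub>2\<close> on the latter have orthogonal ranges and combine to a single vector.\<close>

lemma merge_bessel_vectors:
  assumes "bessel x1" "bessel x2"
  obtains x where "bessel x"
    "\<And>a F. finite F \<Longrightarrow> (norm (\<Sum>m\<in>F. a m *\<^sub>C u m x1))\<^sup>2 + (norm (\<Sum>m\<in>F. a m *\<^sub>C u m x2))\<^sup>2
        \<le> 2 * (norm (\<Sum>m\<in>F. a m *\<^sub>C u m x))\<^sup>2"
proof -
  obtain V1 T1 K1 where 1:
    "\<And>\<xi> \<eta>. V1 (\<xi> + \<eta>) = V1 \<xi> + V1 \<eta>" "\<And>c \<xi>. V1 (c *\<^sub>C \<xi>) = c *\<^sub>C V1 \<xi>"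
    "\<And>n. V1 (ket n) = u n x1" "\<And>n \<xi>. V1 (bishift n \<xi>) = u n (V1 \<xi>)"
    "\<And>x y. T1 (x + y) = T1 x + T1 y" "\<And>c x. T1 (c *\<^sub>C x) = c *\<^sub>C T1 x"
    "\<And>n h. T1 (u n h) = bishift n (T1 h)"
    "\<And>h \<xi>. cinner (T1 h) \<xi> = cinner h (V1 \<xi>)" "\<And>h \<xi>. cinner \<xi> (T1 h) = cinner (V1 \<xi>) h"
    "\<And>h. norm (T1 h) \<le> K1 * norm h" "\<And>\<xi>. norm (V1 \<xi>) \<le> K1 * norm \<xi>" "K1 \<ge> 0"
    by (fact synthesis_operator[OF assms(1)])
  obtain V2 T2 K2 where 2:
    "\<And>\<xi> \<eta>. V2 (\<xi> + \<eta>) = V2 \<xi> + V2 \<eta>" "\<And>c \<xi>. V2 (c *\<^sub>C \<xi>) = c *\<^sub>C V2 \<xi>"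
    "\<And>n. V2 (ket n) = u n x2" "\<And>n \<xi>. V2 (bishift n \<xi>) = u n (V2 \<xi>)"
    "\<And>x y. T2 (x + y) = T2 x + T2 y" "\<And>c x. T2 (c *\<^sub>C x) = c *\<^sub>C T2 x"
    "\<And>n h. T2 (u n h) = bishift n (T2 h)"
    "\<And>h \<xi>. cinner (T2 h) \<xi> = cinner h (V2 \<xi>)" "\<And>h \<xi>. cinner \<xi> (T2 h) = cinner (V2 \<xi>) h"
    "\<And>h. norm (T2 h) \<le> K2 * norm h" "\<And>\<xi>. norm (V2 \<xi>) \<le> K2 * norm \<xi>" "K2 \<ge> 0"
    by (fact synthesis_operator[OF assms(2)])
  have b11: "bounded_clinear (\<lambda>\<xi>. T1 (V1 \<xi>))" and b21: "bounded_clinear (\<lambda>\<xi>. T2 (V1 \<xi>))"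
    and b22: "bounded_clinear (\<lambda>\<xi>. T2 (V2 \<xi>))"
  proof -
    show "bounded_clinear (\<lambda>\<xi>. T1 (V1 \<xi>))"
    proof (rule bounded_clinearI[where K = "K1 * K1"])
      show "norm (T1 (V1 x)) \<le> K1 * K1 * norm x" for x
        using order_trans[OF 1(10)[of "V1 x"] mult_left_mono[OF 1(11)[of x] 1(12)]] by (simp add: mult.assoc)
    qed (simp_all add: 1(1,2,5,6) 2(1,2,5,6))
    show "bounded_clinear (\<lambda>\<xi>. T2 (V1 \<xi>))"
    proof (rule bounded_clinearI[where K = "K2 * K1"])
      show "norm (T2 (V1 x)) \<le> K2 * K1 * norm x" for x
        using order_trans[OF 2(10)[of "V1 x"] mult_left_mono[OF 1(11)[of x] 2(12)]] by (simp add: mult.assoc)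
    qed (simp_all add: 1(1,2,5,6) 2(1,2,5,6))
    show "bounded_clinear (\<lambda>\<xi>. T2 (V2 \<xi>))"
    proof (rule bounded_clinearI[where K = "K2 * K2"])
      show "norm (T2 (V2 x)) \<le> K2 * K2 * norm x" for x
        using order_trans[OF 2(10)[of "V2 x"] mult_left_mono[OF 2(11)[of x] 2(12)]] by (simp add: mult.assoc)
    qed (simp_all add: 1(1,2,5,6) 2(1,2,5,6))
  qed
  define B where "B \<xi> = T1 (V1 \<xi>) - T2 (V2 \<xi>)" for \<xi>
  have Bb: "bounded_clinear B"
    unfolding B_def using bounded_clinear_plus[OF b11 bounded_clinear_scale[OF b22, of "-1"]]
    by (simp add: scaleC_minus_one)
  have "selfadjoint B"
    unfolding selfadjoint_def using Bb
    by (simp add: B_def cinner.diff_left cinner.diff_right 1(8,9) 2(8,9))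
  obtain C where C: "selfadjoint C" "\<And>x. 0 \<le> Re (cinner (C x) x)" "\<And>x. C (C x) = B (B x)"
    "\<And>D x. bounded_clinear D \<Longrightarrow> (\<And>x. D (B x) = B (D x)) \<Longrightarrow> D (C x) = C (D x)"
    "\<And>A. operator_algebra A \<Longrightarrow> closedin wot A \<Longrightarrow> id \<in> A \<Longrightarrow> B \<in> A \<Longrightarrow> C \<in> A"
    by (fact selfadjoint_absolute_value[OF \<open>selfadjoint B\<close>])
  have Cb: "bounded_clinear C" and Cs: "\<And>x y. cinner (C x) y = cinner x (C y)"
    using C(1) by (auto simp: selfadjoint_def)
  have Bs: "\<And>x y. cinner (B x) y = cinner x (B y)"
    using \<open>selfadjoint B\<close> by (auto simp: selfadjoint_def)
  have Zdiff: "bishift n (x - y) = bishift n x - bishift n y" for n x y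
    by (rule bounded_clinear_diff[OF bounded_clinear_bishift])
  have ZB: "B (bishift n x) = bishift n (B x)" for n x
    by (simp add: B_def 1 2 Zdiff)
  have ZC: "bishift n (C x) = C (bishift n x)" for n x
    by (rule C(4)[OF bounded_clinear_bishift]) (simp add: ZB)
  have BC: "B (C x) = C (B x)" for x by (rule C(4)[OF Bb]) simp
  \<comment> \<open>The nonnegative spectral subspace of \<open>B\<close>, described through its
    absolute value \<open>C\<close>.\<close>
  define M where "M = {\<xi>. C \<xi> = B \<xi>}"
  have Mclosed: "closure M = M"
  proof -
    have "closed M" unfolding M_def
      using bounded_clinear_bounded_linear[OF Bb] bounded_clinear_bounded_linear[OF Cb]
      by (intro closed_Collect_eq) (auto intro: linear_continuous_on)
    then show ?thesis by (rule closure_closed)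
  qed
  obtain e f where ef: "ket 0 = e + f" "e \<in> closure M" and fM: "\<And>y. y \<in> M \<Longrightarrow> cinner f y = 0"
    by (rule orthogonal_decomposition[of M "ket 0"])
      (auto simp: M_def bounded_clinear_add[OF Bb] bounded_clinear_add[OF Cb]
        bounded_clinear_scaleC[OF Bb] bounded_clinear_scaleC[OF Cb]
        bounded_clinear_zero[OF Bb] bounded_clinear_zero[OF Cb])
  have eM: "e \<in> M" using ef(2) Mclosed by simp
  \<comment> \<open>The shifts carry the splitting of \<open>ket 0\<close> to every
    \<open>ket m\<close>, so the orbit of \<open>x\<close> is synthesized by \<open>V1\<close> on
    \<open>M\<close> and by \<open>V2\<close> on its orthogonal complement.\<close>
  define x where "x = V1 e + V2 f"
  have reduces: "D y \<in> M" if D: "bounded_clinear D" "\<And>n x. D (bishift n x) = bishift n (D x)" "y \<in> M" for D y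
  proof -
    have DB: "D (B x) = B (D x)" for x by (rule bishift_commutant_abelian[OF D(1,2) Bb ZB])
    have "C (D y) = D (C y)" by (rule C(4)[OF D(1) DB, symmetric])
    also have "\<dots> = B (D y)" using D(3) DB by (simp add: M_def)
    finally show ?thesis by (simp add: M_def)
  qed
  have key: "\<exists>\<alpha> \<gamma>. (\<Sum>m\<in>F. a m *\<^sub>C u m x) = V1 \<alpha> + V2 \<gamma> \<and>
      (\<Sum>m\<in>F. a m *\<^sub>C u m x1) = V1 \<alpha> + V1 \<gamma> \<and> (\<Sum>m\<in>F. a m *\<^sub>C u m x2) = V2 \<alpha> + V2 \<gamma> \<and>
      (norm \<alpha>)\<^sup>2 + (norm \<gamma>)\<^sup>2 = (\<Sum>m\<in>F. (cmod (a m))\<^sup>2) \<and>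
      cinner (V1 \<alpha>) (V2 \<gamma>) = 0 \<and> cinner (V1 \<alpha>) (V1 \<gamma>) = 0 \<and> cinner (V2 \<alpha>) (V2 \<gamma>) = 0 \<and>
      norm (V2 \<alpha>) \<le> norm (V1 \<alpha>) \<and> norm (V1 \<gamma>) \<le> norm (V2 \<gamma>)"
    if F: "finite F" for F a
  proof -
    define \<alpha> where "\<alpha> = (\<Sum>m\<in>F. a m *\<^sub>C bishift m e)"
    define \<gamma> where "\<gamma> = (\<Sum>m\<in>F. a m *\<^sub>C bishift m f)"
    have lin: "V1 (\<Sum>m\<in>F. a m *\<^sub>C bishift m y) = (\<Sum>m\<in>F. a m *\<^sub>C u m (V1 y))"
      "V2 (\<Sum>m\<in>F. a m *\<^sub>C bishift m y) = (\<Sum>m\<in>F. a m *\<^sub>C u m (V2 y))" for y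
      using F
    proof (induction F rule: finite_induct)
      case empty
      show "V1 (\<Sum>m\<in>{}. a m *\<^sub>C bishift m y) = (\<Sum>m\<in>{}. a m *\<^sub>C u m (V1 y))" using 1(2)[of 0 0] by simp
      show "V2 (\<Sum>m\<in>{}. a m *\<^sub>C bishift m y) = (\<Sum>m\<in>{}. a m *\<^sub>C u m (V2 y))" using 2(2)[of 0 0] by simp
    qed (simp_all add: 1(1,2,4) 2(1,2,4))
    have ux: "u m (y + z) = u m y + u m z" for m y z by (rule bounded_clinear_add[OF u_bounded])
    have \<alpha>\<gamma>: "\<alpha> + \<gamma> = (\<Sum>m\<in>F. a m *\<^sub>C ket m)"
    proof -
      have "\<alpha> + \<gamma> = (\<Sum>m\<in>F. a m *\<^sub>C bishift m (e + f))"
        by (simp add: \<alpha>_def \<gamma>_def bishift_add scaleC_add_right sum.distrib)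
      then show ?thesis by (simp add: ef(1)[symmetric] bishift_ket)
    qed
    have x12: "V1 (e + f) = x1" "V2 (e + f) = x2" using 1(3)[of 0] 2(3)[of 0] by (simp_all add: ef(1)[symmetric] u_0)
    have s0: "(\<Sum>m\<in>F. a m *\<^sub>C u m x) = V1 \<alpha> + V2 \<gamma>"
      unfolding \<alpha>_def \<gamma>_def lin x_def by (simp add: ux scaleC_add_right sum.distrib)
    have s1: "(\<Sum>m\<in>F. a m *\<^sub>C u m x1) = V1 \<alpha> + V1 \<gamma>" "(\<Sum>m\<in>F. a m *\<^sub>C u m x2) = V2 \<alpha> + V2 \<gamma>"
      unfolding \<alpha>_def \<gamma>_def lin x12[symmetric] by (simp_all add: 1(1) 2(1) ux scaleC_add_right sum.distrib)
    have "bishift m e \<in> M" for m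
      by (rule reduces[OF bounded_clinear_bishift _ eM]) (simp add: bishift_bishift add.commute)
    then have \<alpha>M: "\<alpha> \<in> M"
      unfolding \<alpha>_def M_def
      by (simp add: bounded_clinear_sum[OF Bb] bounded_clinear_sum[OF Cb] bounded_clinear_scaleC[OF Bb] bounded_clinear_scaleC[OF Cb])
    have \<gamma>M: "cinner \<gamma> y = 0" if "y \<in> M" for y
    proof -
      have "bishift (- m) y \<in> M" for m
        by (rule reduces[OF bounded_clinear_bishift _ that]) (simp add: bishift_bishift add.commute)
      then show ?thesis
        unfolding \<gamma>_def cinner.sum_left
        by (intro sum.neutral) (simp add: cinner_scaleC_left cinner_bishift_left fM)
    qed
    have \<gamma>M': "cinner y \<gamma> = 0" if "y \<in> M" for y
      using \<gamma>M[OF that] by (subst cinner_cnj) simp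
    have "(norm \<alpha>)\<^sup>2 + (norm \<gamma>)\<^sup>2 = (norm (\<alpha> + \<gamma>))\<^sup>2"
      by (rule norm_sq_add_orthogonal[symmetric]) (rule \<gamma>M'[OF \<alpha>M])
    also have "\<dots> = (\<Sum>m\<in>F. (norm (a m *\<^sub>C (ket m :: int ell2)))\<^sup>2)"
      unfolding \<alpha>\<gamma> using F
      by (intro norm_sq_sum_orthogonal) (auto simp: cinner_scaleC_left cinner_scaleC_right cinner_ket ket.rep_eq scaleC_ell2.rep_eq)
    also have "\<dots> = (\<Sum>m\<in>F. (cmod (a m))\<^sup>2)"
    proof (intro sum.cong refl)
      fix m
      have "(norm (ket m :: int ell2))\<^sup>2 = 1" unfolding norm_sq_eq_Re_cinner cinner_ket ket.rep_eq by simp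
      then show "(norm (a m *\<^sub>C (ket m :: int ell2)))\<^sup>2 = (cmod (a m))\<^sup>2"
        by (simp add: norm_scaleC power_mult_distrib)
    qed
    finally have n: "(norm \<alpha>)\<^sup>2 + (norm \<gamma>)\<^sup>2 = (\<Sum>m\<in>F. (cmod (a m))\<^sup>2)" .
    \<comment> \<open>Each inner product is moved to one of \<open>\<alpha>\<close> under some
      \<open>T V\<close> against \<open>\<gamma>\<close>. Every such product commutes with the
      shifts, hence preserves \<open>M\<close>, and \<open>\<gamma>\<close> is orthogonal to
      \<open>M\<close>.\<close>
    have o: "cinner (V1 \<alpha>) (V2 \<gamma>) = 0" "cinner (V1 \<alpha>) (V1 \<gamma>) = 0" "cinner (V2 \<alpha>) (V2 \<gamma>) = 0"
      unfolding 1(8)[symmetric] 2(8)[symmetric]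
      by (intro \<gamma>M' reduces[OF b21 _ \<alpha>M] reduces[OF b11 _ \<alpha>M] reduces[OF b22 _ \<alpha>M]; simp add: 1 2)+
    have Bn: "Re (cinner (B y) y) = (norm (V1 y))\<^sup>2 - (norm (V2 y))\<^sup>2" for y
      by (simp add: B_def cinner.diff_left 1(8) 2(8) cinner_self)
    have "0 \<le> Re (cinner (B \<alpha>) \<alpha>)" using C(2)[of \<alpha>] \<alpha>M by (simp add: M_def)
    then have "(norm (V2 \<alpha>))\<^sup>2 \<le> (norm (V1 \<alpha>))\<^sup>2" by (simp add: Bn)
    then have n1: "norm (V2 \<alpha>) \<le> norm (V1 \<alpha>)" by (rule power2_le_imp_le) simp
    \<comment> \<open>The operators commute and have equal squares, so
      \<open>(C - B) (C + B) = 0\<close> and the range of \<open>C + B\<close> lies in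
      \<open>M\<close>. Hence \<open>C + B\<close> annihilates whatever is orthogonal to
      \<open>M\<close>.\<close>
    have "C \<gamma> + B \<gamma> = 0"
    proof (rule cinner_eqI)
      fix y
      have "C y + B y \<in> M"
        by (simp add: M_def bounded_clinear_add[OF Bb] bounded_clinear_add[OF Cb] C(3) BC add.commute)
      then have "cinner (C y + B y) \<gamma> = 0" by (rule \<gamma>M')
      then show "cinner y (C \<gamma> + B \<gamma>) = cinner y 0"
        by (simp add: cinner_add_left cinner_add_right Cs Bs)
    qed
    then have "B \<gamma> = - C \<gamma>" by (simp add: eq_neg_iff_add_eq_0 add.commute)
    then have "Re (cinner (B \<gamma>) \<gamma>) \<le> 0" using C(2)[of \<gamma>] by (simp add: cinner.minus_left)
    then have "(norm (V1 \<gamma>))\<^sup>2 \<le> (norm (V2 \<gamma>))\<^sup>2" by (simp add: Bn)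
    then have n2: "norm (V1 \<gamma>) \<le> norm (V2 \<gamma>)" by (rule power2_le_imp_le) simp
    show ?thesis using s0 s1 n o n1 n2 by blast
  qed
  show thesis
  proof
    fix a :: "int \<Rightarrow> complex" and F :: "int set" assume F: "finite F"
    obtain \<alpha> \<gamma> where k: "(\<Sum>m\<in>F. a m *\<^sub>C u m x) = V1 \<alpha> + V2 \<gamma>"
      "(\<Sum>m\<in>F. a m *\<^sub>C u m x1) = V1 \<alpha> + V1 \<gamma>" "(\<Sum>m\<in>F. a m *\<^sub>C u m x2) = V2 \<alpha> + V2 \<gamma>"
      "cinner (V1 \<alpha>) (V2 \<gamma>) = 0" "cinner (V1 \<alpha>) (V1 \<gamma>) = 0" "cinner (V2 \<alpha>) (V2 \<gamma>) = 0"
      "norm (V2 \<alpha>) \<le> norm (V1 \<alpha>)" "norm (V1 \<gamma>) \<le> norm (V2 \<gamma>)"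
      using key[OF F, of a] by blast
    have arith: "p + r + (q + s) \<le> 2 * (p + s)" if "q \<le> p" "r \<le> s" for p q r s :: real
      using that by simp
    show "(norm (\<Sum>m\<in>F. a m *\<^sub>C u m x1))\<^sup>2 + (norm (\<Sum>m\<in>F. a m *\<^sub>C u m x2))\<^sup>2
        \<le> 2 * (norm (\<Sum>m\<in>F. a m *\<^sub>C u m x))\<^sup>2"
      unfolding k(1-3) norm_sq_add_orthogonal[OF k(4)] norm_sq_add_orthogonal[OF k(5)]
        norm_sq_add_orthogonal[OF k(6)]
      by (intro arith power_mono k(7,8)) auto
  next
    show "bessel x"
      unfolding bessel_def
    proof (intro exI[of _ "(K1 + K2)\<^sup>2"] conjI allI impI)
      fix h and F :: "int set" assume F: "finite F"
      \<comment> \<open>Duality: using the coefficients of \<open>h\<close> themselves as weights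
        makes the sum of their squares an inner product of \<open>h\<close> with a synthesized
        vector of norm at most \<open>(K1 + K2) * sqrt s\<close>.\<close>
      define a where "a m = cinner h (u m x)" for m
      define s where "s = (\<Sum>m\<in>F. (cmod (a m))\<^sup>2)"
      have s0: "s \<ge> 0" by (simp add: s_def sum_nonneg)
      obtain \<alpha> \<gamma> where k: "(\<Sum>m\<in>F. a m *\<^sub>C u m x) = V1 \<alpha> + V2 \<gamma>"
        "(norm \<alpha>)\<^sup>2 + (norm \<gamma>)\<^sup>2 = s"
        using key[OF F, of a] unfolding s_def by blast
      have "norm \<alpha> \<le> sqrt s" "norm \<gamma> \<le> sqrt s"
        using zero_le_power2[of "norm \<alpha>"] zero_le_power2[of "norm \<gamma>"] k(2)
        by (auto intro!: real_le_rsqrt simp del: zero_le_power2)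
      then have "norm (V1 \<alpha>) \<le> K1 * sqrt s" "norm (V2 \<gamma>) \<le> K2 * sqrt s"
        using 1(11)[of \<alpha>] 2(11)[of \<gamma>] 1(12) 2(12) by (meson mult_left_mono order_trans)+
      then have nn: "norm (V1 \<alpha> + V2 \<gamma>) \<le> (K1 + K2) * sqrt s"
        using norm_triangle_ineq[of "V1 \<alpha>" "V2 \<gamma>"] by (simp add: distrib_right)
      have "cinner h (\<Sum>m\<in>F. a m *\<^sub>C u m x) = (\<Sum>m\<in>F. a m * cnj (a m))"
        unfolding cinner.sum_right by (intro sum.cong refl) (simp add: cinner_scaleC_right a_def mult.commute)
      also have "\<dots> = of_real s" unfolding s_def of_real_sum complex_norm_square ..
      finally have "s = cmod (cinner h (V1 \<alpha> + V2 \<gamma>))" using s0 by (simp add: k(1))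
      also have "\<dots> \<le> norm h * ((K1 + K2) * sqrt s)"
        using norm_cinner_le[of h "V1 \<alpha> + V2 \<gamma>"] nn by (meson mult_left_mono norm_ge_zero order_trans)
      finally have "sqrt s * sqrt s \<le> sqrt s * (norm h * (K1 + K2))" using s0 by (simp add: mult_ac)
      then have "sqrt s \<le> norm h * (K1 + K2)"
      proof (cases "s = 0")
        case False
        then have "sqrt s > 0" using s0 by simp
        then show ?thesis using \<open>sqrt s * sqrt s \<le> _\<close> mult_le_cancel_left_pos by blast
      qed (use 1(12) 2(12) in simp)
      then have "(sqrt s)\<^sup>2 \<le> (norm h * (K1 + K2))\<^sup>2" using s0 by (intro power_mono) auto
      then show "(\<Sum>m\<in>F. (cmod (cinner h (u m x)))\<^sup>2) \<le> (K1 + K2)\<^sup>2 * (norm h)\<^sup>2"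
        using s0 by (simp add: s_def[symmetric] a_def[symmetric] power_mult_distrib mult.commute)
    qed simp
  qed
qed

text \<open>Repeated merging, each step costing at most a factor 2. The inequality transfers a lower
  bound for the whole family, such as a distance in the direct sum, to the single vector
  \<open>x\<close>.\<close>

lemma merge_bessel_family:
  assumes "finite J" "\<And>j. j \<in> J \<Longrightarrow> bessel (z j)"
  shows "\<exists>x c. c > 0 \<and> bessel x \<and> (\<forall>a F. finite F \<longrightarrow>
    c * (\<Sum>j\<in>J. (norm (\<Sum>m\<in>F. a m *\<^sub>C u m (z j)))\<^sup>2) \<le> (norm (\<Sum>m\<in>F. a m *\<^sub>C u m x))\<^sup>2)"
  using assms
proof (induction J rule: finite_induct)
  case empty
  have "bessel 0" unfolding bessel_def
    by (intro exI[of _ 0]) (simp add: bounded_clinear_zero[OF u_bounded])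
  then show ?case by (intro exI[of _ 0] exI[of _ 1]) simp
next
  case (insert j J)
  then obtain x c where x: "c > 0" "bessel x" "\<And>a F. finite F \<Longrightarrow>
    c * (\<Sum>j\<in>J. (norm (\<Sum>m\<in>F. a m *\<^sub>C u m (z j)))\<^sup>2) \<le> (norm (\<Sum>m\<in>F. a m *\<^sub>C u m x))\<^sup>2"
    by auto
  have zb: "bessel (z j)" using insert.prems by simp
  obtain y where y: "bessel y"
    "\<And>a F. finite F \<Longrightarrow> (norm (\<Sum>m\<in>F. a m *\<^sub>C u m x))\<^sup>2 + (norm (\<Sum>m\<in>F. a m *\<^sub>C u m (z j)))\<^sup>2
        \<le> 2 * (norm (\<Sum>m\<in>F. a m *\<^sub>C u m y))\<^sup>2"
    by (fact merge_bessel_vectors[OF x(2) zb])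
  have "min c 1 / 2 * (\<Sum>j\<in>insert j J. (norm (\<Sum>m\<in>F. a m *\<^sub>C u m (z j)))\<^sup>2) \<le> (norm (\<Sum>m\<in>F. a m *\<^sub>C u m y))\<^sup>2"
    if F: "finite F" for F a
  proof -
    let ?n = "\<lambda>v. (norm (\<Sum>m\<in>F. a m *\<^sub>C u m v))\<^sup>2"
    have "min c 1 * (\<Sum>j\<in>insert j J. ?n (z j)) = min c 1 * ?n (z j) + min c 1 * (\<Sum>j\<in>J. ?n (z j))"
      using insert.hyps by (simp add: distrib_left)
    also have "\<dots> \<le> 1 * ?n (z j) + c * (\<Sum>j\<in>J. ?n (z j))"
      by (intro add_mono mult_right_mono) (auto intro: sum_nonneg)
    also have "\<dots> \<le> 2 * ?n y" using x(3)[OF F, of a] y(2)[OF F, of a] by simp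
    finally show ?thesis by simp
  qed
  then show ?case using x(1) y(1) by (intro exI[of _ y] exI[of _ "min c 1 / 2"]) auto
qed

end

section \<open>The case of one generator\<close>

context orthogonal_isometries
begin

lemma wandering_if_orthogonal_to_ranges:
  assumes "y \<noteq> 0" "\<And>i x. cinner y (S i x) = 0"
  shows "\<exists>x. wandering S x"
proof (rule wanderingI[OF assms(1)])
  fix w :: "'i list" assume "w \<noteq> []"
  then show "cinner y (W w y) = 0" using assms(2) by (cases w) auto
qed

text \<open>A generator that is not onto has a wandering vector orthogonal to its range. Otherwise
  its integer powers form a unitary group in which the \<open>z j\<close> are Bessel vectors. Since
  \<open>1 + p\<close> is a combination of powers, the distance of the jointly wandering family from
  its proper images passes to the merged vector.\<close>

lemma wandering_if_single_generator:
  assumes one: "\<And>i j::'i. i = j" and J: "finite J"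
    and z: "\<And>u v. (\<Sum>j\<in>J. cinner (W u (z j)) (W v (z j))) = (if u = v then 1 else 0)"
  shows "\<exists>x. wandering S x"
proof (cases "\<exists>y. y \<noteq> 0 \<and> (\<forall>i x. cinner y (S i x) = 0)")
  case True
  then show ?thesis using wandering_if_orthogonal_to_ranges by blast
next
  case False
  define i :: 'i where "i = undefined"
  let ?U = "S i" and ?V = "cadjoint (S i)"
  have VU: "?V (?U x) = x" for x using cadjoint_S_W[of i "[i]" x] by simp
  have UV: "?U (?V x) = x" for x
  proof -
    have "cinner (x - ?U (?V x)) (S j y) = 0" for j y
      using one[of j i] by (simp add: cinner.diff_left cinner_S cinner_cadjoint_left)
    then have "x - ?U (?V x) = 0" using False by blast
    then show ?thesis by simp
  qed
  have Vb: "bounded_clinear ?V" by (simp add: bounded_clinear_cadjoint)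
  define u where "u m = (if m \<ge> 0 then ?U ^^ nat m else ?V ^^ nat (- m))" for m :: int
  have u1: "?U (u m x) = u (m + 1) x" for m x
  proof (cases "m \<ge> 0")
    case True
    then have "nat (m + 1) = Suc (nat m)" by simp
    then show ?thesis using True by (simp add: u_def)
  next
    case False
    then have "nat (- m) = Suc (nat (- (m + 1)))" by simp
    then show ?thesis using False UV by (auto simp: u_def)
  qed
  have u_u: "u m (u n x) = u (m + n) x" for m n x
  proof (induction m rule: int_induct[where k = 0])
    case base
    show ?case by (simp add: u_def)
  next
    case (step1 m)
    then show ?case using u1[of m "u n x"] u1[of "m + n" x] by (simp add: algebra_simps)
  next
    case (step2 m)
    have "?U (u (m - 1) (u n x)) = ?U (u (m - 1 + n) x)"
      using step2 u1[of "m - 1" "u n x"] u1[of "m - 1 + n" x] by (simp add: algebra_simps)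
    then show ?case using VU by metis
  qed
  interpret unitary_group u
  proof
    fix n m x y
    show "u 0 x = x" by (simp add: u_def)
    show "u m (u n x) = u (m + n) x" by (rule u_u)
    have "bounded_clinear (T ^^ k)" if "bounded_clinear T" for T :: "'a \<Rightarrow> 'a" and k
      by (induction k) (use that in \<open>auto simp: bounded_clinear_id o_def bounded_clinear_comp id_def bounded_clinear_ident\<close>)
    then show "bounded_clinear (u n)" using Vb by (simp add: u_def)
    have "cinner ((T ^^ k) x) ((T ^^ k) y) = cinner x y"
      if "\<And>x y. cinner (T x) (T y) = cinner x y" for T :: "'a \<Rightarrow> 'a" and k
      by (induction k) (use that in auto)
    moreover have "cinner (?V x) (?V y) = cinner x y" for x y
      using UV by (simp add: cinner_cadjoint_left)
    ultimately show "cinner (u n x) (u n y) = cinner x y" by (simp add: u_def cinner_S)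
  qed
  have uW: "u (int k) x = W (replicate k i) x" for k x
    by (induction k) (simp_all add: u_def nat_add_distrib)
  have Wu: "W w x = u (int (length w)) x" for w x
  proof -
    have "w = replicate (length w) i" by (rule replicate_eqI) (auto intro: one)
    then show ?thesis using uW by metis
  qed
  have bes: "bessel (z j)" if j: "j \<in> J" for j
    unfolding bessel_def
  proof (intro exI[of _ 1] conjI allI impI)
    fix h and F :: "int set" assume F: "finite F"
    \<comment> \<open>Translating by this unitary power makes all exponents in \<open>F\<close>
      nonnegative, so that they come from words and Bessel's inequality for words applies.\<close>
    define N where "N = nat (Max (insert 0 (uminus ` F)))"
    have N: "int N + m \<ge> 0" if "m \<in> F" for m
    proof -
      have "- m \<le> Max (insert 0 (uminus ` F))" using F that by (intro Max_ge) auto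
      then show ?thesis unfolding N_def by linarith
    qed
    define r where "r m = replicate (nat (int N + m)) i" for m
    have inj: "inj_on r F"
    proof (rule inj_onI)
      fix m k assume mk: "m \<in> F" "k \<in> F" "r m = r k"
      then have "nat (int N + m) = nat (int N + k)" unfolding r_def by (metis length_replicate)
      then show "m = k" using N[OF mk(1)] N[OF mk(2)] by linarith
    qed
    have "(\<Sum>m\<in>F. (cmod (cinner h (u m (z j))))\<^sup>2) = (\<Sum>m\<in>F. (cmod (cinner (u (int N) h) (W (r m) (z j))))\<^sup>2)"
    proof (intro sum.cong refl)
      fix m assume m: "m \<in> F"
      have "W (r m) (z j) = u (int N) (u m (z j))"
        using N[OF m] by (simp add: r_def uW[symmetric] u_u)
      then show "(cmod (cinner h (u m (z j))))\<^sup>2 = (cmod (cinner (u (int N) h) (W (r m) (z j))))\<^sup>2"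
        by (simp add: cinner_u)
    qed
    also have "\<dots> = (\<Sum>w\<in>r ` F. (cmod (cinner (u (int N) h) (W w (z j))))\<^sup>2)"
      by (simp add: sum.reindex[OF inj])
    also have "\<dots> \<le> (norm (u (int N) h))\<^sup>2"
      using bessel_wandering_family[OF J j z] F by simp
    also have "\<dots> = 1 * (norm h)\<^sup>2" by (simp add: uW)
    finally show "(\<Sum>m\<in>F. (cmod (cinner h (u m (z j))))\<^sup>2) \<le> 1 * (norm h)\<^sup>2" .
  qed simp
  obtain x c where c: "c > 0" and x: "\<And>a F. finite F \<Longrightarrow>
      c * (\<Sum>j\<in>J. (norm (\<Sum>m\<in>F. a m *\<^sub>C u m (z j)))\<^sup>2) \<le> (norm (\<Sum>m\<in>F. a m *\<^sub>C u m x))\<^sup>2"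
    using merge_bessel_family[of J z] J bes by blast
  have poly: "\<exists>a F. finite F \<and> (\<forall>y. y + p y = (\<Sum>m\<in>F. a m *\<^sub>C u m y))" if "p \<in> proper_polys S" for p
    using that
  proof (induction rule: proper_polys.induct)
    case zero
    show ?case by (intro exI[of _ "\<lambda>_. 1"] exI[of _ "{0}"]) (simp add: u_0)
  next
    case (add p w d)
    then obtain a F where F: "finite F" "\<And>y. y + p y = (\<Sum>m\<in>F. a m *\<^sub>C u m y)" by blast
    define k where "k = int (length w)"
    \<comment> \<open>The new monomial may have an exponent that already occurs in \<open>F\<close>,
      so the coefficients are added.\<close>
    define b where "b m = (if m \<in> F then a m else 0) + (if m = k then d else 0)" for m
    have "y + (p y + d *\<^sub>C W w y) = (\<Sum>m\<in>insert k F. b m *\<^sub>C u m y)" for y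
    proof -
      have "(\<Sum>m\<in>insert k F. b m *\<^sub>C u m y)
          = (\<Sum>m\<in>insert k F. (if m \<in> F then a m *\<^sub>C u m y else 0)) + (\<Sum>m\<in>insert k F. (if m = k then d *\<^sub>C u m y else 0))"
        unfolding sum.distrib[symmetric] by (intro sum.cong refl) (auto simp: b_def scaleC_add_left)
      also have "(\<Sum>m\<in>insert k F. (if m \<in> F then a m *\<^sub>C u m y else 0)) = (\<Sum>m\<in>F. a m *\<^sub>C u m y)"
        using F(1) by (intro sum.mono_neutral_cong_right) auto
      also have "(\<Sum>m\<in>insert k F. (if m = k then d *\<^sub>C u m y else 0)) = d *\<^sub>C W w y"
        using F(1) by (simp add: Wu k_def)
      finally show ?thesis by (simp add: F(2)[symmetric] add.assoc)
    qed
    then show ?case using F(1) by (intro exI[of _ b] exI[of _ "insert k F"]) simp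
  qed
  show ?thesis
  proof (rule wandering_if_positive_distance[OF c])
    fix p assume p: "p \<in> proper_polys S"
    obtain a F where F: "finite F" "\<And>y. y + p y = (\<Sum>m\<in>F. a m *\<^sub>C u m y)" using poly[OF p] by blast
    \<comment> \<open>The family is jointly orthogonal to its proper images, so adding
      \<open>p (z j)\<close> cannot bring its total squared norm below 1.\<close>
    have "(\<Sum>j\<in>J. cinner (z j) (p (z j))) = 0"
      using p
    proof (induction rule: proper_polys.induct)
      case (add p w d)
      have "(\<Sum>j\<in>J. cinner (z j) (W w (z j))) = 0" using z[of "[]" w] add.hyps by simp
      then show ?case
        using add.IH by (simp add: cinner_add_right cinner_scaleC_right sum.distrib flip: sum_distrib_left)
    qed simp
    then have re: "(\<Sum>j\<in>J. Re (cinner (z j) (p (z j)))) = 0" by (simp flip: Re_sum)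
    have "of_real (\<Sum>j\<in>J. (norm (z j))\<^sup>2) = (1::complex)"
      using z[of "[]" "[]"] by (simp add: cinner_self)
    then have "(\<Sum>j\<in>J. (norm (z j))\<^sup>2) = 1" unfolding of_real_eq_1_iff .
    then have "1 \<le> (\<Sum>j\<in>J. (norm (z j + p (z j)))\<^sup>2)"
      unfolding norm_sq_add using re by (simp add: sum.distrib sum_nonneg flip: sum_distrib_left)
    then have "c * 1 \<le> c * (\<Sum>j\<in>J. (norm (z j + p (z j)))\<^sup>2)" using c by (intro mult_left_mono) auto
    also have "\<dots> \<le> (norm (x + p x))\<^sup>2" using x[OF F(1), of a] by (simp add: F(2))
    finally show "c \<le> (norm (x + p x))\<^sup>2" by simp
  qed
qed

end

section \<open>Several generators: matrix coefficients\<close>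

lemma summable_on_tail:
  fixes f :: "'w \<Rightarrow> real"
  assumes f: "f summable_on UNIV" "\<And>w. f w \<ge> 0" and "\<delta> > 0"
  obtains F where "finite F" "\<And>G. finite G \<Longrightarrow> G \<inter> F = {} \<Longrightarrow> sum f G \<le> \<delta>"
proof -
  have "(sum f \<longlongrightarrow> infsum f UNIV) (finite_subsets_at_top UNIV)"
    using f(1) has_sum_infsum unfolding has_sum_def by blast
  then have "\<forall>\<^sub>F F in finite_subsets_at_top UNIV. dist (sum f F) (infsum f UNIV) < \<delta>"
    using assms(3) by (rule tendstoD)
  then obtain F where F: "finite F" "dist (sum f F) (infsum f UNIV) < \<delta>"
    unfolding eventually_finite_subsets_at_top by blast
  have "sum f G \<le> \<delta>" if "finite G" "G \<inter> F = {}" for G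
  proof -
    have "sum f G + sum f F = sum f (G \<union> F)" using that F(1) by (simp add: sum.union_disjoint)
    also have "\<dots> \<le> infsum f UNIV" using that(1) F(1) f by (intro finite_sum_le_infsum) auto
    finally show ?thesis using F(2) by (simp add: dist_real_def)
  qed
  then show thesis using that F(1) by blast
qed

lemma norm_ell2_le_iff:
  assumes "c \<ge> 0"
  shows "(norm x)\<^sup>2 \<le> c \<longleftrightarrow> (\<forall>F. finite F \<longrightarrow> (\<Sum>w\<in>F. (cmod (ell2_coord x w))\<^sup>2) \<le> c)"
proof
  assume "(norm x)\<^sup>2 \<le> c"
  then show "\<forall>F. finite F \<longrightarrow> (\<Sum>w\<in>F. (cmod (ell2_coord x w))\<^sup>2) \<le> c"
    using ell2_sum_le_norm order_trans by blast
next
  assume "\<forall>F. finite F \<longrightarrow> (\<Sum>w\<in>F. (cmod (ell2_coord x w))\<^sup>2) \<le> c"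
  then show "(norm x)\<^sup>2 \<le> c"
    unfolding power2_norm_eq_inner[of x] inner_ell2_self
    using ell2_coord[of x] by (intro infsum_le_finite_sums) auto
qed

lemma norm_ket [simp]: "norm (ket w) = 1"
proof -
  have "(norm (ket w))\<^sup>2 = 1" unfolding norm_sq_eq_Re_cinner cinner_ket ket.rep_eq by simp
  then show ?thesis using norm_ge_zero[of "ket w"] by (auto simp: power2_eq_1_iff simp del: norm_ge_zero)
qed

lemma ell2_coord_sum: "ell2_coord (\<Sum>i\<in>F. x i) w = (\<Sum>i\<in>F. ell2_coord (x i) w)"
  by (induction F rule: infinite_finite_induct) (simp_all add: zero_ell2.rep_eq plus_ell2.rep_eq)

lemma ell2_finite_approximation:
  assumes "\<delta> > 0"
  obtains F where "finite F" "norm (x - (\<Sum>w\<in>F. ell2_coord x w *\<^sub>C ket w)) \<le> \<delta>"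
proof -
  obtain F where F: "finite F" "\<And>G. finite G \<Longrightarrow> G \<inter> F = {} \<Longrightarrow> (\<Sum>w\<in>G. (cmod (ell2_coord x w))\<^sup>2) \<le> \<delta>\<^sup>2"
    using summable_on_tail[of "\<lambda>w. (cmod (ell2_coord x w))\<^sup>2" "\<delta>\<^sup>2"] ell2_coord[of x] assms by auto
  have co: "ell2_coord (x - (\<Sum>w\<in>F. ell2_coord x w *\<^sub>C ket w)) v = (if v \<in> F then 0 else ell2_coord x v)" for v
  proof -
    have "(\<Sum>w\<in>F. ell2_coord x w * ell2_coord (ket w) v) = (\<Sum>w\<in>F. if v = w then ell2_coord x v else 0)"
      by (intro sum.cong refl) (simp add: ket.rep_eq)
    then show ?thesis
      using F(1) by (simp add: minus_ell2.rep_eq ell2_coord_sum scaleC_ell2.rep_eq)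
  qed
  have "(norm (x - (\<Sum>w\<in>F. ell2_coord x w *\<^sub>C ket w)))\<^sup>2 \<le> \<delta>\<^sup>2"
    unfolding norm_ell2_le_iff[OF zero_le_power2] co
  proof (intro allI impI)
    fix G :: "'a set" assume G: "finite G"
    have "(\<Sum>w\<in>G. (cmod (if w \<in> F then 0 else ell2_coord x w))\<^sup>2) = (\<Sum>w\<in>G - F. (cmod (ell2_coord x w))\<^sup>2)"
      using G by (intro sum.mono_neutral_cong_right) auto
    also have "\<dots> \<le> \<delta>\<^sup>2" using F(2)[of "G - F"] G by auto
    finally show "(\<Sum>w\<in>G. (cmod (if w \<in> F then 0 else ell2_coord x w))\<^sup>2) \<le> \<delta>\<^sup>2" .
  qed
  then have "norm (x - (\<Sum>w\<in>F. ell2_coord x w *\<^sub>C ket w)) \<le> \<delta>"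
    using assms by (auto intro: power2_le_imp_le)
  then show thesis using that F(1) by blast
qed

context orthogonal_isometries
begin

text \<open>The vectors for which \<open>ket w \<mapsto> W w x\<close> extends to a bounded operator
  from \<open>ell2\<close>, expressed through its adjoint as a Bessel condition.\<close>

definition bounded_vectors :: "'a set" where
  "bounded_vectors = {x. \<exists>K\<ge>0. \<forall>y F. finite F \<longrightarrow> (\<Sum>w\<in>F. (cmod (cinner (W w x) y))\<^sup>2) \<le> K * (norm y)\<^sup>2}"

text \<open>The functional given by the pair on the words, as an element of \<open>ell2\<close>. The
  coercion is meaningful for \<open>x\<close> in \<open>bounded_vectors\<close>. The map is linear
  in \<open>x\<close> and conjugate-linear in \<open>y\<close>.\<close>

definition matrix_coeffs :: "'a \<Rightarrow> 'a \<Rightarrow> 'i list ell2" where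
  "matrix_coeffs x y = Abs_ell2 (\<lambda>w. cinner (W w x) y)"

lemma bounded_vectorsE:
  assumes "x \<in> bounded_vectors"
  obtains K where "K \<ge> 0" "\<And>y F. finite F \<Longrightarrow> (\<Sum>w\<in>F. (cmod (cinner (W w x) y))\<^sup>2) \<le> K * (norm y)\<^sup>2"
  using assms unfolding bounded_vectors_def by blast

lemma bounded_vectors_summable:
  assumes "x \<in> bounded_vectors"
  shows "(\<lambda>w. (cmod (cinner (W w x) y))\<^sup>2) summable_on UNIV"
proof -
  obtain K where K: "\<And>y F. finite F \<Longrightarrow> (\<Sum>w\<in>F. (cmod (cinner (W w x) y))\<^sup>2) \<le> K * (norm y)\<^sup>2"
    using bounded_vectorsE[OF assms] by metis
  show ?thesis by (intro nonneg_bdd_above_summable_on bdd_aboveI2[where M = "K * (norm y)\<^sup>2"]) (auto intro: K)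
qed

lemma matrix_coeffs_coord:
  "x \<in> bounded_vectors \<Longrightarrow> ell2_coord (matrix_coeffs x y) w = cinner (W w x) y"
  using bounded_vectors_summable[of x y] by (simp add: matrix_coeffs_def Abs_ell2_inverse)

lemma zero_bounded: "0 \<in> bounded_vectors"
  unfolding bounded_vectors_def by (auto intro!: exI[of _ 0] simp: bounded_clinear_zero)

lemma bounded_vectors_add:
  assumes "x \<in> bounded_vectors" "y \<in> bounded_vectors"
  shows "x + y \<in> bounded_vectors"
proof -
  obtain K where K: "K \<ge> 0" "\<And>h F. finite F \<Longrightarrow> (\<Sum>w\<in>F. (cmod (cinner (W w x) h))\<^sup>2) \<le> K * (norm h)\<^sup>2"
    by (rule bounded_vectorsE[OF assms(1)]) blast
  obtain L where L: "L \<ge> 0" "\<And>h F. finite F \<Longrightarrow> (\<Sum>w\<in>F. (cmod (cinner (W w y) h))\<^sup>2) \<le> L * (norm h)\<^sup>2"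
    by (rule bounded_vectorsE[OF assms(2)]) blast
  have sq: "(cmod (a + b))\<^sup>2 \<le> 2 * (cmod a)\<^sup>2 + 2 * (cmod b)\<^sup>2" for a b
  proof -
    have "(cmod (a + b))\<^sup>2 \<le> (cmod a + cmod b)\<^sup>2" by (intro power_mono norm_triangle_ineq) auto
    moreover have "0 \<le> (cmod a - cmod b)\<^sup>2" by simp
    ultimately show ?thesis by (simp add: power2_diff power2_sum)
  qed
  have "(\<Sum>w\<in>F. (cmod (cinner (W w (x + y)) h))\<^sup>2) \<le> (2 * K + 2 * L) * (norm h)\<^sup>2" if "finite F" for F h
  proof -
    have "(\<Sum>w\<in>F. (cmod (cinner (W w (x + y)) h))\<^sup>2)
        \<le> (\<Sum>w\<in>F. 2 * (cmod (cinner (W w x) h))\<^sup>2 + 2 * (cmod (cinner (W w y) h))\<^sup>2)"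
      by (intro sum_mono) (simp add: bounded_clinear_add cinner_add_left sq)
    also have "\<dots> = 2 * (\<Sum>w\<in>F. (cmod (cinner (W w x) h))\<^sup>2) + 2 * (\<Sum>w\<in>F. (cmod (cinner (W w y) h))\<^sup>2)"
      by (simp add: sum.distrib sum_distrib_left)
    finally show ?thesis using K(2)[OF that, of h] L(2)[OF that, of h] by (simp add: algebra_simps)
  qed
  then show ?thesis unfolding bounded_vectors_def using K(1) L(1)
    by (intro CollectI exI[of _ "2 * K + 2 * L"]) simp
qed

lemma bounded_vectors_scaleC:
  assumes "x \<in> bounded_vectors"
  shows "c *\<^sub>C x \<in> bounded_vectors"
proof -
  obtain K where K: "K \<ge> 0" "\<And>h F. finite F \<Longrightarrow> (\<Sum>w\<in>F. (cmod (cinner (W w x) h))\<^sup>2) \<le> K * (norm h)\<^sup>2"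
    by (rule bounded_vectorsE[OF assms(1)]) blast
  have "(\<Sum>w\<in>F. (cmod (cinner (W w (c *\<^sub>C x)) h))\<^sup>2) \<le> ((cmod c)\<^sup>2 * K) * (norm h)\<^sup>2" if "finite F" for F h
    using mult_left_mono[OF K(2)[OF that, of h], of "(cmod c)\<^sup>2"]
    by (simp add: bounded_clinear_scaleC cinner_scaleC_left norm_mult power_mult_distrib mult.assoc sum_distrib_left)
  then show ?thesis unfolding bounded_vectors_def using K(1)
    by (intro CollectI exI[of _ "(cmod c)\<^sup>2 * K"]) simp
qed

text \<open>Replacing \<open>x\<close> by \<open>W u x\<close> selects the coefficients at the words
  ending in \<open>u\<close>.\<close>

lemma sum_W_shift:
  assumes "finite F"
  shows "(\<Sum>w\<in>F. (cmod (cinner (W w (W u x)) y))\<^sup>2) = (\<Sum>w\<in>(\<lambda>w. w @ u) ` F. (cmod (cinner (W w x) y))\<^sup>2)"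
  by (subst sum.reindex) (auto simp: inj_on_def W_append)

lemma bounded_vectors_W:
  assumes "x \<in> bounded_vectors"
  shows "W u x \<in> bounded_vectors"
proof -
  obtain K where K: "K \<ge> 0" "\<And>h F. finite F \<Longrightarrow> (\<Sum>w\<in>F. (cmod (cinner (W w x) h))\<^sup>2) \<le> K * (norm h)\<^sup>2"
    by (rule bounded_vectorsE[OF assms(1)]) blast
  then show ?thesis unfolding bounded_vectors_def by (intro CollectI exI[of _ K]) (simp add: sum_W_shift)
qed

lemma matrix_coeffs_add_left:
  "x \<in> bounded_vectors \<Longrightarrow> x' \<in> bounded_vectors \<Longrightarrow> matrix_coeffs (x + x') y = matrix_coeffs x y + matrix_coeffs x' y"
  by (rule ell2_eqI)
    (simp add: matrix_coeffs_coord bounded_vectors_add plus_ell2.rep_eq bounded_clinear_add cinner_add_left)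

lemma matrix_coeffs_add_right:
  "x \<in> bounded_vectors \<Longrightarrow> matrix_coeffs x (y + y') = matrix_coeffs x y + matrix_coeffs x y'"
  by (rule ell2_eqI) (simp add: matrix_coeffs_coord plus_ell2.rep_eq cinner_add_right)

lemma matrix_coeffs_scaleC_left:
  "x \<in> bounded_vectors \<Longrightarrow> matrix_coeffs (c *\<^sub>C x) y = c *\<^sub>C matrix_coeffs x y"
  by (rule ell2_eqI)
    (simp add: matrix_coeffs_coord bounded_vectors_scaleC scaleC_ell2.rep_eq bounded_clinear_scaleC cinner_scaleC_left)

lemma matrix_coeffs_scaleC_right:
  "x \<in> bounded_vectors \<Longrightarrow> matrix_coeffs x (c *\<^sub>C y) = cnj c *\<^sub>C matrix_coeffs x y"
  by (rule ell2_eqI) (simp add: matrix_coeffs_coord scaleC_ell2.rep_eq cinner_scaleC_right)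

lemma matrix_coeffs_zero_right: "x \<in> bounded_vectors \<Longrightarrow> matrix_coeffs x 0 = 0"
  by (rule ell2_eqI) (simp add: matrix_coeffs_coord zero_ell2.rep_eq)

lemma matrix_coeffs_sum_right:
  "x \<in> bounded_vectors \<Longrightarrow> matrix_coeffs x (\<Sum>v\<in>F. y v) = (\<Sum>v\<in>F. matrix_coeffs x (y v))"
  by (induction F rule: infinite_finite_induct) (simp_all add: matrix_coeffs_zero_right matrix_coeffs_add_right)

lemma norm_matrix_coeffs_le_iff:
  assumes "x \<in> bounded_vectors" "c \<ge> 0"
  shows "(norm (matrix_coeffs x y))\<^sup>2 \<le> c \<longleftrightarrow> (\<forall>F. finite F \<longrightarrow> (\<Sum>w\<in>F. (cmod (cinner (W w x) y))\<^sup>2) \<le> c)"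
  unfolding norm_ell2_le_iff[OF assms(2)] matrix_coeffs_coord[OF assms(1)] ..

lemma sum_le_norm_matrix_coeffs:
  "x \<in> bounded_vectors \<Longrightarrow> finite F \<Longrightarrow> (\<Sum>w\<in>F. (cmod (cinner (W w x) y))\<^sup>2) \<le> (norm (matrix_coeffs x y))\<^sup>2"
  using ell2_sum_le_norm[of F "matrix_coeffs x y"] by (simp add: matrix_coeffs_coord)

lemma cinner_le_norm_matrix_coeffs:
  "x \<in> bounded_vectors \<Longrightarrow> cmod (cinner (W w x) y) \<le> norm (matrix_coeffs x y)"
  using ell2_coord_le_norm[of "matrix_coeffs x y" w] by (simp add: matrix_coeffs_coord)

lemma matrix_coeffs_bounded:
  assumes "x \<in> bounded_vectors"
  obtains K where "K \<ge> 0" "\<And>y. norm (matrix_coeffs x y) \<le> K * norm y"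
proof -
  obtain K where K: "K \<ge> 0" "\<And>h F. finite F \<Longrightarrow> (\<Sum>w\<in>F. (cmod (cinner (W w x) h))\<^sup>2) \<le> K * (norm h)\<^sup>2"
    by (rule bounded_vectorsE[OF assms(1)]) blast
  have "norm (matrix_coeffs x y) \<le> sqrt K * norm y" for y
  proof -
    have "(norm (matrix_coeffs x y))\<^sup>2 \<le> K * (norm y)\<^sup>2"
      using K by (subst norm_matrix_coeffs_le_iff[OF assms]) auto
    then have "(norm (matrix_coeffs x y))\<^sup>2 \<le> (sqrt K * norm y)\<^sup>2" using K(1) by (simp add: power_mult_distrib)
    then show ?thesis by (rule power2_le_imp_le) (use K(1) in simp)
  qed
  then show thesis using that[of "sqrt K"] K(1) by simp
qed

lemma matrix_coeffs_tail:
  assumes "x \<in> bounded_vectors" "\<delta> > 0"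
  obtains L where "\<And>G. finite G \<Longrightarrow> (\<And>w. w \<in> G \<Longrightarrow> length w \<ge> L) \<Longrightarrow> (\<Sum>w\<in>G. (cmod (cinner (W w x) y))\<^sup>2) \<le> \<delta>"
proof -
  obtain F where F: "finite F" "\<And>G. finite G \<Longrightarrow> G \<inter> F = {} \<Longrightarrow> (\<Sum>w\<in>G. (cmod (cinner (W w x) y))\<^sup>2) \<le> \<delta>"
    using summable_on_tail[OF bounded_vectors_summable[OF assms(1), of y] _ assms(2)] by auto
  define L where "L = Suc (Max (insert 0 (length ` F)))"
  have "length w < L" if "w \<in> F" for w
    unfolding L_def using F(1) that by (intro le_imp_less_Suc Max_ge) auto
  then show thesis using that[of L] F(2) by (metis disjoint_iff leD)
qed

text \<open>Only coefficients at words of length at least that of \<open>u\<close> occur, so the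
  bound is a tail of a convergent sum, uniformly in \<open>u\<close>.\<close>

lemma norm_matrix_coeffs_W_left_tail:
  assumes "x \<in> bounded_vectors" "\<delta> > 0"
  obtains L where "\<And>u. length u \<ge> L \<Longrightarrow> (norm (matrix_coeffs (W u x) y))\<^sup>2 \<le> \<delta>"
proof -
  obtain L where L: "\<And>G. finite G \<Longrightarrow> (\<And>w. w \<in> G \<Longrightarrow> length w \<ge> L) \<Longrightarrow> (\<Sum>w\<in>G. (cmod (cinner (W w x) y))\<^sup>2) \<le> \<delta>"
    by (rule matrix_coeffs_tail[OF assms]) blast
  have "(norm (matrix_coeffs (W u x) y))\<^sup>2 \<le> \<delta>" if "length u \<ge> L" for u
    using assms(2) that
    by (subst norm_matrix_coeffs_le_iff[OF bounded_vectors_W[OF assms(1)]]) (auto simp: sum_W_shift intro!: L)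
  then show thesis using that by blast
qed

text \<open>Against \<open>S i y\<close> a word starting with \<open>i\<close> loses that letter and
  any other nonempty word contributes 0. The one new coefficient is at the empty word.\<close>

lemma norm_matrix_coeffs_S_right:
  assumes x: "x \<in> bounded_vectors"
  shows "(norm (matrix_coeffs x (S i y)))\<^sup>2 \<le> (cmod (cinner x (S i y)))\<^sup>2 + (norm (matrix_coeffs x y))\<^sup>2"
proof -
  let ?g = "\<lambda>w. (cmod (cinner (W w x) (S i y)))\<^sup>2"
  have "sum ?g F \<le> (cmod (cinner x (S i y)))\<^sup>2 + (norm (matrix_coeffs x y))\<^sup>2" if F: "finite F" for F
  proof -
    define H where "H = {v. i # v \<in> F}"
    have H: "finite H" unfolding H_def
      by (rule finite_subset[OF _ finite_imageI[OF F, of tl]]) (auto intro!: image_eqI[of _ tl "i # _"])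
    let ?G = "insert [] ((#) i ` H)"
    have "sum ?g F = sum ?g (F \<inter> ?G)"
    proof (rule sum.mono_neutral_right[OF F])
      show "\<forall>w\<in>F - F \<inter> ?G. ?g w = 0"
      proof
        fix w assume w: "w \<in> F - F \<inter> ?G"
        then obtain j v where jv: "w = j # v" by (cases w) auto
        then have "j \<noteq> i" using w by (auto simp: H_def)
        then show "?g w = 0" by (simp add: jv cinner_S)
      qed
    qed auto
    also have "\<dots> \<le> sum ?g ?G" using H by (intro sum_mono2) auto
    also have "\<dots> = (cmod (cinner x (S i y)))\<^sup>2 + (\<Sum>v\<in>H. (cmod (cinner (W v x) y))\<^sup>2)"
      using H by (subst sum.insert) (auto simp: sum.reindex cinner_S)
    also have "\<dots> \<le> (cmod (cinner x (S i y)))\<^sup>2 + (norm (matrix_coeffs x y))\<^sup>2"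
      using sum_le_norm_matrix_coeffs[OF x H] by simp
    finally show ?thesis .
  qed
  then show ?thesis by (subst norm_matrix_coeffs_le_iff[OF x]) auto
qed

lemma norm_matrix_coeffs_W_right:
  assumes x: "x \<in> bounded_vectors"
  shows "(norm (matrix_coeffs x (W u z)))\<^sup>2
    \<le> (\<Sum>k<length u. (cmod (cinner x (W (drop k u) z)))\<^sup>2) + (norm (matrix_coeffs x z))\<^sup>2"
proof (induction u)
  case (Cons i u)
  have "(norm (matrix_coeffs x (W (i # u) z)))\<^sup>2
      \<le> (cmod (cinner x (W (i # u) z)))\<^sup>2 + (norm (matrix_coeffs x (W u z)))\<^sup>2"
    using norm_matrix_coeffs_S_right[OF x, of i "W u z"] by simp
  also have "\<dots> \<le> (cmod (cinner x (W (i # u) z)))\<^sup>2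
      + ((\<Sum>k<length u. (cmod (cinner x (W (drop k u) z)))\<^sup>2) + (norm (matrix_coeffs x z))\<^sup>2)"
    using Cons by simp
  finally show ?case by (simp add: sum.lessThan_Suc_shift del: sum.lessThan_Suc)
qed simp

text \<open>The new coefficients pair \<open>x\<close> with suffixes of \<open>u\<close> applied to
  \<open>z\<close>. Distinct suffixes are distinct words, so they are bounded by the coefficients
  taken in the other order. The estimate is uniform in \<open>u\<close>, which is why smallness in
  both orders is sought below.\<close>

lemma norm_matrix_coeffs_W_right_le:
  assumes x: "x \<in> bounded_vectors" and z: "z \<in> bounded_vectors"
  shows "(norm (matrix_coeffs x (W u z)))\<^sup>2 \<le> (norm (matrix_coeffs z x))\<^sup>2 + (norm (matrix_coeffs x z))\<^sup>2"
proof -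
  have inj: "inj_on (\<lambda>k. drop k u) {..<length u}"
    by (rule inj_onI) (metis diff_diff_cancel length_drop lessThan_iff less_imp_le_nat)
  have "(\<Sum>k<length u. (cmod (cinner x (W (drop k u) z)))\<^sup>2) = (\<Sum>k<length u. (cmod (cinner (W (drop k u) z) x))\<^sup>2)"
    by (intro sum.cong refl) (metis cinner_cnj complex_mod_cnj)
  also have "\<dots> = (\<Sum>w\<in>(\<lambda>k. drop k u) ` {..<length u}. (cmod (cinner (W w z) x))\<^sup>2)"
    by (simp add: sum.reindex[OF inj])
  also have "\<dots> \<le> (norm (matrix_coeffs z x))\<^sup>2" by (intro sum_le_norm_matrix_coeffs z) simp
  finally show ?thesis using norm_matrix_coeffs_W_right[OF x, of u z] by linarith
qed

lemma cadjoint_W_Cons: "cadjoint (W (i # g)) x = cadjoint (W g) (cadjoint (S i) x)"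
  by (rule cinner_eqI) (simp add: cadjoint_works[symmetric] bounded_clinear_comp o_def)

lemma norm_cadjoint_W_le: "norm (cadjoint (W g) y) \<le> norm y"
proof -
  have "(norm (cadjoint (W g) y))\<^sup>2 = cmod (cinner (W g (cadjoint (W g) y)) y)"
    by (simp add: cadjoint_works cinner_self norm_power)
  also have "\<dots> \<le> norm (cadjoint (W g) y) * norm y"
    using norm_cinner_le[of "W g (cadjoint (W g) y)" y] by simp
  finally have "norm (cadjoint (W g) y) * norm (cadjoint (W g) y) \<le> norm (cadjoint (W g) y) * norm y"
    by (simp add: power2_eq_square)
  then show ?thesis by (cases "cadjoint (W g) y = 0") auto
qed

lemma cinner_W_same_length:
  "length u = length v \<Longrightarrow> cinner (W u x) (W v y) = (if u = v then cinner x y else 0)"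
  by (auto intro!: cinner_W_eq_0)

end

section \<open>Consequences of the absence of wandering vectors\<close>

locale isometries_without_wandering_vector = orthogonal_isometries S
  for S :: "'i::countable \<Rightarrow> 'a::complex_hilbert \<Rightarrow> 'a" +
  assumes no_wandering: "\<not> (\<exists>x. wandering S x)"
begin

text \<open>A nonzero vector orthogonal to the ranges of all generators would be wandering; the
  general length follows by peeling off first letters with adjoints.\<close>

lemma eq_0_if_orthogonal_to_word_ranges:
  "(\<And>g h. length g = L \<Longrightarrow> cinner y (W g h) = 0) \<Longrightarrow> y = 0"
proof (induction L arbitrary: y)
  case 0
  then have "cinner y (W [] y) = 0" by blast
  then show ?case by (simp add: cinner_self)
next
  case (Suc L)
  have "cadjoint (S i) y = 0" for i
  proof (rule Suc.IH)
    fix g h assume "length (g :: 'i list) = L"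
    then show "cinner (cadjoint (S i) y) (W g h) = 0"
      using Suc.prems[of "i # g" h] by (simp add: cinner_cadjoint_left)
  qed
  then have "cinner y (S i x) = 0" for i x
    using cinner_cadjoint_left[OF S_bounded, of i y x] by simp
  then show ?case using wandering_if_orthogonal_to_ranges no_wandering by blast
qed

text \<open>The ranges of the words of length \<open>L\<close> are mutually orthogonal and span a
  dense subspace. With infinitely many generators there are infinitely many such words, so a finite
  set captures the norm up to \<delta>.\<close>

lemma word_ranges_exhaust:
  assumes "\<delta> > 0"
  obtains F where "finite F" "\<And>g. g \<in> F \<Longrightarrow> length g = L"
    "(norm z)\<^sup>2 - \<delta> \<le> (\<Sum>g\<in>F. (norm (cadjoint (W g) z))\<^sup>2)"
proof -
  define M where "M = {v. \<exists>F h. finite F \<and> (\<forall>g\<in>F. length g = L) \<and> v = (\<Sum>g\<in>F. W g (h g))}"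
  have MI: "(\<Sum>g\<in>F. W g (h g)) \<in> M" if "finite F" "\<And>g. g \<in> F \<Longrightarrow> length g = L" for F h
    using that unfolding M_def by blast
  obtain e f where ef: "z = e + f" "e \<in> closure M" "\<And>y. y \<in> M \<Longrightarrow> cinner f y = 0"
  proof (rule orthogonal_decomposition[of M z])
    show "0 \<in> M" using MI[of "{}"] by simp
    show "c *\<^sub>C x \<in> M" if x: "x \<in> M" for c x
    proof -
      obtain F h where F: "finite F" "\<And>g. g \<in> F \<Longrightarrow> length g = L" "x = (\<Sum>g\<in>F. W g (h g))"
        using x unfolding M_def by blast
      then show ?thesis using MI[of F "\<lambda>g. c *\<^sub>C h g"] by (simp add: scaleC.sum_right bounded_clinear_scaleC)
    qed
    show "x + y \<in> M" if x: "x \<in> M" and y: "y \<in> M" for x y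
    proof -
      obtain F h where F: "finite F" "\<And>g. g \<in> F \<Longrightarrow> length g = L" "x = (\<Sum>g\<in>F. W g (h g))"
        using x unfolding M_def by blast
      obtain F' h' where F': "finite F'" "\<And>g. g \<in> F' \<Longrightarrow> length g = L" "y = (\<Sum>g\<in>F'. W g (h' g))"
        using y unfolding M_def by blast
      have 1: "(\<Sum>g\<in>F \<union> F'. W g (if g \<in> F then h g else 0)) = x"
        unfolding F(3) using F(1) F'(1) by (intro sum.mono_neutral_cong_right) (auto simp: bounded_clinear_zero)
      have 2: "(\<Sum>g\<in>F \<union> F'. W g (if g \<in> F' then h' g else 0)) = y"
        unfolding F'(3) using F(1) F'(1) by (intro sum.mono_neutral_cong_right) (auto simp: bounded_clinear_zero)
      have "(\<Sum>g\<in>F \<union> F'. W g ((if g \<in> F then h g else 0) + (if g \<in> F' then h' g else 0))) \<in> M"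
        using F F' by (intro MI) auto
      then show ?thesis by (simp add: bounded_clinear_add[OF W_bounded] sum.distrib 1 2)
    qed
  qed blast
  have "f = 0"
  proof (rule eq_0_if_orthogonal_to_word_ranges[of L])
    fix g h assume "length (g :: 'i list) = L"
    then show "cinner f (W g h) = 0" using ef(3) MI[of "{g}" "\<lambda>_. h"] by simp
  qed
  then have "z \<in> closure M" using ef by simp
  then obtain v where v: "v \<in> M" "dist v z < sqrt \<delta>"
    using assms closure_approachable[of z M] by (meson real_sqrt_gt_0_iff)
  then obtain F h where F: "finite F" "\<And>g. g \<in> F \<Longrightarrow> length g = L" "v = (\<Sum>g\<in>F. W g (h g))"
    unfolding M_def by blast
  have "(norm v)\<^sup>2 = (\<Sum>g\<in>F. (norm (W g (h g)))\<^sup>2)"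
    unfolding F(3) using F(1,2) by (intro norm_sq_sum_orthogonal) (auto simp: cinner_W_same_length)
  then have nv: "(norm v)\<^sup>2 = (\<Sum>g\<in>F. (norm (h g))\<^sup>2)" by simp
  have zv: "Re (cinner z v) = (\<Sum>g\<in>F. Re (cinner (cadjoint (W g) z) (h g)))"
    unfolding F(3) by (simp add: cinner.sum_right cinner_cadjoint_left)
  \<comment> \<open>Completing the square: over the words in \<open>F\<close>, the best coefficients
    for approximating \<open>z\<close> are the adjoint images of \<open>z\<close>.\<close>
  have "(norm (z - v))\<^sup>2 + (\<Sum>g\<in>F. (norm (cadjoint (W g) z))\<^sup>2)
      = (norm z)\<^sup>2 + (\<Sum>g\<in>F. (norm (cadjoint (W g) z - h g))\<^sup>2)"
    unfolding norm_sq_diff nv zv by (simp add: sum.distrib sum_subtractf sum_distrib_left algebra_simps)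
  moreover have "0 \<le> (\<Sum>g\<in>F. (norm (cadjoint (W g) z - h g))\<^sup>2)" by (intro sum_nonneg) simp
  moreover have "(norm (z - v))\<^sup>2 \<le> \<delta>"
  proof -
    have "norm (z - v) \<le> sqrt \<delta>" using v(2) by (simp add: dist_norm norm_minus_commute)
    then have "(norm (z - v))\<^sup>2 \<le> (sqrt \<delta>)\<^sup>2" by (intro power_mono) auto
    then show ?thesis using assms by simp
  qed
  ultimately show thesis using that[OF F(1,2)] by linarith
qed

text \<open>For bounded \<open>x\<close>, the vectors \<open>- p x\<close> with \<open>p\<close>
  proper approximate \<open>x\<close>. The adjoint of \<open>S i\<close> strips the first letters in
  \<open>p\<close>, so it sends \<open>- p x\<close> to a combination of vectors
  \<open>W v x\<close>, which are bounded.\<close>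

lemma cadjoint_S_closure_bounded_vectors:
  assumes "x \<in> closure bounded_vectors"
  shows "cadjoint (S i) x \<in> closure bounded_vectors"
proof -
  have Vb: "bounded_clinear (cadjoint (S i))" by (simp add: bounded_clinear_cadjoint)
  have *: "cadjoint (S i) x \<in> closure bounded_vectors" if x: "x \<in> bounded_vectors" for x
    unfolding closure_approachable
  proof (intro allI impI)
    fix e :: real assume e: "e > 0"
    have "\<exists>p\<in>proper_polys S. (norm (x + p x))\<^sup>2 < e\<^sup>2"
    proof (rule ccontr)
      assume "\<not> ?thesis"
      then have "\<And>p. p \<in> proper_polys S \<Longrightarrow> e\<^sup>2 \<le> (norm (x + p x))\<^sup>2" by force
      moreover have "e\<^sup>2 > 0" using e by simp
      ultimately show False using wandering_if_positive_distance no_wandering by blast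
    qed
    then obtain p where p: "p \<in> proper_polys S" "(norm (x + p x))\<^sup>2 < e\<^sup>2" by blast
    have "cadjoint (S i) (p x) \<in> bounded_vectors"
      using p(1)
    proof (induction rule: proper_polys.induct)
      case zero
      show ?case by (simp add: bounded_clinear_zero[OF Vb] zero_bounded)
    next
      case (add p w c)
      obtain j v where w: "w = j # v" using add.hyps by (cases w) auto
      have "cadjoint (S i) (W w x) \<in> bounded_vectors"
        unfolding cadjoint_S_W w using x by (simp add: bounded_vectors_W zero_bounded)
      then show ?case
        using add.IH by (simp add: bounded_clinear_add[OF Vb] bounded_clinear_scaleC[OF Vb] bounded_vectors_add bounded_vectors_scaleC)
    qed
    then have "- cadjoint (S i) (p x) \<in> bounded_vectors"
      using bounded_vectors_scaleC[of _ "-1"] by (simp add: scaleC_minus_one)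
    moreover have "dist (- cadjoint (S i) (p x)) (cadjoint (S i) x) < e"
    proof -
      have "dist (- cadjoint (S i) (p x)) (cadjoint (S i) x) = norm (cadjoint (S i) (x + p x))"
        by (simp add: dist_norm bounded_clinear_add[OF Vb] norm_minus_commute[of "- cadjoint (S i) (p x)"])
      also have "\<dots> \<le> norm (x + p x)" using norm_cadjoint_W_le[of "[i]" "x + p x"] by (simp add: o_def)
      also have "\<dots> < e" using p(2) e by (simp add: power_less_imp_less_base)
      finally show ?thesis .
    qed
    ultimately show "\<exists>y\<in>bounded_vectors. dist y (cadjoint (S i) x) < e" by blast
  qed
  obtain X where X: "\<And>n. X n \<in> bounded_vectors" "X \<longlonglongrightarrow> x"
    using assms unfolding closure_sequential by blast
  have "(\<lambda>n. cadjoint (S i) (X n)) \<longlonglongrightarrow> cadjoint (S i) x" by (rule bounded_clinear_tendsto[OF Vb X(2)])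
  then have "cadjoint (S i) x \<in> closure (closure bounded_vectors)"
    unfolding closure_sequential[of _ "closure bounded_vectors"] using *[OF X(1)]
    by (intro exI[of _ "\<lambda>n. cadjoint (S i) (X n)"]) simp
  then show ?thesis by simp
qed

lemma cadjoint_W_Nil: "cadjoint (W []) x = x"
  by (rule cinner_eqI) (simp add: cadjoint_works[OF bounded_clinear_id, symmetric])

lemma cadjoint_W_closure_bounded_vectors:
  "x \<in> closure bounded_vectors \<Longrightarrow> cadjoint (W g) x \<in> closure bounded_vectors"
proof (induction g arbitrary: x)
  case Nil
  then show ?case by (simp only: cadjoint_W_Nil)
qed (simp add: cadjoint_W_Cons cadjoint_S_closure_bounded_vectors del: word_op.simps)

text \<open>The coefficient at \<open>w\<close> against the adjoint image under \<open>W g\<close>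
  is the coefficient at \<open>g @ w\<close> against \<open>z\<close>. Since the \<open>g\<close>
  have equal length, all words \<open>g @ w\<close> are distinct, and they have length at least
  \<open>L\<close>.\<close>

lemma sum_norm_matrix_coeffs_cadjoint_le:
  assumes x: "x \<in> bounded_vectors" and F: "finite F" "\<And>g. g \<in> F \<Longrightarrow> length g = L"
    and tail: "\<And>G. finite G \<Longrightarrow> (\<And>w. w \<in> G \<Longrightarrow> length w \<ge> L) \<Longrightarrow> (\<Sum>w\<in>G. (cmod (cinner (W w x) z))\<^sup>2) \<le> \<delta>"
  shows "(\<Sum>g\<in>F. (norm (matrix_coeffs x (cadjoint (W g) z)))\<^sup>2) \<le> \<delta>"
proof -
  let ?f = "\<lambda>g w. (cmod (cinner (W w x) (cadjoint (W g) z)))\<^sup>2"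
  have "((\<lambda>G. \<Sum>g\<in>F. sum (?f g) G) \<longlongrightarrow> (\<Sum>g\<in>F. (norm (matrix_coeffs x (cadjoint (W g) z)))\<^sup>2))
      (finite_subsets_at_top UNIV)"
  proof (intro tendsto_sum)
    fix g
    have "(?f g has_sum (norm (matrix_coeffs x (cadjoint (W g) z)))\<^sup>2) UNIV"
      using has_sum_infsum[OF bounded_vectors_summable[OF x]]
      unfolding power2_norm_eq_inner[of "matrix_coeffs x (cadjoint (W g) z)"] inner_ell2_self matrix_coeffs_coord[OF x] .
    then show "(sum (?f g) \<longlongrightarrow> (norm (matrix_coeffs x (cadjoint (W g) z)))\<^sup>2) (finite_subsets_at_top UNIV)"
      unfolding has_sum_def .
  qed
  then show ?thesis
  proof (rule tendsto_upperbound)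
    show "\<forall>\<^sub>F G in finite_subsets_at_top UNIV. (\<Sum>g\<in>F. sum (?f g) G) \<le> \<delta>"
    proof (rule eventually_finite_subsets_at_top_weakI)
      fix G :: "'i list set" assume G: "finite G"
      have inj: "inj_on (\<lambda>(g, w). g @ w) (F \<times> G)"
        by (rule inj_onI) (use F(2) in \<open>auto simp: append_eq_append_conv\<close>)
      have "(\<Sum>g\<in>F. sum (?f g) G) = (\<Sum>(g, w)\<in>F \<times> G. (cmod (cinner (W (g @ w) x) z))\<^sup>2)"
        unfolding sum.cartesian_product by (intro sum.cong refl) (auto simp: cadjoint_works[symmetric] W_append)
      also have "\<dots> = (\<Sum>w\<in>(\<lambda>(g, w). g @ w) ` (F \<times> G). (cmod (cinner (W w x) z))\<^sup>2)"
        by (subst sum.reindex[OF inj]) (simp add: o_def split_def)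
      also have "\<dots> \<le> \<delta>" using F G by (intro tail) auto
      finally show "(\<Sum>g\<in>F. sum (?f g) G) \<le> \<delta>" .
    qed
  qed simp
qed

text \<open>If the coefficients were bounded below on the bounded vectors, they would be so on their
  closure, which is invariant under the backward shifts \<open>W g\<^sup>*\<close>; but these send the coefficients
  into the tail, while the \<open>W g\<^sup>* z\<close> for the words \<open>g\<close> of a given length keep the whole norm of \<open>z\<close>.\<close>

lemma exists_small_matrix_coeffs:
  fixes x :: "'k \<Rightarrow> 'a"
  assumes I: "finite I" and x: "\<And>i. i \<in> I \<Longrightarrow> x i \<in> bounded_vectors"
    and z0: "z0 \<in> bounded_vectors" "z0 \<noteq> 0" and \<epsilon>: "\<epsilon> > 0"
  obtains z where "z \<in> bounded_vectors" "norm z = 1" "(\<Sum>i\<in>I. (norm (matrix_coeffs (x i) z))\<^sup>2) \<le> \<epsilon>"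
proof (rule ccontr)
  note found = that
  assume c: "\<not> thesis"
  let ?q = "\<lambda>z. \<Sum>i\<in>I. (norm (matrix_coeffs (x i) z))\<^sup>2"
  have below: "\<epsilon> * (norm z)\<^sup>2 \<le> ?q z" if z: "z \<in> bounded_vectors" for z
  proof (cases "z = 0")
    case False
    let ?y = "of_real (1 / norm z) *\<^sub>C z"
    have "norm ?y = 1" using False by (simp add: norm_scaleC norm_divide)
    from found[OF bounded_vectors_scaleC[OF z] this] have "\<epsilon> < ?q ?y" using c by (meson not_le)
    also have "?q ?y = (1 / norm z)\<^sup>2 * ?q z"
      unfolding sum_distrib_left
      by (intro sum.cong refl) (simp add: matrix_coeffs_scaleC_right[OF x] norm_scaleC power_mult_distrib power_divide norm_divide)
    finally show ?thesis using False by (simp add: power_divide field_simps)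
  qed (simp add: sum_nonneg)
  have q_lim: "(\<lambda>n. ?q (X n)) \<longlonglongrightarrow> ?q z" if X: "X \<longlonglongrightarrow> z" for X z
  proof (intro tendsto_sum tendsto_power tendsto_norm)
    fix i assume i: "i \<in> I"
    obtain K where K: "K \<ge> 0" "\<And>y. norm (matrix_coeffs (x i) y) \<le> K * norm y"
      by (rule matrix_coeffs_bounded[OF x[OF i]]) blast
    have d: "matrix_coeffs (x i) (y - y') = matrix_coeffs (x i) y - matrix_coeffs (x i) y'" for y y'
      using matrix_coeffs_add_right[OF x[OF i], of "y - y'" y'] by (simp add: algebra_simps)
    have "(\<lambda>n. matrix_coeffs (x i) (X n) - matrix_coeffs (x i) z) \<longlonglongrightarrow> 0"
    proof (rule Lim_null_comparison)
      show "\<forall>\<^sub>F n in sequentially. norm (matrix_coeffs (x i) (X n) - matrix_coeffs (x i) z) \<le> K * norm (X n - z)"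
        using K(2) by (simp flip: d)
      have "(\<lambda>n. norm (X n - z)) \<longlonglongrightarrow> 0" using X by (simp add: LIM_zero tendsto_norm_zero)
      from tendsto_mult_left[OF this, of K] show "(\<lambda>n. K * norm (X n - z)) \<longlonglongrightarrow> 0" by simp
    qed
    then show "(\<lambda>n. matrix_coeffs (x i) (X n)) \<longlonglongrightarrow> matrix_coeffs (x i) z" by (rule LIM_zero_cancel)
  qed
  have below': "\<epsilon> * (norm z)\<^sup>2 \<le> ?q z" if z: "z \<in> closure bounded_vectors" for z
  proof -
    obtain X where X: "\<And>n. X n \<in> bounded_vectors" "X \<longlonglongrightarrow> z"
      using z unfolding closure_sequential by blast
    show ?thesis
    proof (rule LIMSEQ_le)
      show "(\<lambda>n. \<epsilon> * (norm (X n))\<^sup>2) \<longlonglongrightarrow> \<epsilon> * (norm z)\<^sup>2" by (intro tendsto_intros X)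
      show "(\<lambda>n. ?q (X n)) \<longlonglongrightarrow> ?q z" by (rule q_lim[OF X(2)])
    qed (use below X(1) in blast)
  qed
  \<comment> \<open>Makes the total over \<open>I\<close> at most a quarter of
    \<open>\<epsilon> * (norm z0)^2\<close>, against the lower bound of one half; the added 1 covers
    empty \<open>I\<close>.\<close>
  define \<delta> where "\<delta> = \<epsilon> * (norm z0)\<^sup>2 / (4 * (real (card I) + 1))"
  have nz: "(norm z0)\<^sup>2 > 0" using z0(2) by simp
  have \<delta>: "\<delta> > 0" unfolding \<delta>_def using \<epsilon> nz by (intro divide_pos_pos mult_pos_pos) auto
  have "\<forall>i\<in>I. \<exists>L. \<forall>G. finite G \<longrightarrow> (\<forall>w\<in>G. length w \<ge> L) \<longrightarrow> (\<Sum>w\<in>G. (cmod (cinner (W w (x i)) z0))\<^sup>2) \<le> \<delta>"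
  proof
    fix i assume "i \<in> I"
    from x[OF this] show "\<exists>L. \<forall>G. finite G \<longrightarrow> (\<forall>w\<in>G. length w \<ge> L) \<longrightarrow> (\<Sum>w\<in>G. (cmod (cinner (W w (x i)) z0))\<^sup>2) \<le> \<delta>"
      by (rule matrix_coeffs_tail[where y = z0, OF _ \<delta>]) blast
  qed
  from bchoice[OF this] obtain L where L: "\<forall>i\<in>I. \<forall>G. finite G \<longrightarrow> (\<forall>w\<in>G. length w \<ge> L i)
      \<longrightarrow> (\<Sum>w\<in>G. (cmod (cinner (W w (x i)) z0))\<^sup>2) \<le> \<delta>"
    by (elim exE)
  define N where "N = Max (insert 0 (L ` I))"
  have N: "L i \<le> N" if "i \<in> I" for i unfolding N_def using I that by (intro Max_ge) auto
  obtain F where F: "finite F" "\<And>g. g \<in> F \<Longrightarrow> length g = N"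
    "(norm z0)\<^sup>2 - (norm z0)\<^sup>2 / 2 \<le> (\<Sum>g\<in>F. (norm (cadjoint (W g) z0))\<^sup>2)"
    by (rule word_ranges_exhaust[of "(norm z0)\<^sup>2 / 2" N z0]) (use nz in auto)
  have cl: "z0 \<in> closure bounded_vectors" using z0(1) closure_subset by blast
  have "\<epsilon> * ((norm z0)\<^sup>2 / 2) \<le> \<epsilon> * (\<Sum>g\<in>F. (norm (cadjoint (W g) z0))\<^sup>2)"
    using F(3) \<epsilon> by (intro mult_left_mono) auto
  also have "\<dots> \<le> (\<Sum>g\<in>F. ?q (cadjoint (W g) z0))"
    unfolding sum_distrib_left by (intro sum_mono below' cadjoint_W_closure_bounded_vectors cl)
  also have "\<dots> = (\<Sum>i\<in>I. \<Sum>g\<in>F. (norm (matrix_coeffs (x i) (cadjoint (W g) z0)))\<^sup>2)"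
    by (rule sum.swap)
  also have "\<dots> \<le> (\<Sum>i\<in>I. \<delta>)"
  proof (rule sum_mono)
    fix i assume i: "i \<in> I"
    show "(\<Sum>g\<in>F. (norm (matrix_coeffs (x i) (cadjoint (W g) z0)))\<^sup>2) \<le> \<delta>"
    proof (rule sum_norm_matrix_coeffs_cadjoint_le[OF x[OF i] F(1,2)])
      fix G :: "'i list set" assume "finite G" "\<And>w. w \<in> G \<Longrightarrow> N \<le> length w"
      then show "(\<Sum>w\<in>G. (cmod (cinner (W w (x i)) z0))\<^sup>2) \<le> \<delta>"
        using N[OF i] by (intro L[rule_format, OF i]) (auto intro: order_trans)
    qed
  qed
  also have "\<dots> \<le> (real (card I) + 1) * \<delta>" using \<delta> by (simp add: distrib_right)
  also have "\<dots> = \<epsilon> * (norm z0)\<^sup>2 / 4" by (simp add: \<delta>_def field_simps)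
  finally show False using \<epsilon> nz by simp
qed

end

section \<open>Averaging over words in two letters\<close>

definition two_letter_words :: "'i \<Rightarrow> 'i \<Rightarrow> nat \<Rightarrow> 'i list set" where
  "two_letter_words a b k = {u. set u \<subseteq> {a, b} \<and> length u = k}"

lemma finite_two_letter_words [simp]: "finite (two_letter_words a b k)"
  unfolding two_letter_words_def by (rule finite_lists_length_eq) simp

lemma sum_two_letter_words_Suc:
  fixes f :: "'i list \<Rightarrow> real"
  assumes "a \<noteq> b"
  shows "(\<Sum>u\<in>two_letter_words a b (Suc k). f u) = (\<Sum>u\<in>two_letter_words a b k. f (a # u) + f (b # u))"
proof -
  have "two_letter_words a b (Suc k) = (#) a ` two_letter_words a b k \<union> (#) b ` two_letter_words a b k"
  proof (intro equalityI subsetI)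
    fix u assume "u \<in> two_letter_words a b (Suc k)"
    then show "u \<in> (#) a ` two_letter_words a b k \<union> (#) b ` two_letter_words a b k"
      by (cases u) (auto simp: two_letter_words_def)
  qed (auto simp: two_letter_words_def)
  then have "(\<Sum>u\<in>two_letter_words a b (Suc k). f u)
      = sum f ((#) a ` two_letter_words a b k) + sum f ((#) b ` two_letter_words a b k)"
    using assms by (simp only:, subst sum.union_disjoint) auto
  then show ?thesis by (simp add: sum.reindex sum.distrib)
qed

lemma two_letter_words_0: "two_letter_words a b 0 = {[]}"
  by (auto simp: two_letter_words_def)

lemma sum_two_letter_words_const:
  "a \<noteq> b \<Longrightarrow> (\<Sum>u\<in>two_letter_words a b k. c) = 2 ^ k * (c::real)"
proof (induction k arbitrary: c)
  case (Suc k)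
  show ?case using Suc.IH[OF Suc.prems, of "c + c"] by (subst sum_two_letter_words_Suc[OF Suc.prems]) simp
qed (simp add: two_letter_words_0)

text \<open>Average over the \<open>2^k\<close> words of length \<open>k\<close>. A given word of
  length \<open>l\<close> is a suffix of a fraction \<open>2^-l\<close> of them, so suffixes of
  length \<open>l\<close> contribute at most \<open>B / 2^l\<close> on average. Lengths beyond
  \<open>m\<close> give at most \<open>B / 2^m\<close>, and shorter ones at most \<tau> each. Two
  letters keep the average finite and still provide the exponential gain.\<close>

lemma exists_word_with_small_suffixes:
  fixes f :: "'i list \<Rightarrow> real"
  assumes ab: "a \<noteq> b" and B0: "B \<ge> 0" and B: "\<And>l. (\<Sum>u\<in>two_letter_words a b l. f u) \<le> B"
    and small: "\<And>u. set u \<subseteq> {a, b} \<Longrightarrow> length u \<le> m \<Longrightarrow> f u \<le> \<tau>" and k: "m \<le> k"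
  obtains u where "length u = k" "(\<Sum>j<length u. f (drop j u)) \<le> m * \<tau> + B / 2 ^ m"
proof -
  let ?g = "\<lambda>u. \<Sum>j<length u. f (drop j u)"
  let ?G = "\<lambda>k. \<Sum>u\<in>two_letter_words a b k. ?g u"
  have rec: "?G (Suc k) = (\<Sum>u\<in>two_letter_words a b (Suc k). f u) + 2 * ?G k" for k
  proof -
    have gC: "?g (i # u) = f (i # u) + ?g u" for i u
      by (simp add: sum.lessThan_Suc_shift del: sum.lessThan_Suc)
    show ?thesis
      unfolding sum_two_letter_words_Suc[OF ab] gC by (simp add: sum.distrib sum_distrib_left)
  qed
  have 1: "?G k \<le> 2 ^ k * (k * \<tau>)" if "k \<le> m" for k
    using that
  proof (induction k)
    case (Suc k)
    have "(\<Sum>u\<in>two_letter_words a b (Suc k). f u) \<le> (\<Sum>u\<in>two_letter_words a b (Suc k). \<tau>)"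
      using Suc.prems by (intro sum_mono small) (auto simp: two_letter_words_def)
    also have "\<dots> = 2 ^ Suc k * \<tau>" by (rule sum_two_letter_words_const[OF ab])
    finally show ?case unfolding rec using Suc by (simp add: algebra_simps)
  qed (simp add: two_letter_words_0)
  define c where "c = m * \<tau> + B / 2 ^ m"
  \<comment> \<open>The term \<open>- B\<close> closes the induction: each step doubles it and adds
    at most \<open>B\<close>.\<close>
  have 2: "?G k \<le> 2 ^ k * c - B" if "m \<le> k" for k
    using that
  proof (induction k rule: dec_induct)
    case base
    show ?case using 1[of m] by (simp add: c_def distrib_left)
  next
    case (step k)
    then show ?case unfolding rec power_Suc mult.assoc using B[of "Suc k"] by linarith
  qed
  have "\<exists>u\<in>two_letter_words a b k. ?g u \<le> m * \<tau> + B / 2 ^ m"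
  proof (rule ccontr)
    assume "\<not> ?thesis"
    moreover have "replicate k a \<in> two_letter_words a b k" by (auto simp: two_letter_words_def)
    ultimately have "(\<Sum>u\<in>two_letter_words a b k. m * \<tau> + B / 2 ^ m) < ?G k"
      by (intro sum_strict_mono) auto
    then have "2 ^ k * (m * \<tau> + B / 2 ^ m) < ?G k" unfolding sum_two_letter_words_const[OF ab] .
    then show False using 2[OF k] B0 unfolding c_def by linarith
  qed
  then show thesis using that by (auto simp: two_letter_words_def)
qed

context isometries_without_wandering_vector
begin

text \<open>A long word \<open>u\<close> makes the coefficients of \<open>W u z\<close> against
  \<open>x\<close> small, but in the other order it adds the pairings of \<open>x\<close> with
  suffixes of \<open>u\<close>. Short suffixes are moved to \<open>x\<close> by adjoints, where
  \<open>z\<close> was chosen small against bounded approximations; long ones are controlled by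
  averaging over \<open>u\<close>.\<close>

lemma exists_mutually_small_matrix_coeffs:
  fixes a b :: 'i
  assumes ab: "a \<noteq> b" and x: "x \<in> bounded_vectors"
    and z0: "z0 \<in> bounded_vectors" "z0 \<noteq> 0" and \<epsilon>: "\<epsilon> > 0"
  obtains z where "z \<in> bounded_vectors" "norm z = 1"
    "(norm (matrix_coeffs x z))\<^sup>2 \<le> \<epsilon>" "(norm (matrix_coeffs z x))\<^sup>2 \<le> \<epsilon>"
proof -
  obtain m where m: "(norm x)\<^sup>2 / 2 ^ m \<le> \<epsilon> / 4"
  proof -
    have "(\<lambda>m. (norm x)\<^sup>2 * (1 / 2) ^ m) \<longlonglongrightarrow> (norm x)\<^sup>2 * 0"
      by (intro tendsto_intros LIMSEQ_power_zero) simp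
    then have "\<forall>\<^sub>F m in sequentially. (norm x)\<^sup>2 * (1 / 2) ^ m < \<epsilon> / 4"
      using \<epsilon> by (intro order_tendstoD) auto
    then obtain m where "(norm x)\<^sup>2 * (1 / 2) ^ m < \<epsilon> / 4" by (auto simp: eventually_sequentially)
    then show thesis using that[of m] by (simp add: power_one_over)
  qed
  \<comment> \<open>Pairings with short suffixes are at most \<open>2 * sqrt \<eta>\<close>, so
    \<open>m\<close> squared ones cost at most a quarter of \<epsilon>. The long suffixes and
    \<open>\<eta>\<close> itself take a further quarter each.\<close>
  define \<eta> where "\<eta> = \<epsilon> / (16 * (real m + 1))"
  have \<eta>: "\<eta> > 0" using \<epsilon> by (simp add: \<eta>_def)
  have \<eta>m: "m * (4 * \<eta>) \<le> \<epsilon> / 4" "\<eta> \<le> \<epsilon> / 4"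
    using \<epsilon> by (simp_all add: \<eta>_def field_simps)
  define I where "I = {s. set s \<subseteq> {a, b} \<and> length s \<le> m}"
  have I: "finite I" unfolding I_def by (rule finite_lists_length_le) simp
  have "\<forall>s. \<exists>p. p \<in> bounded_vectors \<and> dist p (cadjoint (W s) x) < sqrt \<eta>"
  proof
    fix s
    have "x \<in> closure bounded_vectors" using x closure_subset by blast
    then have "\<forall>e>0. \<exists>p\<in>bounded_vectors. dist p (cadjoint (W s) x) < e"
      using cadjoint_W_closure_bounded_vectors unfolding closure_approachable[symmetric] by blast
    then show "\<exists>p. p \<in> bounded_vectors \<and> dist p (cadjoint (W s) x) < sqrt \<eta>"
      using \<eta> real_sqrt_gt_0_iff by blast
  qed
  from choice[OF this] obtain p' where p': "\<And>s. p' s \<in> bounded_vectors"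
    "\<And>s. dist (p' s) (cadjoint (W s) x) < sqrt \<eta>" by blast
  \<comment> \<open>At the empty word \<open>x\<close> itself is kept, so the choice of
    \<open>z\<close> also controls \<open>matrix_coeffs x z\<close>.\<close>
  define p where "p s = (if s = [] then x else p' s)" for s
  have p: "p s \<in> bounded_vectors" for s using p'(1) x by (simp add: p_def)
  have pd: "norm (cadjoint (W s) x - p s) \<le> sqrt \<eta>" for s
    using p'(2)[of s] cadjoint_W_Nil[of x] \<eta> by (auto simp: p_def dist_norm norm_minus_commute simp del: word_op.simps)
  obtain z where z: "z \<in> bounded_vectors" "norm z = 1" "(\<Sum>s\<in>I. (norm (matrix_coeffs (p s) z))\<^sup>2) \<le> \<eta>"
    by (rule exists_small_matrix_coeffs[where x = p, OF I p z0 \<eta>]) blast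
  have sz: "(norm (matrix_coeffs (p s) z))\<^sup>2 \<le> \<eta>" if "s \<in> I" for s
    using member_le_sum[of s I "\<lambda>s. (norm (matrix_coeffs (p s) z))\<^sup>2"] that I z(3) by simp
  have xz: "(norm (matrix_coeffs x z))\<^sup>2 \<le> \<eta>" using sz[of "[]"] by (simp add: I_def p_def)
  have small: "(cmod (cinner x (W s z)))\<^sup>2 \<le> 4 * \<eta>" if s: "s \<in> I" for s
  proof -
    have "cinner x (W s z) = cinner (p s) z + cinner (cadjoint (W s) x - p s) z"
      by (simp add: cinner.diff_left cinner_cadjoint_left)
    then have "cmod (cinner x (W s z)) \<le> cmod (cinner (p s) z) + cmod (cinner (cadjoint (W s) x - p s) z)"
      by (simp add: norm_triangle_ineq)
    also have "cmod (cinner (p s) z) \<le> sqrt \<eta>"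
      using cinner_le_norm_matrix_coeffs[OF p, of "[]" s z] real_le_rsqrt[OF sz[OF s]] by simp
    also have "cmod (cinner (cadjoint (W s) x - p s) z) \<le> sqrt \<eta>"
      using norm_cinner_le[of "cadjoint (W s) x - p s" z] pd[of s] z(2) by simp
    finally have "cmod (cinner x (W s z)) \<le> 2 * sqrt \<eta>" by simp
    then have "(cmod (cinner x (W s z)))\<^sup>2 \<le> (2 * sqrt \<eta>)\<^sup>2" by (intro power_mono) auto
    then show ?thesis using \<eta> by (simp add: power_mult_distrib)
  qed
  obtain L where L: "\<And>u. length u \<ge> L \<Longrightarrow> (norm (matrix_coeffs (W u z) x))\<^sup>2 \<le> \<epsilon>"
    by (rule norm_matrix_coeffs_W_left_tail[OF z(1) \<epsilon>]) blast
  have B: "(\<Sum>u\<in>two_letter_words a b l. (cmod (cinner x (W u z)))\<^sup>2) \<le> (norm x)\<^sup>2" for l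
    by (rule bessel_inequality[OF finite_two_letter_words])
      (use z(2) in \<open>auto simp: two_letter_words_def cinner_W_same_length cinner_self\<close>)
  obtain u where u: "length u = max m L"
    "(\<Sum>j<length u. (cmod (cinner x (W (drop j u) z)))\<^sup>2) \<le> m * (4 * \<eta>) + (norm x)\<^sup>2 / 2 ^ m"
    by (rule exists_word_with_small_suffixes[OF ab _ B, of m "4 * \<eta>" "max m L"])
      (auto simp: I_def intro!: small)
  show thesis
  proof
    show "W u z \<in> bounded_vectors" by (rule bounded_vectors_W[OF z(1)])
    show "norm (W u z) = 1" using z(2) by simp
    show "(norm (matrix_coeffs (W u z) x))\<^sup>2 \<le> \<epsilon>" using u(1) by (intro L) simp
    show "(norm (matrix_coeffs x (W u z)))\<^sup>2 \<le> \<epsilon>"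
      using norm_matrix_coeffs_W_right[OF x, of u z] u(2) xz \<eta>m m \<epsilon> by linarith
  qed
qed

end

section \<open>Successive approximation of the vacuum coefficient\<close>

instance complex_hilbert \<subseteq> banach ..

text \<open>Overlapping occurrences would put the initial \<open>a\<close> of one onto a
  \<open>b\<close> of the other.\<close>

lemma unbordered_overlap:
  assumes "a \<noteq> b" and eq: "r @ (a # replicate K b) = (a # replicate K b) @ t" and r: "r \<noteq> []"
  shows "\<exists>t'. r = (a # replicate K b) @ t'"
proof (cases "length r \<le> K")
  case True
  let ?u = "a # replicate K b"
  have "(r @ ?u) ! length r = a" by (simp add: nth_append)
  moreover have "(?u @ t) ! length r = ?u ! length r" using True by (subst nth_append) simp
  moreover have "?u ! length r = b" using r True by (cases r) auto
  ultimately show ?thesis using assms(1) eq by metis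
next
  case False
  then have "take (length (a # replicate K b)) r = take (length (a # replicate K b)) (r @ (a # replicate K b))" by simp
  also have "\<dots> = a # replicate K b" unfolding eq by simp
  finally show ?thesis by (metis append_take_drop_id)
qed

context orthogonal_isometries
begin

text \<open>Nonvanishing forces comparable words, hence two occurrences of the unbordered block at
  different positions. These are disjoint, and \<open>length v \<le> K\<close> leaves no room for a
  block inside \<open>v\<close>.\<close>

lemma cinner_W_unbordered:
  assumes ab: "a \<noteq> b" and v: "length v \<le> K" and wv: "w \<noteq> v"
    and ne: "cinner (W (w @ a # replicate K b) x) (W (v @ a # replicate K b) y) \<noteq> 0"
  shows "\<exists>t. w = v @ (a # replicate K b) @ t"
proof -
  let ?u = "a # replicate K b"
  have "(\<exists>t. w @ ?u = (v @ ?u) @ t) \<or> (\<exists>t. v @ ?u = (w @ ?u) @ t)"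
    using ne cinner_W_eq_0[of "w @ ?u" "v @ ?u"] by blast
  then show ?thesis
  proof (elim disjE exE)
    fix t assume e: "w @ ?u = (v @ ?u) @ t"
    have "length w = length v + length t" using arg_cong[OF e, of length] by simp
    then have "take (length v) w = v" using arg_cong[OF e, of "take (length v)"] by simp
    then obtain r where r: "w = v @ r" by (metis append_take_drop_id)
    then have "r @ ?u = ?u @ t" "r \<noteq> []" using e wv by auto
    from unbordered_overlap[OF ab this] show ?thesis using r by auto
  next
    fix t assume e: "v @ ?u = (w @ ?u) @ t"
    have "length v = length w + length t" using arg_cong[OF e, of length] by simp
    then have "take (length w) v = w" using arg_cong[OF e, of "take (length w)"] by simp
    then obtain r where r: "v = w @ r" by (metis append_take_drop_id)
    then have "r @ ?u = ?u @ t" "r \<noteq> []" using e wv by auto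
    from unbordered_overlap[OF ab this] have "length r > K" by auto
    then show ?thesis using r v by simp
  qed
qed

lemma orthonormal_unbordered_translates:
  assumes ab: "a \<noteq> b" and v: "length v \<le> K" "length w \<le> K" "v \<noteq> w"
  shows "cinner (W w (W (a # replicate K b) x)) (W v (W (a # replicate K b) y)) = 0"
proof (rule ccontr)
  assume "cinner (W w (W (a # replicate K b) x)) (W v (W (a # replicate K b) y)) \<noteq> 0"
  then have "cinner (W (w @ a # replicate K b) x) (W (v @ a # replicate K b) y) \<noteq> 0"
    by (simp only: W_append not_False_eq_True)
  from cinner_W_unbordered[OF ab v(1) _ this] v show False by auto
qed

text \<open>The coefficient at \<open>v\<close> is 1. Any other nonzero coefficient sits at
  \<open>v\<close> followed by the block and some \<open>t\<close>, where cancellation leaves the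
  coefficient at \<open>t\<close> of the pair on the right-hand side.\<close>

lemma norm_matrix_coeffs_unbordered:
  assumes ab: "a \<noteq> b" and z: "z \<in> bounded_vectors" "norm z = 1" and v: "length v \<le> K"
  shows "norm (matrix_coeffs (W (a # replicate K b) z) (W v (W (a # replicate K b) z)) - ket v)
    \<le> norm (matrix_coeffs (W (a # replicate K b) z) z)"
proof -
  let ?u = "a # replicate K b"
  have uz: "W ?u z \<in> bounded_vectors" by (rule bounded_vectors_W[OF z(1)])
  define D where "D = matrix_coeffs (W ?u z) (W v (W ?u z)) - ket v"
  have D: "ell2_coord D w = (if w = v then 0 else cinner (W (w @ ?u) z) (W (v @ ?u) z))" for w
    using z(2) by (simp add: D_def minus_ell2.rep_eq matrix_coeffs_coord[OF uz] ket.rep_eq cinner_self W_append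
        del: word_op.simps)
  have "(norm D)\<^sup>2 \<le> (norm (matrix_coeffs (W ?u z) z))\<^sup>2"
    unfolding norm_ell2_le_iff[OF zero_le_power2]
  proof (intro allI impI)
    fix G :: "'i list set" assume G: "finite G"
    let ?p = "v @ ?u"
    define H where "H = {t. ?p @ t \<in> G}"
    have "finite ((@) ?p -` G)" by (rule finite_vimageI[OF G]) (simp add: inj_def)
    then have H: "finite H" by (simp only: H_def vimage_def)
    have "(\<Sum>w\<in>G. (cmod (ell2_coord D w))\<^sup>2) = (\<Sum>w\<in>(@) ?p ` H. (cmod (ell2_coord D w))\<^sup>2)"
    proof (rule sum.mono_neutral_right[OF G])
      show "(@) ?p ` H \<subseteq> G" by (auto simp: H_def)
      show "\<forall>w\<in>G - (@) ?p ` H. (cmod (ell2_coord D w))\<^sup>2 = 0"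
      proof
        fix w assume w: "w \<in> G - (@) ?p ` H"
        show "(cmod (ell2_coord D w))\<^sup>2 = 0"
        proof (rule ccontr)
          assume "(cmod (ell2_coord D w))\<^sup>2 \<noteq> 0"
          then have "w \<noteq> v" "cinner (W (w @ ?u) z) (W (v @ ?u) z) \<noteq> 0" by (auto simp: D split: if_splits)
          from cinner_W_unbordered[OF ab v this] obtain t where "w = ?p @ t" by auto
          with w show False by (auto simp: H_def)
        qed
      qed
    qed
    also have "\<dots> = (\<Sum>t\<in>H. (cmod (ell2_coord D (?p @ t)))\<^sup>2)"
      by (subst sum.reindex) (auto simp: inj_on_def)
    also have "\<dots> = (\<Sum>t\<in>H. (cmod (cinner (W t (W ?u z)) z))\<^sup>2)"
    proof (intro sum.cong refl)
      fix t
      have "(?p @ t) @ ?u = ?p @ (t @ ?u)" by simp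
      then have "cinner (W ((?p @ t) @ ?u) z) (W ?p z) = cinner (W (t @ ?u) z) z"
        by (simp only: cinner_W_append)
      then show "(cmod (ell2_coord D (?p @ t)))\<^sup>2 = (cmod (cinner (W t (W ?u z)) z))\<^sup>2"
        unfolding D by (simp add: W_append del: word_op.simps append_Cons)
    qed
    also have "\<dots> \<le> (norm (matrix_coeffs (W ?u z) z))\<^sup>2" by (rule sum_le_norm_matrix_coeffs[OF uz H])
    finally show "(\<Sum>w\<in>G. (cmod (ell2_coord D w))\<^sup>2) \<le> (norm (matrix_coeffs (W ?u z) z))\<^sup>2" .
  qed
  then show ?thesis unfolding D_def by (rule power2_le_imp_le) simp
qed

end

context isometries_without_wandering_vector
begin

text \<open>Write \<open>f\<close> for a finitely supported approximation of the error. With \<open>x' = \<surd>\<beta> W u z\<close> and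
  \<open>y' = (1/\<surd>\<beta>) \<Sum> cnj (f v) W v (W u z)\<close>, where \<open>u\<close> is a long unbordered word, the coefficients of
  \<open>(x', y')\<close> are close to \<open>f\<close> and both cross terms are small by the choice of \<open>z\<close>.\<close>

lemma matrix_coeffs_correction:
  fixes a b :: 'i
  assumes ab: "a \<noteq> b" and z0: "z0 \<in> bounded_vectors" "z0 \<noteq> 0"
    and x: "x \<in> bounded_vectors" and \<beta>: "\<beta> > 0" and err: "norm (g - matrix_coeffs x y) \<le> \<beta>"
  obtains x' y' where "x + x' \<in> bounded_vectors" "(norm x')\<^sup>2 \<le> \<beta>" "(norm y')\<^sup>2 \<le> \<beta>"
    "norm (g - matrix_coeffs (x + x') (y + y')) \<le> \<beta> / 4"
proof -
  define e where "e = g - matrix_coeffs x y"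
  define f where "f = ell2_coord e"
  obtain F where F: "finite F" "norm (e - (\<Sum>v\<in>F. f v *\<^sub>C ket v)) \<le> \<beta> / 16"
    using ell2_finite_approximation[of "\<beta> / 16" e] \<beta> unfolding f_def by auto
  define N where "N = (\<Sum>v\<in>F. cmod (f v)) + 1"
  have N: "N > 0" "(\<Sum>v\<in>F. cmod (f v)) \<le> N" by (simp_all add: N_def sum_nonneg add_nonneg_pos)
  have fF: "(\<Sum>v\<in>F. (cmod (f v))\<^sup>2) \<le> \<beta>\<^sup>2"
    using ell2_sum_le_norm[OF F(1), of e] power_mono[OF err norm_ge_zero, of 2] unfolding f_def e_def by linarith
  \<comment> \<open>After summation against the coefficients of \<open>f\<close> and the factor
    \<open>1 / sqrt \<beta>\<close> in \<open>y'\<close>, this leaves \<beta>/16. The constants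
    \<nu> and \<rho> are chosen likewise; with the truncation of \<open>e\<close> there are four
    errors of this size.\<close>
  define \<kappa> where "\<kappa> = \<beta> * sqrt \<beta> / (16 * N)"
  have \<kappa>: "\<kappa> > 0" using \<beta> N by (simp add: \<kappa>_def)
  obtain z where z: "z \<in> bounded_vectors" "norm z = 1"
    "(norm (matrix_coeffs x z))\<^sup>2 \<le> \<kappa>\<^sup>2 / 2" "(norm (matrix_coeffs z x))\<^sup>2 \<le> \<kappa>\<^sup>2 / 2"
    by (rule exists_mutually_small_matrix_coeffs[OF ab x z0, of "\<kappa>\<^sup>2 / 2"]) (use \<kappa> in auto)
  define \<nu> where "\<nu> = \<beta> / (16 * N)"
  define \<rho> where "\<rho> = sqrt \<beta> / 16"
  have \<nu>\<rho>: "\<nu> > 0" "\<rho> > 0" using \<beta> N by (simp_all add: \<nu>_def \<rho>_def)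
  obtain L1 where L1: "\<And>u. length u \<ge> L1 \<Longrightarrow> (norm (matrix_coeffs (W u z) z))\<^sup>2 \<le> \<nu>\<^sup>2"
    by (rule norm_matrix_coeffs_W_left_tail[OF z(1), of "\<nu>\<^sup>2" z]) (use \<nu>\<rho> in auto)
  obtain L2 where L2: "\<And>u. length u \<ge> L2 \<Longrightarrow> (norm (matrix_coeffs (W u z) y))\<^sup>2 \<le> \<rho>\<^sup>2"
    by (rule norm_matrix_coeffs_W_left_tail[OF z(1), of "\<rho>\<^sup>2" y]) (use \<nu>\<rho> in auto)
  \<comment> \<open>Long enough for both tail estimates on \<open>u\<close>, and at least the length
    of every word in \<open>F\<close>, so that the translates \<open>v @ u\<close> act with
    orthogonal ranges.\<close>
  define K where "K = Max (insert L1 (insert L2 (length ` F)))"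
  have K: "L1 \<le> K" "L2 \<le> K" "\<And>v. v \<in> F \<Longrightarrow> length v \<le> K"
    unfolding K_def using F(1) by (auto intro!: Max_ge simp del: Max_insert)
  define u where "u = a # replicate K b"
  have lu: "length u = Suc K" by (simp add: u_def)
  have uz: "W u z \<in> bounded_vectors" by (rule bounded_vectors_W[OF z(1)])
  have nu1: "norm (matrix_coeffs (W u z) z) \<le> \<nu>"
    by (rule power2_le_imp_le[OF L1]) (use K lu \<nu>\<rho> in auto)
  have nu2: "norm (matrix_coeffs (W u z) y) \<le> \<rho>"
    by (rule power2_le_imp_le[OF L2]) (use K lu \<nu>\<rho> in auto)
  define h where "h = (\<Sum>v\<in>F. cnj (f v) *\<^sub>C W v (W u z))"
  define x' where "x' = of_real (sqrt \<beta>) *\<^sub>C W u z"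
  define y' where "y' = of_real (1 / sqrt \<beta>) *\<^sub>C h"
  have sb: "sqrt \<beta> > 0" using \<beta> by simp
  have x'L: "x' \<in> bounded_vectors" unfolding x'_def by (rule bounded_vectors_scaleC[OF uz])
  have "(norm h)\<^sup>2 = (\<Sum>v\<in>F. (norm (cnj (f v) *\<^sub>C W v (W u z)))\<^sup>2)"
    unfolding h_def
  proof (rule norm_sq_sum_orthogonal[OF F(1)])
    fix v w assume "v \<in> F" "w \<in> F" "v \<noteq> w"
    then show "cinner (cnj (f v) *\<^sub>C W v (W u z)) (cnj (f w) *\<^sub>C W w (W u z)) = 0"
      using orthonormal_unbordered_translates[OF ab K(3) K(3), of w v z z]
      by (simp add: cinner_scaleC_left cinner_scaleC_right u_def del: word_op.simps)
  qed
  also have "\<dots> = (\<Sum>v\<in>F. (cmod (f v))\<^sup>2)" using z(2) by (simp add: norm_scaleC)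
  finally have nh: "(norm h)\<^sup>2 \<le> \<beta>\<^sup>2" using fF by simp
  have r1: "norm (matrix_coeffs x y') \<le> \<beta> / 16"
  proof -
    have "norm (matrix_coeffs x (W v (W u z))) \<le> \<kappa>" for v
    proof -
      have "(norm (matrix_coeffs x (W (v @ u) z)))\<^sup>2 \<le> \<kappa>\<^sup>2"
        using norm_matrix_coeffs_W_right_le[OF x z(1), of "v @ u"] z(3,4) by linarith
      then have "norm (matrix_coeffs x (W (v @ u) z)) \<le> \<kappa>" by (rule power2_le_imp_le) (use \<kappa> in simp)
      then show ?thesis by (simp add: W_append)
    qed
    then have "norm (matrix_coeffs x h) \<le> (\<Sum>v\<in>F. cmod (f v) * \<kappa>)"
      unfolding h_def matrix_coeffs_sum_right[OF x]
      by (intro sum_norm_le) (simp add: matrix_coeffs_scaleC_right[OF x] norm_scaleC mult_left_mono)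
    also have "\<dots> \<le> N * \<kappa>" unfolding sum_distrib_right[symmetric] using N \<kappa> by (intro mult_right_mono) auto
    finally have "norm (matrix_coeffs x h) \<le> \<beta> * sqrt \<beta> / 16" using N by (simp add: \<kappa>_def)
    then have "(1 / sqrt \<beta>) * norm (matrix_coeffs x h) \<le> (1 / sqrt \<beta>) * (\<beta> * sqrt \<beta> / 16)"
      using sb by (intro mult_left_mono) auto
    then show ?thesis using sb \<beta>
      by (simp add: y'_def matrix_coeffs_scaleC_right[OF x] norm_scaleC norm_divide)
  qed
  have r2: "norm (matrix_coeffs x' y) \<le> \<beta> / 16"
  proof -
    have "norm (matrix_coeffs x' y) \<le> sqrt \<beta> * \<rho>"
      unfolding x'_def matrix_coeffs_scaleC_left[OF uz] norm_scaleC
      using nu2 sb by (simp add: mult_left_mono)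
    then show ?thesis using \<beta> by (simp add: \<rho>_def)
  qed
  have m: "matrix_coeffs x' y' = (\<Sum>v\<in>F. f v *\<^sub>C matrix_coeffs (W u z) (W v (W u z)))"
  proof -
    have "matrix_coeffs x' y' = (of_real (sqrt \<beta>) * of_real (1 / sqrt \<beta>)) *\<^sub>C matrix_coeffs (W u z) h"
      unfolding x'_def y'_def
      by (simp add: matrix_coeffs_scaleC_left[OF uz] matrix_coeffs_scaleC_right[OF uz] scaleC_scaleC del: word_op.simps)
    also have "of_real (sqrt \<beta>) * of_real (1 / sqrt \<beta>) = (1::complex)" using sb by (simp flip: of_real_mult)
    finally show ?thesis
      by (simp add: h_def matrix_coeffs_sum_right[OF uz] matrix_coeffs_scaleC_right[OF uz])
  qed
  have r3: "norm ((\<Sum>v\<in>F. f v *\<^sub>C ket v) - matrix_coeffs x' y') \<le> \<beta> / 16"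
  proof -
    have "(\<Sum>v\<in>F. f v *\<^sub>C ket v) - matrix_coeffs x' y'
        = (\<Sum>v\<in>F. f v *\<^sub>C (ket v - matrix_coeffs (W u z) (W v (W u z))))"
      by (simp add: m scaleC.diff_right sum_subtractf)
    also have "norm \<dots> \<le> (\<Sum>v\<in>F. cmod (f v) * \<nu>)"
    proof (rule sum_norm_le)
      fix v assume v: "v \<in> F"
      have "norm (ket v - matrix_coeffs (W u z) (W v (W u z))) \<le> \<nu>"
        using norm_matrix_coeffs_unbordered[OF ab z(1,2) K(3)[OF v]] nu1
        unfolding u_def by (simp only: norm_minus_commute)
      then show "norm (f v *\<^sub>C (ket v - matrix_coeffs (W u z) (W v (W u z)))) \<le> cmod (f v) * \<nu>"
        by (simp add: norm_scaleC mult_left_mono)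
    qed
    also have "\<dots> \<le> N * \<nu>" unfolding sum_distrib_right[symmetric] using N \<nu>\<rho> by (intro mult_right_mono) auto
    also have "\<dots> = \<beta> / 16" using N by (simp add: \<nu>_def)
    finally show ?thesis .
  qed
  show thesis
  proof
    show "x + x' \<in> bounded_vectors" by (rule bounded_vectors_add[OF x x'L])
    show "(norm x')\<^sup>2 \<le> \<beta>" using z(2) \<beta> by (simp add: x'_def norm_scaleC power_mult_distrib)
    show "(norm y')\<^sup>2 \<le> \<beta>"
      using nh \<beta> by (simp add: y'_def norm_scaleC norm_divide power_divide power_mult_distrib divide_le_eq power2_eq_square)
    have "g - matrix_coeffs (x + x') (y + y')
        = (e - (\<Sum>v\<in>F. f v *\<^sub>C ket v)) + ((\<Sum>v\<in>F. f v *\<^sub>C ket v) - matrix_coeffs x' y')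
          + (- matrix_coeffs x y') + (- matrix_coeffs x' y)"
      by (simp add: e_def matrix_coeffs_add_left[OF x x'L] matrix_coeffs_add_right[OF x] matrix_coeffs_add_right[OF x'L])
    also have "norm \<dots> \<le> \<beta> / 16 + \<beta> / 16 + \<beta> / 16 + \<beta> / 16"
      using r1 r2 by (intro norm_triangle_mono F(2) r3) (simp_all only: norm_minus_cancel)
    finally show "norm (g - matrix_coeffs (x + x') (y + y')) \<le> \<beta> / 4" by simp
  qed
qed

text \<open>One nonzero bounded vector starts the iterated correction towards \<open>ket []\<close>.
  The limit \<open>X\<close> may fail to be bounded, so the coefficients are passed to the limit one
  word at a time. The limit \<open>Y\<close> then separates \<open>X\<close> from its proper images,
  with distance at least \<open>1 / norm Y\<close>.\<close>

lemma bounded_vectors_trivial: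
  fixes a b :: 'i
  assumes ab: "a \<noteq> b"
  shows "bounded_vectors \<subseteq> {0}"
proof (rule ccontr)
  assume "\<not> ?thesis"
  then obtain z0 where z0: "z0 \<in> bounded_vectors" "z0 \<noteq> 0" by blast
  \<comment> \<open>The start \<open>(0, 0)\<close> has error 1. A correction at error
    \<open>(1/4)^n\<close> moves both vectors by at most \<open>(1/2)^n\<close>, which is
    summable.\<close>
  define P where "P n s \<longleftrightarrow> fst s \<in> bounded_vectors \<and> norm (ket [] - matrix_coeffs (fst s) (snd s)) \<le> (1/4) ^ n"
    for n and s :: "'a \<times> 'a"
  define Q where "Q n s t \<longleftrightarrow> norm (fst t - fst s) \<le> (1/2) ^ n \<and> norm (snd t - snd s) \<le> (1/2) ^ n"
    for n :: nat and s t :: "'a \<times> 'a"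
  have P0: "\<exists>s. P 0 s"
    by (intro exI[of _ "(0, 0)"]) (simp add: P_def zero_bounded matrix_coeffs_zero_right)
  have PS: "\<exists>t. P (Suc n) t \<and> Q n s t" if "P n s" for n s
  proof -
    from that have s: "fst s \<in> bounded_vectors" "norm (ket [] - matrix_coeffs (fst s) (snd s)) \<le> (1/4) ^ n"
      by (simp_all add: P_def)
    obtain x' y' where xy: "fst s + x' \<in> bounded_vectors" "(norm x')\<^sup>2 \<le> (1/4) ^ n" "(norm y')\<^sup>2 \<le> (1/4) ^ n"
      "norm (ket [] - matrix_coeffs (fst s + x') (snd s + y')) \<le> (1/4) ^ n / 4"
      by (rule matrix_coeffs_correction[OF ab z0 s(1) _ s(2)]) simp
    have q: "((1/4)::real) ^ n = ((1/2) ^ n)\<^sup>2" by (simp add: power2_eq_square flip: power_mult_distrib)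
    have "norm x' \<le> (1/2) ^ n" "norm y' \<le> (1/2) ^ n"
      by (rule power2_le_imp_le[OF xy(2)[unfolded q]], simp, rule power2_le_imp_le[OF xy(3)[unfolded q]], simp)
    then show ?thesis using xy(1,4)
      by (intro exI[of _ "(fst s + x', snd s + y')"]) (simp add: P_def Q_def)
  qed
  obtain s where s: "\<And>n. P n (s n)" "\<And>n. Q n (s n) (s (Suc n))"
    using dependent_nat_choice[of P Q, OF P0 PS] by blast
  have conv: "\<exists>l. X \<longlonglongrightarrow> l" if X: "\<And>n. norm (X (Suc n) - X n) \<le> (1/2) ^ n" for X :: "nat \<Rightarrow> 'a"
  proof -
    have "summable (\<lambda>n. X (Suc n) - X n)"
      by (rule summable_comparison_test'[of "\<lambda>n. (1/2) ^ n" 0]) (use X in \<open>auto intro: summable_geometric\<close>)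
    then have "(\<lambda>n. X n - X 0) \<longlonglongrightarrow> (\<Sum>n. X (Suc n) - X n)"
      by (subst sum_lessThan_telescope[symmetric]) (rule summable_LIMSEQ)
    from tendsto_add[OF this tendsto_const[of "X 0"]] show ?thesis by auto
  qed
  obtain X where X: "(\<lambda>n. fst (s n)) \<longlonglongrightarrow> X" using conv[of "\<lambda>n. fst (s n)"] s(2) by (auto simp: Q_def)
  obtain Y where Y: "(\<lambda>n. snd (s n)) \<longlonglongrightarrow> Y" using conv[of "\<lambda>n. snd (s n)"] s(2) by (auto simp: Q_def)
  have XY: "cinner (W w X) Y = (if w = [] then 1 else 0)" for w
  proof (rule LIMSEQ_unique)
    show "(\<lambda>n. cinner (W w (fst (s n))) (snd (s n))) \<longlonglongrightarrow> cinner (W w X) Y"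
      by (intro cinner.tendsto bounded_clinear_tendsto[OF W_bounded] X Y)
    have "(\<lambda>n. (if w = [] then 1 else 0) - cinner (W w (fst (s n))) (snd (s n))) \<longlonglongrightarrow> 0"
    proof (rule Lim_null_comparison)
      show "\<forall>\<^sub>F n in sequentially. norm ((if w = [] then 1 else 0) - cinner (W w (fst (s n))) (snd (s n))) \<le> (1/4) ^ n"
      proof (intro always_eventually allI)
        fix n
        have sn: "fst (s n) \<in> bounded_vectors" "norm (ket [] - matrix_coeffs (fst (s n)) (snd (s n))) \<le> (1/4) ^ n"
          using s(1)[of n] by (simp_all add: P_def)
        have "(if w = [] then 1 else 0) - cinner (W w (fst (s n))) (snd (s n))
            = ell2_coord (ket [] - matrix_coeffs (fst (s n)) (snd (s n))) w"
          by (simp add: minus_ell2.rep_eq ket.rep_eq matrix_coeffs_coord[OF sn(1)])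
        then show "norm ((if w = [] then 1 else 0) - cinner (W w (fst (s n))) (snd (s n))) \<le> (1/4) ^ n"
          using ell2_coord_le_norm[of "ket [] - matrix_coeffs (fst (s n)) (snd (s n))" w] sn(2) by simp
      qed
      show "(\<lambda>n. (1/4::real) ^ n) \<longlonglongrightarrow> 0" by (intro LIMSEQ_power_zero) simp
    qed
    from tendsto_diff[OF tendsto_const[of "if w = [] then 1 else 0"] this]
    show "(\<lambda>n. cinner (W w (fst (s n))) (snd (s n))) \<longlonglongrightarrow> (if w = [] then 1 else 0)" by simp
  qed
  have "cinner X Y = 1" using XY[of "[]"] by simp
  then have Y0: "norm Y > 0" by auto
  have "(1 / norm Y)\<^sup>2 \<le> (norm (X + p X))\<^sup>2" if p: "p \<in> proper_polys S" for p
  proof -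
    have "cinner (p X) Y = 0"
      using p
    proof (induction rule: proper_polys.induct)
      case (add p w c)
      then show ?case by (simp add: cinner_add_left cinner_scaleC_left XY)
    qed simp
    then have "1 = cmod (cinner (X + p X) Y)" using \<open>cinner X Y = 1\<close> by (simp add: cinner_add_left)
    also have "\<dots> \<le> norm (X + p X) * norm Y" by (rule norm_cinner_le)
    finally have "1 / norm Y \<le> norm (X + p X)" using Y0 by (simp add: divide_le_eq)
    then show ?thesis by (intro power_mono) auto
  qed
  moreover have "(1 / norm Y)\<^sup>2 > 0" using Y0 by simp
  ultimately show False using wandering_if_positive_distance no_wandering by blast
qed

end

theorem theorem4p12:
  fixes S :: "'i::countable \<Rightarrow> 'a::complex_hilbert \<Rightarrow> 'a"
  assumes "isometries_with_orthogonal_ranges S"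
    and "type_L S"
  shows "\<exists>x. wandering S x"
proof (rule ccontr)
  assume no: "\<not> (\<exists>x. wandering S x)"
  interpret isometries_without_wandering_vector S
    by unfold_locales (fact assms(1) no)+
  obtain J :: "('a \<times> 'a) set" and z where J: "finite J"
    and z: "\<And>u v. (\<Sum>j\<in>J. cinner (W u (z j)) (W v (z j))) = (if u = v then 1 else 0)"
    by (rule wandering_family_if_id_not_in_closure[OF id_not_in_closure_if_type_L[OF assms(2)]]) blast
  show False
  proof (cases "\<exists>a b::'i. a \<noteq> b")
    case True
    then obtain a b :: 'i where ab: "a \<noteq> b" by blast
    \<comment> \<open>Membership in the wandering family gives the Bessel bound with constant 1. All
      \<open>z j\<close> then vanish, against total squared norm 1.\<close>
    have "z j \<in> bounded_vectors" if j: "j \<in> J" for j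
      unfolding bounded_vectors_def
    proof (intro CollectI exI[of _ 1] conjI allI impI)
      fix y and F :: "'i list set" assume F: "finite F"
      have "cmod (cinner (W w (z j)) y) = cmod (cinner y (W w (z j)))" for w
        by (subst cinner_cnj) simp
      then show "(\<Sum>w\<in>F. (cmod (cinner (W w (z j)) y))\<^sup>2) \<le> 1 * (norm y)\<^sup>2"
        using bessel_wandering_family[OF J j z F, of y] by simp
    qed simp
    then have "z j = 0" if "j \<in> J" for j using bounded_vectors_trivial[OF ab] that by blast
    then have "(\<Sum>j\<in>J. cinner (W [] (z j)) (W [] (z j))) = 0" by (intro sum.neutral) simp
    then show False using z[of "[]" "[]"] by simp
  next
    case False
    then show False using wandering_if_single_generator[OF _ J z] no by blast
  qed
qed

end
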